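(* (Rule of Signs) Let $\xi(t)=\beta^{2}\sum_{p\geq2}\beta_{p}^{2}t^{p}$, not identically zero, satisfy $\xi(1+\epsilon)<\infty$ for some $\epsilon>0$, let $h\ge 0$, and set $$\mathfrak{d}=\left(\frac{1}{\sqrt{\xi''}}\right)''.$$ Let $\eta$ be optimal for the dual problem $\max_{\eta\in\Lambda_{\xi,h}}D_{\xi,h}(\eta)$ and let $0\leq a<b<1$. Write $\{\eta=\xi\}=\{s\in[0,1):\eta(s)=\xi(s)\}$. Then: (1) If $\mathfrak{d}>0$ on $(a,b)$, then $\mathrm{card}(\{\eta=\xi\}\cap[a,b])\leq2$. (2) If $\mathfrak{d}\leq0$ on $[a,b]$ and $a,b\in\{\eta=\xi\}$, then $[a,b]\subset\{\eta=\xi\}$.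
   Context: Here $\beta$ and $\beta_p$ ($p\ge2$) are real numbers. The function $\mathfrak d$ is defined at the points of $[0,1]$ where $\xi''>0$, i.e. on $(0,1]$, and also at $0$ when $\xi''(0)>0$. Let $X=\{\eta:\eta\in C^{1}([0,1)),\ \eta'\in Lip_{\mathrm{loc}}([0,1))\}$, where $\eta$ is real-valued and may blow up at $1$ and $Lip_{\mathrm{loc}}$ denotes locally Lipschitz functions. For $\eta\in X$, the second distributional derivative $\eta''$ is identified with an a.e. unique measurable function, essentially bounded on each $[0,1-\delta]$, $\delta>0$. Let $$\Lambda_{\xi,h}=\left\{ \eta\in X:\ \eta\geq\xi \text{ on } [0,1),\ \eta'(0)=-h^{2},\ \eta''\geq0\ \text{Lebesgue-a.e.}\right\}$$ and define $D_{\xi,h}:\Lambda_{\xi,h}\to[-\infty,\infty)$ by $$D_{\xi,h}(\eta)=\frac{1}{2}\left(\int_{0}^{1}\left(2\sqrt{\eta''(s)}-\eta''(s)(1-s)-\frac{1}{1-s}\right)ds-\eta(0)+h^{2}+\xi(1)\right),$$ where the integrand is non-positive by the arithmetic-geometric mean inequality. "Optimal" means that $\eta\in\Lambda_{\xi,h}$ attains the maximum of $D_{\xi,h}$ over $\Lambda_{\xi,h}$. *)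

theory Defs
  imports "HOL-Analysis.Analysis"
begin

text \<open>The index is shifted so that the sum starts with the coefficient \<open>b 2\<close>. The value is
  meaningful only where the series converges.\<close>

definition mixture :: "real \<Rightarrow> (nat \<Rightarrow> real) \<Rightarrow> real \<Rightarrow> real" where
  "mixture \<beta> b t = \<beta>\<^sup>2 * (\<Sum>p. (b (p + 2))\<^sup>2 * t ^ (p + 2))"

definition sign_dom :: "(real \<Rightarrow> real) \<Rightarrow> real set" where
  "sign_dom \<xi> = {t \<in> {0..1}. (deriv ^^ 2) \<xi> t > 0}"

text \<open>Meaningful only on \<open>sign_dom \<xi>\<close>. The derivatives are two-sided; at the end points of
  \<open>[0,1]\<close> this is harmless for a power series with radius of convergence greater than one.\<close>

definition sign_fun :: "(real \<Rightarrow> real) \<Rightarrow> real \<Rightarrow> real" where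
  "sign_fun \<xi> = (deriv ^^ 2) (\<lambda>t. 1 / sqrt ((deriv ^^ 2) \<xi> t))"

text \<open>A function on \<open>[0,1)\<close> is a total function of which only the values on \<open>{0..<1}\<close> matter;
  accordingly its derivative is taken within \<open>{0..<1}\<close>, hence one-sided at \<open>0\<close>.\<close>

definition deriv01 :: "(real \<Rightarrow> real) \<Rightarrow> real \<Rightarrow> real" where
  "deriv01 \<eta> s = vector_derivative \<eta> (at s within {0..<1})"

definition lip_loc01 :: "(real \<Rightarrow> real) \<Rightarrow> bool" where
  "lip_loc01 f \<longleftrightarrow>
     (\<forall>x\<in>{0..<1}. \<exists>u>0. \<exists>L. L-lipschitz_on (cball x u \<inter> {0..<1}) f)"

definition X_space :: "(real \<Rightarrow> real) set" where
  "X_space = {\<eta>. \<eta> differentiable_on {0..<1} \<and> continuous_on {0..<1} (deriv01 \<eta>) \<and>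
                 lip_loc01 (deriv01 \<eta>)}"

definition test_fun01 :: "(real \<Rightarrow> real) \<Rightarrow> bool" where
  "test_fun01 \<phi> \<longleftrightarrow>
     (\<forall>n. (deriv ^^ n) \<phi> differentiable_on UNIV) \<and>
     (\<exists>c d. 0 < c \<and> c \<le> d \<and> d < 1 \<and> (\<forall>x. x \<notin> {c..d} \<longrightarrow> \<phi> x = 0))"

text \<open>\<open>g\<close> represents the second distributional derivative of \<open>\<eta>\<close> on \<open>(0,1)\<close>.\<close>

definition is_second_distr_deriv :: "(real \<Rightarrow> real) \<Rightarrow> (real \<Rightarrow> real) \<Rightarrow> bool" where
  "is_second_distr_deriv \<eta> g \<longleftrightarrow>
     set_borel_measurable lebesgue {0..<1} g \<and>
     (\<forall>\<delta>>0. \<exists>C. AE s in lebesgue. s \<in> {0..1 - \<delta>} \<longrightarrow> \<bar>g s\<bar> \<le> C) \<and>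
     (\<forall>\<phi>. test_fun01 \<phi> \<longrightarrow>
        (LINT s:{0<..<1}|lebesgue. \<eta> s * (deriv ^^ 2) \<phi> s) =
        (LINT s:{0<..<1}|lebesgue. g s * \<phi> s))"

text \<open>Every \<open>\<eta> \<in> X_space\<close> has such a \<open>g\<close>, unique almost everywhere on \<open>[0,1)\<close>; the notions
  below do not depend on the representative.\<close>

definition second_deriv :: "(real \<Rightarrow> real) \<Rightarrow> real \<Rightarrow> real" where
  "second_deriv \<eta> = (SOME g. is_second_distr_deriv \<eta> g)"

definition Lambda :: "(real \<Rightarrow> real) \<Rightarrow> real \<Rightarrow> (real \<Rightarrow> real) set" where
  "Lambda \<xi> h = {\<eta> \<in> X_space.
     (\<forall>s\<in>{0..<1}. \<eta> s \<ge> \<xi> s) \<and>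
     deriv01 \<eta> 0 = - h\<^sup>2 \<and>
     (AE s in lebesgue. s \<in> {0..<1} \<longrightarrow> second_deriv \<eta> s \<ge> 0)}"

definition dual_integrand :: "(real \<Rightarrow> real) \<Rightarrow> real \<Rightarrow> real" where
  "dual_integrand \<eta> s =
     2 * sqrt (second_deriv \<eta> s) - second_deriv \<eta> s * (1 - s) - 1 / (1 - s)"

text \<open>The integrand is non-positive, so its integral, with values in \<open>[-\<infinity>,0]\<close>, is the negative of
  the non-negative integral of its negation.\<close>

definition dual_fun :: "(real \<Rightarrow> real) \<Rightarrow> real \<Rightarrow> (real \<Rightarrow> real) \<Rightarrow> ereal" where
  "dual_fun \<xi> h \<eta> = ereal (1 / 2) *
     (- enn2ereal (\<integral>\<^sup>+s\<in>{0..<1}. ennreal (- dual_integrand \<eta> s) \<partial>lebesgue)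
      + ereal (- \<eta> 0 + h\<^sup>2 + \<xi> 1))"

definition optimal :: "(real \<Rightarrow> real) \<Rightarrow> real \<Rightarrow> (real \<Rightarrow> real) \<Rightarrow> bool" where
  "optimal \<xi> h \<eta> \<longleftrightarrow>
     \<eta> \<in> Lambda \<xi> h \<and> (\<forall>\<zeta>\<in>Lambda \<xi> h. dual_fun \<xi> h \<zeta> \<le> dual_fun \<xi> h \<eta>)"

definition contact_set :: "(real \<Rightarrow> real) \<Rightarrow> (real \<Rightarrow> real) \<Rightarrow> real set" where
  "contact_set \<xi> \<eta> = {s \<in> {0..<1}. \<eta> s = \<xi> s}"

end

theory Submission
  imports Defs
begin

text \<open>Write \<open>f = \<eta> - \<xi> \<ge> 0\<close>, \<open>G = \<eta>''\<close> and \<open>g = 1 / sqrt \<xi>''\<close>, so that the sign function is \<open>g''\<close>.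
  At a contact point \<open>f\<close> has a minimum, hence \<open>f' = 0\<close> there; at the end point \<open>0\<close> this
  holds because \<open>\<xi>' 0 = 0\<close> and \<open>\<eta>' 0 = - h\<^sup>2 \<le> 0\<close>.

  Both parts compare \<open>\<eta>\<close> with one competitor \<open>\<eta> + v\<close>, where \<open>v'' = w\<close> is supported in a compact
  interval \<open>K\<close> of \<open>[0,1)\<close> and has vanishing integral and first moment. Then \<open>v\<close> vanishes outside
  \<open>K\<close>, and of the dual functional only \<open>\<integral> sqrt \<eta>''\<close> changes. Optimality therefore says
  \<open>\<integral>\<^sub>K sqrt (G + w) \<le> \<integral>\<^sub>K sqrt G\<close> as soon as \<open>\<eta> + v\<close> is convex and above \<open>\<xi>\<close>; this is
  \<open>comparison_principle\<close>.

  If \<open>g'' \<le> 0\<close> on \<open>[a,c]\<close> and both end points are contact points, let the competitor follow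
  \<open>\<xi>\<close> on \<open>[a,c]\<close>. This gives \<open>\<integral> sqrt \<xi>'' \<le> \<integral> sqrt G\<close>. By concavity of the square root,
  \<open>sqrt G \<le> sqrt \<xi>'' + f'' g / 2\<close>, with equality only where \<open>G = \<xi>''\<close>, and two integrations by parts
  give \<open>\<integral> f'' g = \<integral> f g'' \<le> 0\<close>. So \<open>G = \<xi>''\<close> almost everywhere and \<open>f = 0\<close> on \<open>[a,c]\<close>
  (\<open>contact_interval\<close>). If \<open>a = 0\<close>, the argument needs \<open>\<xi>'' 0 > 0\<close>: otherwise \<open>g\<close> would be a
  concave function with limit \<open>\<infinity>\<close> at \<open>0\<close>.

  If \<open>g'' > 0\<close> and there are three contact points \<open>s1 < s2 < s3\<close>, then \<open>f'\<close> vanishes at all of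
  them, so \<open>G \<le> \<xi>''\<close> on sets \<open>A\<close> and \<open>C\<close> of positive measure in the two gaps, and
  \<open>G \<ge> \<xi>''\<close> on a set \<open>B\<close> of positive measure immediately to the right of \<open>s2\<close>, since \<open>f \<ge> 0 = f s2\<close>.
  Take \<open>w = t (p 1\<^sub>A + q 1\<^sub>C - 1\<^sub>B)\<close> with vanishing moments. As \<open>B\<close> lies between \<open>A\<close> and \<open>C\<close>,
  testing \<open>w\<close> against a convex function gives a non-negative number; hence \<open>v \<ge> 0\<close>, and the competitor
  is admissible for small \<open>t\<close>. By concavity of the square root the gain is at least what it would be
  if \<open>G\<close> were replaced by \<open>\<xi>''\<close>, that is, \<open>t/2 \<integral> g w - O(t\<^sup>2)\<close>, and \<open>\<integral> g w > 0\<close> by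
  strict convexity of \<open>g\<close>. This contradicts optimality (\<open>no_three_contacts\<close>).

  The functional refers to an arbitrarily chosen representative of the distributional second
  derivative. To compute with it, one needs that \<open>\<eta>'\<close> has a locally bounded Borel density, which
  comes from the Radon-Nikodym theorem (\<open>lipschitz_density\<close>), and that test functions determine such a
  density almost everywhere (\<open>test_functions_separate\<close>).\<close>

section \<open>Integration by parts against a bounded density\<close>

lemma ess_bounded_set_integrable:
  fixes w :: "real \<Rightarrow> real"
  assumes "w \<in> borel_measurable borel" "AE r in lborel. r \<in> {a..b} \<longrightarrow> \<bar>w r\<bar> \<le> C"
  shows "set_integrable lborel {a..b} w"
  unfolding set_integrable_def
proof (rule Bochner_Integration.integrable_bound)
  show "integrable lborel (\<lambda>x. indicator {a..b} x *\<^sub>R C)"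
    by (rule integrable_scaleR_left) (auto intro!: integrable_real_indicator simp: emeasure_lborel_Icc_eq)
  show "(\<lambda>x. indicat_real {a..b} x *\<^sub>R w x) \<in> borel_measurable lborel"
    using assms(1) by measurable
  show "AE x in lborel. norm (indicat_real {a..b} x *\<^sub>R w x) \<le> norm (indicat_real {a..b} x *\<^sub>R C)"
    using assms(2) by eventually_elim (auto simp: indicator_def)
qed

lemma bounded_borel_set_integrable:
  fixes w :: "real \<Rightarrow> real"
  assumes "w \<in> borel_measurable borel" "\<And>r. r \<in> {a..b} \<Longrightarrow> \<bar>w r\<bar> \<le> C"
  shows "set_integrable lborel {a..b} w"
  by (rule ess_bounded_set_integrable[of w a b C]) (use assms in auto)

lemma bounded_borel_integrable_on:
  fixes w :: "real \<Rightarrow> real"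
  assumes "w \<in> borel_measurable borel" "\<And>r. r \<in> {a..b} \<Longrightarrow> \<bar>w r\<bar> \<le> C"
  shows "w integrable_on {a..b}"
  using set_borel_integral_eq_integral(1)[OF bounded_borel_set_integrable[OF assms]] by simp

lemma abs_integral_le_quadratic:
  fixes f :: "real \<Rightarrow> real"
  assumes "f integrable_on {x..y}" "x \<le> y" "\<And>r. r \<in> {x..y} \<Longrightarrow> \<bar>f r\<bar> \<le> K * (y - x)"
  shows "\<bar>integral {x..y} f\<bar> \<le> K * (y - x)\<^sup>2"
proof -
  have "norm (integral {x..y} f) \<le> (K * (y - x)) * measure lborel (cbox x y)"
  proof (rule has_integral_bound[where f = f and i = "integral {x..y} f"])
    show "0 \<le> K * (y - x)" using assms(3)[of x] assms(2) by force
    show "(f has_integral integral {x..y} f) (cbox x y)" using assms(1) by (simp add: integrable_integral)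
    show "\<And>xa. xa \<in> cbox x y \<Longrightarrow> norm (f xa) \<le> K * (y - x)" using assms(3) by simp
  qed
  then show ?thesis using assms(2) by (simp add: power2_eq_square)
qed

text \<open>The hypothesis makes the derivative of \<open>J\<close> vanish everywhere. In this form the statement
  applies to differences of indefinite integrals of discontinuous functions.\<close>

lemma constant_if_quadratic_modulus:
  fixes J :: "real \<Rightarrow> real"
  assumes J: "\<And>x y. a \<le> x \<Longrightarrow> x \<le> y \<Longrightarrow> y \<le> b \<Longrightarrow> \<bar>J y - J x\<bar> \<le> K * (y - x)\<^sup>2" and "a \<le> b"
  shows "J b = J a"
proof -
  have sym: "\<bar>J y - J x\<bar> \<le> K * (y - x)\<^sup>2" if "x \<in> {a..b}" "y \<in> {a..b}" for x y
    using J[of x y] J[of y x] that by (cases "x \<le> y") (auto simp: abs_minus_commute power2_commute)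
  have "(J has_derivative (\<lambda>h. 0)) (at x within {a..b})" if x: "x \<in> {a..b}" for x
    unfolding has_derivative_within_alt
  proof (intro conjI allI impI)
    fix e :: real assume e: "e > 0"
    define d where "d = e / (\<bar>K\<bar> + 1)"
    have d: "d > 0" using e by (simp add: d_def)
    have "norm (J y - J x - 0) \<le> e * norm (y - x)" if y: "y \<in> {a..b}" "norm (y - x) < d" for y
    proof -
      have "\<bar>J y - J x\<bar> \<le> K * (y - x)\<^sup>2" by (rule sym) (use x y in auto)
      also have "\<dots> \<le> (\<bar>K\<bar> + 1) * (\<bar>y - x\<bar> * \<bar>y - x\<bar>)"
        by (simp add: power2_eq_square[symmetric]) (simp add: mult_right_mono)
      also have "\<dots> \<le> (\<bar>K\<bar> + 1) * (d * \<bar>y - x\<bar>)"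
        using y(2) by (intro mult_left_mono mult_right_mono) auto
      also have "\<dots> = e * \<bar>y - x\<bar>" by (simp add: d_def)
      finally show ?thesis by simp
    qed
    then show "\<exists>d>0. \<forall>y\<in>{a..b}. norm (y - x) < d \<longrightarrow> norm (J y - J x - 0) \<le> e * norm (y - x)"
      using d by blast
  qed simp
  then have "\<exists>c. \<forall>x\<in>{a..b}. J x = c"
    by (intro has_derivative_zero_constant) auto
  then show ?thesis using \<open>a \<le> b\<close> by auto
qed

text \<open>The function \<open>F\<close> is the indefinite integral of a bounded \<open>w\<close> and need not be differentiable.
  Over \<open>[x,y]\<close>, freezing \<open>g\<close> at \<open>y\<close> and \<open>F\<close> at \<open>x\<close> makes the identity exact; the two freezing errors are
  of order \<open>(y - x)\<^sup>2\<close>, so the difference of both sides is constant.\<close>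

lemma integral_by_parts_density:
  fixes w F g g' :: "real \<Rightarrow> real"
  assumes ab: "a \<le> b"
    and w: "w \<in> borel_measurable borel" "\<And>r. r \<in> {a..b} \<Longrightarrow> \<bar>w r\<bar> \<le> C"
    and F: "\<And>x y. a \<le> x \<Longrightarrow> x \<le> y \<Longrightarrow> y \<le> b \<Longrightarrow> F y - F x = integral {x..y} w"
    and g: "\<And>x. x \<in> {a..b} \<Longrightarrow> (g has_real_derivative g' x) (at x within {a..b})"
    and g': "continuous_on {a..b} g'"
  shows "(\<lambda>r. w r * g r) integrable_on {a..b}"
    and "integral {a..b} (\<lambda>r. w r * g r) = F b * g b - F a * g a - integral {a..b} (\<lambda>r. F r * g' r)"
proof -
  have Cpos: "C \<ge> 0" using w(2)[of a] ab by force
  have wint: "w integrable_on {x..y}" if "a \<le> x" "y \<le> b" for x y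
    by (rule bounded_borel_integrable_on[OF w(1), of _ _ C]) (use w(2) that in auto)
  obtain M0 where "\<And>r. r \<in> {a..b} \<Longrightarrow> norm (g' r) \<le> M0"
    using continuous_on_compact_bound[OF compact_Icc g'] by metis
  then obtain M where M: "\<And>r. r \<in> {a..b} \<Longrightarrow> \<bar>g' r\<bar> \<le> M" and M0: "M \<ge> 0"
    using ab by (metis abs_ge_zero atLeastAtMost_iff dual_order.refl order_trans real_norm_def)
  have gcont: "continuous_on {a..b} g"
    using g DERIV_continuous continuous_on_eq_continuous_within by blast
  have gint: "(g' has_integral (g y - g x)) {x..y}" if "a \<le> x" "x \<le> y" "y \<le> b" for x y
    using that by (intro fundamental_theorem_of_calculus has_real_derivative_iff_has_vector_derivative[THEN iffD1])
      (auto intro: DERIV_subset[OF g])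
  have glip: "\<bar>g y - g x\<bar> \<le> M * (y - x)" if "a \<le> x" "x \<le> y" "y \<le> b" for x y
  proof -
    have "norm (g y - g x) \<le> M * measure lborel (cbox x y)"
      by (rule has_integral_bound[of M g']) (use gint[OF that] M M0 that in auto)
    then show ?thesis using that by simp
  qed
  have Flip: "\<bar>F y - F x\<bar> \<le> C * (y - x)" if "a \<le> x" "x \<le> y" "y \<le> b" for x y
  proof -
    have "norm (F y - F x) \<le> C * measure lborel (cbox x y)"
      by (rule has_integral_bound[of C w])
        (use F[OF that] wint[of x y] w(2) Cpos that in \<open>auto simp: integrable_integral\<close>)
    then show ?thesis using that by simp
  qed
  have "C-lipschitz_on {a..b} F"
  proof (rule lipschitz_onI[OF _ Cpos])
    fix x y assume "x \<in> {a..b}" "y \<in> {a..b}"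
    then show "dist (F x) (F y) \<le> C * dist x y"
      using Flip[of x y] Flip[of y x] by (cases "x \<le> y") (auto simp: dist_real_def abs_minus_commute)
  qed
  then have Fcont: "continuous_on {a..b} F" by (rule lipschitz_on_continuous_on)
  have gbd: "bounded (g ` {a..b})" using gcont compact_continuous_image compact_imp_bounded by blast
  have wg_abs: "(\<lambda>r. w r * g r) absolutely_integrable_on {a..b}"
  proof -
    have "set_integrable lborel {a..b} w"
      by (rule bounded_borel_set_integrable[OF w(1), of _ _ C]) (use w(2) in auto)
    then have "w absolutely_integrable_on {a..b}"
      unfolding set_integrable_def by (simp add: integrable_completion borel_measurable_integrable)
    moreover have "g \<in> borel_measurable (lebesgue_on {a..b})"
      by (rule continuous_imp_measurable_on_sets_lebesgue[OF gcont]) auto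
    ultimately have "(\<lambda>r. g r * w r) absolutely_integrable_on {a..b}"
      by (intro absolutely_integrable_bounded_measurable_product_real) (auto simp: gbd)
    then show ?thesis by (simp add: mult.commute)
  qed
  show wgint: "(\<lambda>r. w r * g r) integrable_on {a..b}"
    using wg_abs by (rule set_lebesgue_integral_eq_integral(1))
  have wgint': "(\<lambda>r. w r * g r) integrable_on {x..y}" if "a \<le> x" "y \<le> b" for x y
    using integrable_on_subinterval[OF wgint] that by auto
  have Fg'int: "(\<lambda>r. F r * g' r) integrable_on {x..y}" if "a \<le> x" "y \<le> b" for x y
    by (intro integrable_continuous_interval continuous_on_mult
        continuous_on_subset[OF Fcont] continuous_on_subset[OF g']) (use that in auto)
  define J where "J x = integral {a..x} (\<lambda>r. w r * g r) - F x * g x + integral {a..x} (\<lambda>r. F r * g' r)" for x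
  have "J b = J a"
  proof (rule constant_if_quadratic_modulus[where K = "C * M + C * M", OF _ ab])
    fix x y assume xy: "a \<le> x" "x \<le> y" "y \<le> b"
    have 1: "integral {a..y} (\<lambda>r. w r * g r) = integral {a..x} (\<lambda>r. w r * g r) + integral {x..y} (\<lambda>r. w r * g r)"
      using Henstock_Kurzweil_Integration.integral_combine[OF xy(1,2) wgint'[of a y]] xy by simp
    have 2: "integral {a..y} (\<lambda>r. F r * g' r) = integral {a..x} (\<lambda>r. F r * g' r) + integral {x..y} (\<lambda>r. F r * g' r)"
      using Henstock_Kurzweil_Integration.integral_combine[OF xy(1,2) Fg'int[of a y]] xy by simp
    have 3: "(F y - F x) * g y = integral {x..y} (\<lambda>r. w r * g y)"
      using F[OF xy] by simp
    have 4: "F x * (g y - g x) = integral {x..y} (\<lambda>r. F x * g' r)"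
      using gint[OF xy] by (simp add: integral_unique)
    have i3: "(\<lambda>r. w r * g y) integrable_on {x..y}" using wint[of x y] xy by (simp add: integrable_on_mult_left)
    have i4: "(\<lambda>r. F x * g' r) integrable_on {x..y}"
      using gint[OF xy] by (intro integrable_on_mult_right) auto
    have 5: "integral {x..y} (\<lambda>r. w r * g r) - integral {x..y} (\<lambda>r. w r * g y) = integral {x..y} (\<lambda>r. w r * g r - w r * g y)"
      by (rule Henstock_Kurzweil_Integration.integral_diff[symmetric]) (use wgint'[of x y] i3 xy in auto)
    have 6: "integral {x..y} (\<lambda>r. F r * g' r) - integral {x..y} (\<lambda>r. F x * g' r) = integral {x..y} (\<lambda>r. F r * g' r - F x * g' r)"
      by (rule Henstock_Kurzweil_Integration.integral_diff[symmetric]) (use Fg'int[of x y] i4 xy in auto)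
    have "J y - J x = integral {x..y} (\<lambda>r. w r * g r - w r * g y) + integral {x..y} (\<lambda>r. F r * g' r - F x * g' r)"
      unfolding J_def 1 2 5[symmetric] 6[symmetric] 3[symmetric] 4[symmetric] by (simp add: algebra_simps)
    moreover have "\<bar>integral {x..y} (\<lambda>r. w r * g r - w r * g y)\<bar> \<le> (C * M) * (y - x)\<^sup>2"
    proof (rule abs_integral_le_quadratic)
      show "(\<lambda>r. w r * g r - w r * g y) integrable_on {x..y}"
        by (rule Henstock_Kurzweil_Integration.integrable_diff) (use wgint'[of x y] i3 xy in auto)
      fix r assume r: "r \<in> {x..y}"
      have "\<bar>w r * g r - w r * g y\<bar> = \<bar>w r\<bar> * \<bar>g y - g r\<bar>"
        by (simp add: abs_mult[symmetric] algebra_simps abs_minus_commute)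
      also have "\<dots> \<le> C * (M * (y - r))"
        by (rule mult_mono) (use w(2)[of r] glip[of r y] xy r Cpos in auto)
      also have "\<dots> \<le> C * (M * (y - x))"
        using r Cpos M0 by (intro mult_left_mono) auto
      finally show "\<bar>w r * g r - w r * g y\<bar> \<le> C * M * (y - x)" by (simp add: mult.assoc)
    qed (use xy in auto)
    moreover have "\<bar>integral {x..y} (\<lambda>r. F r * g' r - F x * g' r)\<bar> \<le> (C * M) * (y - x)\<^sup>2"
    proof (rule abs_integral_le_quadratic)
      show "(\<lambda>r. F r * g' r - F x * g' r) integrable_on {x..y}"
        by (rule Henstock_Kurzweil_Integration.integrable_diff) (use Fg'int[of x y] i4 xy in auto)
      fix r assume r: "r \<in> {x..y}"
      have "\<bar>F r * g' r - F x * g' r\<bar> = \<bar>F r - F x\<bar> * \<bar>g' r\<bar>"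
        by (simp add: abs_mult[symmetric] algebra_simps)
      also have "\<dots> \<le> (C * (r - x)) * M"
        by (rule mult_mono) (use M[of r] Flip[of x r] xy r Cpos in auto)
      also have "\<dots> \<le> (C * (y - x)) * M"
        using r Cpos M0 by (intro mult_left_mono mult_right_mono) auto
      finally show "\<bar>F r * g' r - F x * g' r\<bar> \<le> C * M * (y - x)" by (simp add: mult_ac)
    qed (use xy in auto)
    ultimately show "\<bar>J y - J x\<bar> \<le> (C * M + C * M) * (y - x)\<^sup>2"
      by (simp add: algebra_simps)
  qed
  then show "integral {a..b} (\<lambda>r. w r * g r) = F b * g b - F a * g a - integral {a..b} (\<lambda>r. F r * g' r)"
    by (simp add: J_def)
qed

section \<open>Densities on an interval\<close>

text \<open>After adding the constant \<open>C\<close> the function becomes a density, and two measures on the line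
  that agree on all half-lines are equal.\<close>

lemma AE_zero_if_interval_integrals_zero:
  fixes k :: "real \<Rightarrow> real"
  assumes k: "k \<in> borel_measurable borel" "\<And>r. r \<in> {a..b} \<Longrightarrow> \<bar>k r\<bar> \<le> C"
    and zero: "\<And>x y. a \<le> x \<Longrightarrow> x \<le> y \<Longrightarrow> y \<le> b \<Longrightarrow> integral {x..y} k = 0"
  shows "AE s in lborel. s \<in> {a..b} \<longrightarrow> k s = 0"
proof -
  define p where "p s = indicator {a..b} s * (k s + C)" for s
  define q where "q s = indicator {a..b} s * C" for s :: real
  have [measurable]: "k \<in> borel_measurable borel" by (rule k)
  have [measurable]: "p \<in> borel_measurable borel" "q \<in> borel_measurable borel"
    unfolding p_def q_def by measurable
  have nn: "p s \<ge> 0" "q s \<ge> 0" for s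
    using k(2)[of s] by (auto simp: p_def q_def indicator_def)
  have int: "set_integrable lborel {x..y} p" "set_integrable lborel {x..y} q" for x y
    by (rule bounded_borel_set_integrable[where C = "2 * \<bar>C\<bar>"]; use k(2) in \<open>fastforce simp: p_def q_def indicator_def\<close>)+
  have em: "emeasure (density lborel f) {x<..} = ennreal (integral {x..max x b} f)"
    if f: "f \<in> {p, q}" for f x
  proof -
    have fm [measurable]: "f \<in> borel_measurable borel" and fn: "\<And>s. f s \<ge> 0"
      and fi: "set_integrable lborel {x..max x b} f" and f0: "\<And>s. s > b \<Longrightarrow> f s = 0"
      using f nn int by (auto simp: p_def q_def)
    have "emeasure (density lborel f) {x<..} = (\<integral>\<^sup>+s. ennreal (f s) * indicator {x<..} s \<partial>lborel)"
      by (rule emeasure_density) measurable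
    also have "\<dots> = (\<integral>\<^sup>+s. ennreal (indicator {x..max x b} s *\<^sub>R f s) \<partial>lborel)"
      using AE_lborel_singleton[of x] by (intro nn_integral_cong_AE) (auto simp: indicator_def f0)
    also have "\<dots> = ennreal (LINT s:{x..max x b}|lborel. f s)"
      unfolding set_lebesgue_integral_def
      by (rule nn_integral_eq_integral) (use fi fn in \<open>auto simp: set_integrable_def\<close>)
    also have "\<dots> = ennreal (integral {x..max x b} f)"
      using set_borel_integral_eq_integral(2)[OF fi] by simp
    finally show ?thesis .
  qed
  have restr: "integral {x..max x b} (\<lambda>s. indicator {a..b} s * f s) = (integral {max x a..b} f :: real)" for f x
  proof -
    have "integral {x..max x b} (\<lambda>s. indicator {a..b} s * f s) = integral ({x..max x b} \<inter> {a..b}) f"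
    proof -
      have "(\<lambda>s. indicator {a..b} s * f s) = (\<lambda>s. if s \<in> {a..b} then f s else 0)"
        by (auto simp: indicator_def fun_eq_iff)
      then show ?thesis by (simp only: integral_restrict_Int Int_commute)
    qed
    also have "{x..max x b} \<inter> {a..b} = {max x a..b}" by auto
    finally show ?thesis .
  qed
  have pq: "integral {x..max x b} p = integral {x..max x b} q" for x
  proof -
    have ki: "k integrable_on {max x a..b}"
      by (rule bounded_borel_integrable_on[OF k(1), of _ _ C]) (use k(2) in auto)
    have "integral {max x a..b} (\<lambda>s. k s + C) = integral {max x a..b} k + integral {max x a..b} (\<lambda>_. C)"
      by (rule Henstock_Kurzweil_Integration.integral_add[OF ki]) (rule integrable_const_ivl)
    moreover have "integral {max x a..b} k = 0"
      by (cases "max x a \<le> b") (auto intro: zero)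
    ultimately show ?thesis unfolding p_def q_def restr by simp
  qed
  have "density lborel p = density lborel q"
    by (rule measure_eqI_lessThan) (auto simp: em pq)
  then have "AE s in lborel. ennreal (p s) = ennreal (q s)"
    by (subst (asm) sigma_finite_measure.density_unique_iff[OF sigma_finite_lborel]) auto
  then show ?thesis
    by eventually_elim (use nn in \<open>auto simp: p_def q_def indicator_def\<close>)
qed

text \<open>Truncation reduces an essential bound to a pointwise one.\<close>

lemma AE_zero_if_interval_integrals_zero_ess:
  fixes k :: "real \<Rightarrow> real"
  assumes k: "k \<in> borel_measurable borel" "AE r in lborel. r \<in> {a..b} \<longrightarrow> \<bar>k r\<bar> \<le> C"
    and zero: "\<And>x y. a \<le> x \<Longrightarrow> x \<le> y \<Longrightarrow> y \<le> b \<Longrightarrow> integral {x..y} k = 0"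
  shows "AE s in lborel. s \<in> {a..b} \<longrightarrow> k s = 0"
proof -
  have [measurable]: "k \<in> borel_measurable borel" by (rule k)
  define k' where "k' s = max (- C) (min C (k s))" for s
  have m [measurable]: "k' \<in> borel_measurable borel" unfolding k'_def by measurable
  have eq: "AE s in lborel. s \<in> {a..b} \<longrightarrow> k' s = k s"
    using k(2) by eventually_elim (auto simp: k'_def)
  have bd: "\<bar>k' r\<bar> \<le> \<bar>C\<bar>" for r by (auto simp: k'_def)
  have "AE s in lborel. s \<in> {a..b} \<longrightarrow> k' s = 0"
  proof (rule AE_zero_if_interval_integrals_zero[OF m bd])
    fix x y assume xy: "a \<le> x" "x \<le> y" "y \<le> b"
    have i1: "set_integrable lborel {x..y} k'"
      by (rule bounded_borel_set_integrable[OF m bd])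
    have i2: "set_integrable lborel {x..y} k"
      by (rule ess_bounded_set_integrable[OF k(1), of _ _ C]) (use k(2) xy in \<open>auto elim: eventually_mono\<close>)
    have "(LINT s:{x..y}|lborel. k' s) = (LINT s:{x..y}|lborel. k s)"
      by (rule set_lebesgue_integral_cong_AE) (use eq xy in \<open>auto elim: eventually_mono\<close>)
    then show "integral {x..y} k' = 0"
      using set_borel_integral_eq_integral(2)[OF i1] set_borel_integral_eq_integral(2)[OF i2] zero[OF xy] by simp
  qed
  with eq show ?thesis by eventually_elim auto
qed

lemma AE_zero_if_nonneg_integral_nonpos:
  fixes k :: "real \<Rightarrow> real"
  assumes k: "set_integrable lborel {a..b} k"
    and nn: "AE s in lborel. s \<in> {a..b} \<longrightarrow> k s \<ge> 0" and le: "integral {a..b} k \<le> 0"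
  shows "AE s in lborel. s \<in> {a..b} \<longrightarrow> k s = 0"
proof -
  have nn': "AE s in lborel. 0 \<le> indicator {a..b} s *\<^sub>R k s"
    using nn by eventually_elim (auto simp: indicator_def)
  have "(LINT s|lborel. indicator {a..b} s *\<^sub>R k s) = 0"
    using integral_nonneg_AE[OF nn'] le set_borel_integral_eq_integral(2)[OF k]
    by (simp add: set_lebesgue_integral_def)
  then have "AE s in lborel. indicator {a..b} s *\<^sub>R k s = 0"
    using k nn' by (subst (asm) integral_nonneg_eq_0_iff_AE) (auto simp: set_integrable_def)
  then show ?thesis by eventually_elim (auto simp: indicator_def split: if_splits)
qed

text \<open>A Lipschitz function is absolutely continuous. Adding \<open>L x\<close> makes it increasing; the
  Stieltjes measure of the sum is at most \<open>2 L\<close> times Lebesgue measure, so that the Radon-Nikodym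
  theorem gives a density with values in \<open>[0,2 L]\<close>. Subtracting \<open>L\<close> again gives the bound \<open>L\<close>.\<close>

lemma lipschitz_density:
  fixes F :: "real \<Rightarrow> real"
  assumes F: "L-lipschitz_on {a..b} F" and ab: "a \<le> b"
  obtains w where "w \<in> borel_measurable borel" "\<And>r. \<bar>w r\<bar> \<le> L"
    "\<And>x y. a \<le> x \<Longrightarrow> x \<le> y \<Longrightarrow> y \<le> b \<Longrightarrow> F y - F x = integral {x..y} w"
proof -
  have L: "L \<ge> 0" using F by (rule lipschitz_on_nonneg)
  define c where "c x = max a (min b x)" for x
  define H where "H x = F (c x) + L * x" for x
  define H' where "H' x = L * x - F (c x)" for x
  have Fc: "\<bar>F (c y) - F (c x)\<bar> \<le> L * (y - x)" if "x \<le> y" for x y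
  proof -
    have "dist (F (c y)) (F (c x)) \<le> L * dist (c y) (c x)"
      by (rule lipschitz_onD[OF F]) (use ab in \<open>auto simp: c_def\<close>)
    also have "\<dots> \<le> L * (y - x)"
      by (rule mult_left_mono[OF _ L]) (use that in \<open>auto simp: c_def dist_real_def\<close>)
    finally show ?thesis by (simp add: dist_real_def)
  qed
  have contF: "continuous_on UNIV (\<lambda>x. F (c x))"
    by (rule continuous_on_compose2[OF lipschitz_on_continuous_on[OF F]])
      (use ab in \<open>auto simp: c_def intro!: continuous_intros\<close>)
  then have cH: "continuous_on UNIV H" "continuous_on UNIV H'"
    unfolding H_def H'_def by (auto intro!: continuous_intros)
  have cr: "continuous (at_right x) H" "continuous (at_right x) H'" for x
    using cH by (auto simp: continuous_on_eq_continuous_at intro: continuous_at_imp_continuous_within)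
  have mH: "H x \<le> H y" "H' x \<le> H' y" if "x \<le> y" for x y
    using Fc[OF that] by (auto simp: H_def H'_def algebra_simps abs_le_iff)
  let ?N = "interval_measure H" and ?N' = "interval_measure H'"
  have NIoc: "emeasure ?N {x<..y} = ennreal (H y - H x)" "emeasure ?N' {x<..y} = ennreal (H' y - H' x)"
    if "x \<le> y" for x y
    by (rule emeasure_interval_measure_Ioc[OF that]; use mH cr in blast)+
  \<comment> \<open>As \<open>H x + H' x = 2 * L * x\<close>, the two Stieltjes measures add up to a multiple of Lebesgue
    measure, which therefore dominates each of them.\<close>
  define S where "S = measure_of UNIV (sets borel) (\<lambda>A. emeasure ?N A + emeasure ?N' A)"
  have setsS: "sets S = sets borel"
    using sets.sigma_sets_eq[of "borel :: real measure"] by (simp add: S_def)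
  have emS: "emeasure S A = emeasure ?N A + emeasure ?N' A" if "A \<in> sets borel" for A
  proof -
    have "emeasure S A = (\<lambda>A. emeasure ?N A + emeasure ?N' A) A"
      unfolding S_def
    proof (rule emeasure_measure_of_sigma)
      show "sigma_algebra UNIV (sets borel :: real set set)" using sets.sigma_algebra_axioms[of borel] by simp
      show "positive (sets borel) (\<lambda>A. emeasure ?N A + emeasure ?N' A)" by (simp add: positive_def)
      show "countably_additive (sets borel) (\<lambda>A. emeasure ?N A + emeasure ?N' A)"
        unfolding countably_additive_def
      proof (intro allI impI)
        fix X :: "nat \<Rightarrow> real set" assume X: "range X \<subseteq> sets borel" "disjoint_family X"
        have "(\<Sum>i. emeasure ?N (X i) + emeasure ?N' (X i)) = (\<Sum>i. emeasure ?N (X i)) + (\<Sum>i. emeasure ?N' (X i))"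
          by (rule suminf_add[symmetric]) auto
        also have "\<dots> = emeasure ?N (\<Union>(range X)) + emeasure ?N' (\<Union>(range X))"
          using X by (simp add: suminf_emeasure)
        finally show "(\<Sum>i. emeasure ?N (X i) + emeasure ?N' (X i)) = emeasure ?N (\<Union>(range X)) + emeasure ?N' (\<Union>(range X))" .
      qed
    qed (rule that)
    then show ?thesis .
  qed
  let ?K = "density lborel (\<lambda>_::real. ennreal (2 * L))"
  have K: "emeasure ?K A = ennreal (2 * L) * emeasure lborel A" if "A \<in> sets borel" for A :: "real set"
    using that by (simp add: emeasure_density nn_integral_cmult)
  have SK: "S = ?K"
  proof (rule measure_eqI_generator_eq[where E = "range (\<lambda>(x,y). {x<..y::real})" and \<Omega> = UNIV
        and A = "\<lambda>n. {- real n<..real n}"])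
    show "Int_stable (range (\<lambda>(x, y). {x<..y::real}))"
    proof (rule Int_stableI)
      fix A B assume "A \<in> range (\<lambda>(x, y). {x<..y::real})" "B \<in> range (\<lambda>(x, y). {x<..y::real})"
      then obtain x y x' y' where "A = {x<..y}" "B = {x'<..y'}" by auto
      then have "A \<inter> B = (\<lambda>(x, y). {x<..y}) (max x x', min y y')" by auto
      then show "A \<inter> B \<in> range (\<lambda>(x, y). {x<..y})" by blast
    qed
    fix X assume "X \<in> range (\<lambda>(x, y). {x<..y::real})"
    then obtain x y where X: "X = {x<..y}" by auto
    show "emeasure S X = emeasure ?K X"
    proof (cases "x \<le> y")
      case True
      have "ennreal (H y - H x) + ennreal (H' y - H' x) = ennreal (2 * L * (y - x))"
        using mH[OF True] by (simp add: ennreal_plus[symmetric] del: ennreal_plus) (simp add: H_def H'_def algebra_simps)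
      also have "\<dots> = ennreal (2 * L) * emeasure lborel {x<..y}"
        using True L by (subst ennreal_mult) auto
      finally show ?thesis using True K[of "{x<..y}"] by (simp add: X emS NIoc)
    qed (simp add: X)
  next
    show "sets S = sigma_sets UNIV (range (\<lambda>(x, y). {x<..y::real}))"
      "sets ?K = sigma_sets UNIV (range (\<lambda>(x, y). {x<..y::real}))"
      using setsS by (simp_all add: borel_sigma_sets_Ioc case_prod_unfold)
    show "(\<Union>i. {- real i<..real i}) = (UNIV :: real set)"
    proof safe
      fix x :: real
      obtain n where "\<bar>x\<bar> < real n" using reals_Archimedean2 by blast
      then show "x \<in> (\<Union>i. {- real i<..real i})" by (auto intro!: exI[of _ n])
    qed auto
    fix i
    show "emeasure S {- real i<..real i} \<noteq> \<infinity>"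
      by (subst emS) (auto simp: NIoc)
  qed auto
  have NleK: "emeasure ?N A \<le> ennreal (2 * L) * emeasure lborel A" if "A \<in> sets borel" for A
  proof -
    have "emeasure ?N A \<le> emeasure S A" using emS[OF that] by simp
    then show ?thesis using SK K[OF that] by simp
  qed
  have "absolutely_continuous lborel ?N"
    unfolding absolutely_continuous_def
  proof
    fix A assume A: "A \<in> null_sets (lborel::real measure)"
    then have "A \<in> sets borel" "emeasure lborel A = 0" by auto
    then show "A \<in> null_sets ?N" using NleK[of A] by (auto simp: null_sets_def)
  qed
  then obtain p where p: "p \<in> borel_measurable lborel" and dp: "density lborel p = ?N"
    using sigma_finite_measure.Radon_Nikodym[OF sigma_finite_lborel, of ?N] by auto
  have [measurable]: "p \<in> borel_measurable borel" using p by simp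
  \<comment> \<open>On the part of a bounded interval where \<open>p > 2 * L\<close>, the domination leaves no room for a positive
    excess \<open>p - 2 * L\<close>.\<close>
  have ple: "AE x in lborel. p x \<le> ennreal (2 * L)"
  proof -
    have "AE x in lborel. x \<in> {- real n<..real n} \<longrightarrow> p x \<le> ennreal (2 * L)" for n
    proof -
      define B where "B = {x \<in> {- real n<..real n}. ennreal (2 * L) < p x}"
      have B [measurable]: "B \<in> sets borel" unfolding B_def by measurable
      have fin: "ennreal (2 * L) * emeasure lborel B \<noteq> \<infinity>"
      proof -
        have "emeasure lborel B \<le> emeasure lborel {- real n<..real n}"
          by (rule emeasure_mono) (auto simp: B_def)
        then show ?thesis by (auto simp: ennreal_mult_eq_top_iff top_unique)
      qed
      have "(\<integral>\<^sup>+x. (p x - ennreal (2*L)) * indicator B x \<partial>lborel) + ennreal (2 * L) * emeasure lborel B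
         = (\<integral>\<^sup>+x. (p x - ennreal (2*L)) * indicator B x \<partial>lborel) + (\<integral>\<^sup>+x. ennreal (2*L) * indicator B x \<partial>lborel)"
        by (simp add: nn_integral_cmult)
      also have "\<dots> = (\<integral>\<^sup>+x. (p x - ennreal (2*L)) * indicator B x + ennreal (2*L) * indicator B x \<partial>lborel)"
        by (rule nn_integral_add[symmetric]) measurable
      also have "\<dots> = (\<integral>\<^sup>+x. p x * indicator B x \<partial>lborel)"
        by (rule nn_integral_cong) (auto simp: B_def indicator_def diff_add_cancel_ennreal)
      also have "\<dots> = emeasure ?N B"
        by (simp add: dp[symmetric] emeasure_density)
      also have "\<dots> \<le> 0 + ennreal (2 * L) * emeasure lborel B" using NleK[of B] by simp
      finally have "(\<integral>\<^sup>+x. (p x - ennreal (2*L)) * indicator B x \<partial>lborel) \<le> 0"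
        using fin by (simp only: ennreal_add_left_cancel_le add.commute[of _ "ennreal (2 * L) * emeasure lborel B"]) auto
      then have "(\<integral>\<^sup>+x. (p x - ennreal (2*L)) * indicator B x \<partial>lborel) = 0" by simp
      then have "AE x in lborel. (p x - ennreal (2*L)) * indicator B x = 0"
        by (subst (asm) nn_integral_0_iff_AE) auto
      then show ?thesis
        by eventually_elim (auto simp: B_def indicator_def diff_eq_0_iff_ennreal split: if_splits)
    qed
    then have "AE x in lborel. \<forall>n. x \<in> {- real n<..real n} \<longrightarrow> p x \<le> ennreal (2 * L)"
      by (subst AE_all_countable) blast
    then show ?thesis
    proof eventually_elim
      case (elim x)
      obtain n where "\<bar>x\<bar> < real n" using reals_Archimedean2 by blast
      then have "x \<in> {- real n<..real n}" by auto
      then show ?case using elim by blast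
    qed
  qed
  define P where "P x = min (2 * L) (enn2real (p x))" for x
  have [measurable]: "P \<in> borel_measurable borel" unfolding P_def by measurable
  have P: "0 \<le> P x" "P x \<le> 2 * L" for x using L by (auto simp: P_def)
  have Pp: "AE x in lborel. p x = ennreal (P x)"
    using ple
  proof eventually_elim
    case (elim x)
    then have "enn2real (p x) \<le> 2 * L" using L by (metis enn2real_ennreal enn2real_mono ennreal_less_top mult_nonneg_nonneg zero_le_numeral)
    moreover have "p x < top" using elim by (metis ennreal_less_top le_less_trans)
    ultimately show ?case by (simp add: P_def)
  qed
  define w where "w x = P x - L" for x
  show ?thesis
  proof (rule that[of w])
    show "w \<in> borel_measurable borel" unfolding w_def by measurable
    show "\<bar>w r\<bar> \<le> L" for r using P[of r] by (auto simp: w_def)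
    fix x y assume xy: "a \<le> x" "x \<le> y" "y \<le> b"
    have Pint: "set_integrable lborel {x..y} P"
      by (rule bounded_borel_set_integrable[where C = "2 * L"]) (use P in auto)
    have "ennreal (H y - H x) = emeasure (density lborel p) {x<..y}"
      using NIoc xy dp by simp
    also have "\<dots> = (\<integral>\<^sup>+s. p s * indicator {x<..y} s \<partial>lborel)"
      by (simp add: emeasure_density)
    also have "\<dots> = (\<integral>\<^sup>+s. ennreal (indicator {x..y} s *\<^sub>R P s) \<partial>lborel)"
      using Pp AE_lborel_singleton[of x]
      by (intro nn_integral_cong_AE, eventually_elim) (auto simp: indicator_def)
    also have "\<dots> = ennreal (LINT s:{x..y}|lborel. P s)"
      unfolding set_lebesgue_integral_def
      by (rule nn_integral_eq_integral) (use Pint P in \<open>auto simp: set_integrable_def\<close>)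
    also have "\<dots> = ennreal (integral {x..y} P)"
      using set_borel_integral_eq_integral(2)[OF Pint] by simp
    finally have "H y - H x = integral {x..y} P"
      using mH(1)[OF xy(2)] P by (subst (asm) ennreal_inj) (auto intro: integral_nonneg set_borel_integral_eq_integral(1)[OF Pint])
    moreover have "integral {x..y} w = integral {x..y} P - integral {x..y} (\<lambda>_. L)"
      unfolding w_def by (rule Henstock_Kurzweil_Integration.integral_diff) (auto intro: set_borel_integral_eq_integral(1)[OF Pint])
    moreover have "c x = x" "c y = y" using xy by (auto simp: c_def)
    ultimately show "F y - F x = integral {x..y} w"
      using xy by (simp add: H_def algebra_simps)
  qed
qed

section \<open>Smooth test functions\<close>

text \<open>The classical smooth, non-analytic functions; the polynomial factor makes the family closed
  under differentiation.\<close>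

definition flat_exp :: "real poly \<Rightarrow> real \<Rightarrow> real" where
  "flat_exp p x = (if x > 0 then poly p (1 / x) * exp (- (1 / x)) else 0)"

lemma poly_times_exp_minus_tendsto_0:
  "((\<lambda>y::real. poly p y * exp (- y)) \<longlongrightarrow> 0) at_top"
proof -
  have "((\<lambda>y. \<Sum>i\<le>degree p. coeff p i * (y ^ i / exp y)) \<longlongrightarrow> (\<Sum>i\<le>degree p. coeff p i * 0)) at_top"
    by (intro tendsto_sum tendsto_mult tendsto_const tendsto_power_div_exp_0)
  then show ?thesis
    by (simp add: poly_altdef sum_distrib_right exp_minus divide_inverse mult.assoc)
qed

lemma flat_exp_deriv:
  "(flat_exp p has_real_derivative flat_exp ([:0, 0, 1:] * (p - pderiv p)) x) (at x)"
proof -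
  consider "x > 0" | "x < 0" | "x = 0" by linarith
  then show ?thesis
  proof cases
    case 1
    have "((\<lambda>x. poly p (1 / x) * exp (- (1 / x))) has_real_derivative
        flat_exp ([:0, 0, 1:] * (p - pderiv p)) x) (at x)"
      using 1 by (auto intro!: derivative_eq_intros poly_DERIV[THEN DERIV_chain2]
          simp: flat_exp_def field_simps power2_eq_square)
    then show ?thesis
      by (rule has_field_derivative_transform_within_open[of _ _ _ "{0<..}"]) (use 1 in \<open>auto simp: flat_exp_def\<close>)
  next
    case 2
    have "((\<lambda>x. 0) has_real_derivative flat_exp ([:0, 0, 1:] * (p - pderiv p)) x) (at x)"
      using 2 by (simp add: flat_exp_def)
    then show ?thesis
      by (rule has_field_derivative_transform_within_open[of _ _ _ "{..<0}"]) (use 2 in \<open>auto simp: flat_exp_def\<close>)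
  next
    case 3
    have "((\<lambda>h. flat_exp p h / h) \<longlongrightarrow> 0) (at_right 0)"
    proof (rule Lim_transform_eventually)
      show "((\<lambda>h. poly (pCons 0 p) (inverse h) * exp (- inverse h)) \<longlongrightarrow> 0) (at_right 0)"
        by (rule filterlim_compose[OF poly_times_exp_minus_tendsto_0 filterlim_inverse_at_top_right])
      show "\<forall>\<^sub>F h in at_right 0. poly (pCons 0 p) (inverse h) * exp (- inverse h) = flat_exp p h / h"
        by (rule eventually_at_rightI[of 0 1]) (auto simp: flat_exp_def field_simps)
    qed
    moreover have "((\<lambda>h. flat_exp p h / h) \<longlongrightarrow> 0) (at_left 0)"
      by (rule Lim_transform_eventually[of "\<lambda>_. 0"]) (auto simp: flat_exp_def intro: eventually_at_leftI[of "-1"])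
    ultimately have "((\<lambda>h. flat_exp p h / h) \<longlongrightarrow> 0) (at 0)"
      by (intro filterlim_split_at)
    then show ?thesis using 3
      by (simp add: DERIV_def flat_exp_def[of _ 0])
  qed
qed

text \<open>A class of functions that is closed under differentiation consists of smooth functions. The
  closure properties are those that the plateau functions below need; the reciprocal of a positive
  member is included because they are quotients.\<close>

inductive_set smooth_class :: "(real \<Rightarrow> real) set" where
  flat: "(\<lambda>x. flat_exp p (c * x + d)) \<in> smooth_class"
| const: "(\<lambda>x. k) \<in> smooth_class"
| add: "f \<in> smooth_class \<Longrightarrow> g \<in> smooth_class \<Longrightarrow> (\<lambda>x. f x + g x) \<in> smooth_class"
| mult: "f \<in> smooth_class \<Longrightarrow> g \<in> smooth_class \<Longrightarrow> (\<lambda>x. f x * g x) \<in> smooth_class"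
| inv: "f \<in> smooth_class \<Longrightarrow> (\<And>x. f x > 0) \<Longrightarrow> (\<lambda>x. inverse (f x)) \<in> smooth_class"

lemma smooth_class_deriv:
  "f \<in> smooth_class \<Longrightarrow> \<exists>f'\<in>smooth_class. \<forall>x. (f has_real_derivative f' x) (at x)"
proof (induction rule: smooth_class.induct)
  case (flat p c d)
  let ?q = "[:0, 0, 1:] * (p - pderiv p)"
  have "((\<lambda>x. flat_exp p (c * x + d)) has_real_derivative flat_exp ?q (c * x + d) * c) (at x)" for x
    by (rule DERIV_chain2[OF flat_exp_deriv]) (auto intro!: derivative_eq_intros)
  moreover have "(\<lambda>x. flat_exp ?q (c * x + d) * c) \<in> smooth_class"
    by (intro smooth_class.intros)
  ultimately show ?case by (rule_tac bexI) auto
next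
  case (const k)
  show ?case by (rule bexI[of _ "\<lambda>x. 0"]) (auto intro: smooth_class.intros)
next
  case (add f g)
  then obtain f' g' where "f' \<in> smooth_class" "\<forall>x. (f has_real_derivative f' x) (at x)"
    "g' \<in> smooth_class" "\<forall>x. (g has_real_derivative g' x) (at x)" by blast
  then show ?case
    by (intro bexI[of _ "\<lambda>x. f' x + g' x"]) (auto intro!: smooth_class.intros derivative_eq_intros)
next
  case (mult f g)
  then obtain f' g' where "f' \<in> smooth_class" "\<And>x. (f has_real_derivative f' x) (at x)"
    "g' \<in> smooth_class" "\<And>x. (g has_real_derivative g' x) (at x)" by blast
  then show ?case using mult.hyps
    by (intro bexI[of _ "\<lambda>x. f' x * g x + g' x * f x"]) (auto intro!: smooth_class.intros DERIV_mult)
next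
  case (inv f)
  then obtain f' where f': "f' \<in> smooth_class" "\<And>x. (f has_real_derivative f' x) (at x)" by blast
  have "((\<lambda>x. inverse (f x)) has_real_derivative (- 1) * (f' x * (inverse (f x) * inverse (f x)))) (at x)" for x
    using f'(2)[of x] inv.hyps(2)[of x]
    by (auto intro!: derivative_eq_intros simp: power2_eq_square field_simps)
  moreover have "(\<lambda>x. (- 1) * (f' x * (inverse (f x) * inverse (f x)))) \<in> smooth_class"
    by (intro smooth_class.intros f' inv.hyps)
  ultimately show ?case by (intro bexI[of _ "\<lambda>x. (- 1) * (f' x * (inverse (f x) * inverse (f x)))"]) auto
qed

lemma smooth_class_smooth:
  assumes "f \<in> smooth_class"
  shows "(deriv ^^ n) f differentiable_on UNIV"
proof -
  have "(deriv ^^ n) f \<in> smooth_class" for n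
  proof (induction n)
    case (Suc n)
    then obtain f' where f': "f' \<in> smooth_class" "\<And>x. ((deriv ^^ n) f has_real_derivative f' x) (at x)"
      using smooth_class_deriv by blast
    then have "deriv ((deriv ^^ n) f) = f'" by (auto intro!: DERIV_imp_deriv)
    then show ?case using f'(1) by simp
  qed (use assms in simp)
  then obtain f' where "\<And>x. ((deriv ^^ n) f has_real_derivative f' x) (at x)"
    using smooth_class_deriv by blast
  then show ?thesis
    by (intro differentiable_at_imp_differentiable_on) (auto simp: real_differentiable_def)
qed

text \<open>The bump \<open>B\<close> is positive exactly on \<open>(x,y)\<close>. The quotient keeps its support, stays in \<open>[0,1]\<close> and,
  as the summand in the denominator tends to \<open>0\<close>, converges to the indicator of \<open>(x,y)\<close>.\<close>

definition plateau :: "real \<Rightarrow> real \<Rightarrow> nat \<Rightarrow> real \<Rightarrow> real" where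
  "plateau x y n s = (let B = flat_exp 1 (s - x) * flat_exp 1 (y - s) in B / (B + 1 / real (Suc n)))"

lemma flat_exp_1: "flat_exp 1 x \<ge> 0" "flat_exp 1 x > 0 \<longleftrightarrow> x > 0" "x \<le> 0 \<Longrightarrow> flat_exp 1 x = 0"
  by (auto simp: flat_exp_def)

lemma plateau_smooth_class: "plateau x y n \<in> smooth_class"
proof -
  define B where "B s = flat_exp 1 (1 * s + (- x)) * flat_exp 1 ((- 1) * s + y)" for s
  have B: "B \<in> smooth_class" unfolding B_def by (intro smooth_class.intros)
  have "B s \<ge> 0" for s using flat_exp_1 by (simp add: B_def)
  then have "(\<lambda>s. B s * inverse (B s + 1 / real (Suc n))) \<in> smooth_class"
    using B by (intro smooth_class.intros) (auto intro!: add_nonneg_pos)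
  moreover have "(\<lambda>s. B s * inverse (B s + 1 / real (Suc n))) = plateau x y n"
    by (auto simp: B_def plateau_def Let_def divide_inverse fun_eq_iff)
  ultimately show ?thesis by simp
qed

lemma plateau_bounds: "0 \<le> plateau x y n s" "plateau x y n s \<le> 1"
  and plateau_outside: "s \<notin> {x<..<y} \<Longrightarrow> plateau x y n s = 0"
  and plateau_tendsto: "(\<lambda>n. plateau x y n s) \<longlonglongrightarrow> indicator {x<..<y} s"
proof -
  define B where "B = flat_exp 1 (s - x) * flat_exp 1 (y - s)"
  have B: "B \<ge> 0" using flat_exp_1 by (simp add: B_def)
  have p: "plateau x y n s = B / (B + 1 / real (Suc n))" for n by (simp add: plateau_def B_def Let_def)
  show "0 \<le> plateau x y n s" "plateau x y n s \<le> 1" using B unfolding p by (auto simp: divide_le_eq_1 add_nonneg_pos)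
  show out: "s \<notin> {x<..<y} \<Longrightarrow> plateau x y n s = 0" for n
    using flat_exp_1(3)[of "s - x"] flat_exp_1(3)[of "y - s"] by (auto simp: p B_def)
  show "(\<lambda>n. plateau x y n s) \<longlonglongrightarrow> indicator {x<..<y} s"
  proof (cases "s \<in> {x<..<y}")
    case True
    then have "B > 0" using flat_exp_1(2) by (auto simp: B_def)
    have "(\<lambda>n. B / (B + 1 / real (Suc n))) \<longlonglongrightarrow> B / (B + 0)"
      using \<open>B > 0\<close> by (intro tendsto_intros lim_1_over_n[THEN LIMSEQ_Suc]) auto
    then show ?thesis using True \<open>B > 0\<close> by (simp add: p)
  qed (simp add: out)
qed

lemma plateau_test_fun:
  assumes "0 < x" "x \<le> y" "y < 1"
  shows "test_fun01 (plateau x y n)"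
proof -
  have "plateau x y n s = 0" if "s \<notin> {x..y}" for s
    by (rule plateau_outside) (use that in auto)
  then show ?thesis
    unfolding test_fun01_def
    using smooth_class_smooth[OF plateau_smooth_class[of x y n]] assms by blast
qed

text \<open>Dominated convergence along plateau functions turns the hypothesis into vanishing integrals over
  all compact intervals inside \<open>(0,1)\<close>.\<close>

lemma test_functions_separate:
  fixes k :: "real \<Rightarrow> real"
  assumes k: "k \<in> borel_measurable borel" and bd: "\<And>d. d < 1 \<Longrightarrow> \<exists>C. AE s in lborel. s \<in> {0..d} \<longrightarrow> \<bar>k s\<bar> \<le> C"
    and zero: "\<And>\<phi>. test_fun01 \<phi> \<Longrightarrow> (LINT s:{0<..<1}|lborel. k s * \<phi> s) = 0"
  shows "AE s in lborel. s \<in> {0..<1} \<longrightarrow> k s = 0"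
proof -
  have [measurable]: "k \<in> borel_measurable borel" by (rule k)
  have int0: "integral {x..y} k = 0" if xy: "0 < x" "x \<le> y" "y < 1" for x y
  proof -
    obtain C where "AE s in lborel. s \<in> {0..y} \<longrightarrow> \<bar>k s\<bar> \<le> C" using bd[OF xy(3)] by blast
    then have C: "AE s in lborel. s \<in> {0..y} \<longrightarrow> \<bar>k s\<bar> \<le> \<bar>C\<bar>" by eventually_elim auto
    have [measurable]: "plateau x y n \<in> borel_measurable borel" for n
      using smooth_class_smooth[OF plateau_smooth_class[of x y n], of 0]
      by (auto intro!: borel_measurable_continuous_onI differentiable_imp_continuous_on)
    have "(\<lambda>n. LINT s|lborel. indicator {0<..<1} s *\<^sub>R (k s * plateau x y n s))
        \<longlonglongrightarrow> (LINT s|lborel. indicator {0<..<1} s *\<^sub>R (k s * indicator {x<..<y} s))"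
    proof (rule integral_dominated_convergence[where w = "\<lambda>s. indicator {x..y} s *\<^sub>R \<bar>C\<bar>"])
      show "integrable lborel (\<lambda>s. indicator {x..y} s *\<^sub>R \<bar>C\<bar>)"
        by (rule integrable_scaleR_left) (auto intro!: integrable_real_indicator simp: emeasure_lborel_Icc_eq)
      show "AE s in lborel. (\<lambda>n. indicat_real {0<..<1} s *\<^sub>R (k s * plateau x y n s))
          \<longlonglongrightarrow> indicat_real {0<..<1} s *\<^sub>R (k s * indicator {x<..<y} s)"
        by (intro AE_I2 tendsto_intros plateau_tendsto)
      show "AE s in lborel. norm (indicat_real {0<..<1} s *\<^sub>R (k s * plateau x y n s)) \<le> indicator {x..y} s *\<^sub>R \<bar>C\<bar>" for n
        using C
      proof eventually_elim
        case (elim s)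
        show ?case
        proof (cases "s \<in> {x<..<y}")
          case True
          then have "\<bar>k s\<bar> * \<bar>plateau x y n s\<bar> \<le> \<bar>C\<bar> * 1"
            using elim xy plateau_bounds[of x y n s] by (intro mult_mono) auto
          then show ?thesis using True xy by (auto simp: abs_mult)
        qed (use plateau_outside in \<open>auto simp: indicator_def\<close>)
      qed
    qed measurable
    moreover have "(LINT s|lborel. indicator {0<..<1} s *\<^sub>R (k s * plateau x y n s)) = 0" for n
      using zero[OF plateau_test_fun[OF xy]] by (simp add: set_lebesgue_integral_def)
    ultimately have "(LINT s|lborel. indicator {0<..<1} s *\<^sub>R (k s * indicator {x<..<y} s)) = 0"
      by (simp only: LIMSEQ_const_iff)
    also have "(LINT s|lborel. indicator {0<..<1} s *\<^sub>R (k s * indicator {x<..<y} s))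
        = (LINT s|lborel. indicator {x..y} s *\<^sub>R k s)"
      using AE_lborel_singleton[of x] AE_lborel_singleton[of y]
      by (intro integral_cong_AE, measurable, eventually_elim) (use xy in \<open>auto simp: indicator_def\<close>)
    also have "\<dots> = integral {x..y} k"
    proof -
      have "AE r in lborel. r \<in> {x..y} \<longrightarrow> \<bar>k r\<bar> \<le> \<bar>C\<bar>"
        using C by eventually_elim (use xy in auto)
      from set_borel_integral_eq_integral(2)[OF ess_bounded_set_integrable[OF k this]]
      show ?thesis by (simp add: set_lebesgue_integral_def)
    qed
    finally show ?thesis .
  qed
  have "AE s in lborel. \<forall>n::nat. s \<in> {1 / (real n + 2) .. 1 - 1 / (real n + 2)} \<longrightarrow> k s = 0"
    unfolding AE_all_countable
  proof
    fix n :: nat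
    define e where "e = 1 / (real n + 2)"
    have e: "e > 0" by (simp add: e_def)
    then have "\<exists>C. AE s in lborel. s \<in> {0..1 - e} \<longrightarrow> \<bar>k s\<bar> \<le> C" by (intro bd) simp
    then obtain C where C: "AE s in lborel. s \<in> {0..1 - e} \<longrightarrow> \<bar>k s\<bar> \<le> C" by blast
    have "AE s in lborel. s \<in> {e..1 - e} \<longrightarrow> k s = 0"
    proof (rule AE_zero_if_interval_integrals_zero_ess[OF k])
      show "AE r in lborel. r \<in> {e..1 - e} \<longrightarrow> \<bar>k r\<bar> \<le> C"
        using C by eventually_elim (use e in auto)
      show "integral {x..y} k = 0" if "e \<le> x" "x \<le> y" "y \<le> 1 - e" for x y
        by (rule int0) (use that e in auto)
    qed
    then show "AE s in lborel. s \<in> {1 / (real n + 2)..1 - 1 / (real n + 2)} \<longrightarrow> k s = 0"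
      by (simp only: e_def)
  qed
  then show ?thesis using AE_lborel_singleton[of 0]
  proof eventually_elim
    case (elim s)
    show ?case
    proof
      assume s: "s \<in> {0..<1}"
      then have "min s (1 - s) > 0" using elim by auto
      then obtain n where "inverse (real (Suc n)) < min s (1 - s)" using reals_Archimedean by blast
      moreover have "1 / (real n + 2) \<le> inverse (real (Suc n))" by (simp add: field_simps)
      ultimately have "s \<in> {1 / (real n + 2) .. 1 - 1 / (real n + 2)}" by auto
      then show "k s = 0" using elim by blast
    qed
  qed
qed

section \<open>The second derivative as a bounded density\<close>

text \<open>The concrete counterpart of the distributional second derivative: the bound holds pointwise on
  each \<open>[0,d]\<close> and \<open>G\<close> is Borel, which makes it convenient for integration.\<close>

definition has_curvature :: "(real \<Rightarrow> real) \<Rightarrow> (real \<Rightarrow> real) \<Rightarrow> bool" where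
  "has_curvature \<eta> G \<longleftrightarrow>
     G \<in> borel_measurable borel \<and> (\<forall>d<1. \<exists>C. \<forall>s\<in>{0..d}. \<bar>G s\<bar> \<le> C) \<and>
     (\<forall>x y. 0 \<le> x \<longrightarrow> x \<le> y \<longrightarrow> y < 1 \<longrightarrow> deriv01 \<eta> y - deriv01 \<eta> x = integral {x..y} G)"

lemma has_curvatureD:
  assumes "has_curvature \<eta> G"
  shows "G \<in> borel_measurable borel"
    and "d < 1 \<Longrightarrow> \<exists>C. \<forall>s\<in>{0..d}. \<bar>G s\<bar> \<le> C"
    and "0 \<le> x \<Longrightarrow> x \<le> y \<Longrightarrow> y < 1 \<Longrightarrow> deriv01 \<eta> y - deriv01 \<eta> x = integral {x..y} G"
  using assms by (auto simp: has_curvature_def)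

lemma at_within_01_nonbot: "s \<in> {0..<1} \<Longrightarrow> at s within {0..<1::real} \<noteq> bot"
proof -
  assume s: "s \<in> {0..<1}"
  have "s islimpt {0..<1}"
  proof (rule islimpt_subset)
    show "s islimpt {s..<1}" using s by (simp add: islimpt_Ico)
  qed (use s in auto)
  then show ?thesis by (simp add: trivial_limit_within)
qed

lemma deriv01_eqI:
  "(\<eta> has_real_derivative D) (at s within {0..<1}) \<Longrightarrow> s \<in> {0..<1} \<Longrightarrow> deriv01 \<eta> s = D"
  unfolding deriv01_def has_real_derivative_iff_has_vector_derivative
  by (intro vector_derivative_within at_within_01_nonbot)

lemma X_space_deriv01:
  assumes "\<eta> \<in> X_space" "s \<in> {0..<1}"
  shows "(\<eta> has_real_derivative deriv01 \<eta> s) (at s within {0..<1})"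
proof -
  have "\<eta> differentiable (at s within {0..<1})"
    using assms by (auto simp: X_space_def differentiable_on_def)
  then obtain D where "(\<eta> has_real_derivative D) (at s within {0..<1})"
    by (auto simp: real_differentiable_def)
  then show ?thesis using deriv01_eqI assms by metis
qed

lemma lip_loc01_local_lipschitz:
  assumes "lip_loc01 f"
  shows "local_lipschitz {0::real} {0..<1} (\<lambda>_. f)"
  unfolding local_lipschitz_def
proof (intro ballI)
  fix x t :: real assume "x \<in> {0..<1}"
  then obtain u L where "u > 0" "L-lipschitz_on (cball x u \<inter> {0..<1}) f"
    using assms unfolding lip_loc01_def by blast
  then show "\<exists>u>0. \<exists>L. \<forall>t\<in>cball t u \<inter> {0}. L-lipschitz_on (cball x u \<inter> {0..<1}) f" by blast
qed

text \<open>Competitors enter the primal space through this lemma: an indefinite integral of a locally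
  bounded function is locally Lipschitz.\<close>

lemma X_spaceI_density:
  assumes D: "\<And>s. s \<in> {0..<1} \<Longrightarrow> (\<eta> has_real_derivative D s) (at s within {0..<1})"
    and G: "G \<in> borel_measurable borel" "\<And>d. d < 1 \<Longrightarrow> \<exists>C. \<forall>s\<in>{0..d}. \<bar>G s\<bar> \<le> C"
    and DG: "\<And>x y. 0 \<le> x \<Longrightarrow> x \<le> y \<Longrightarrow> y < 1 \<Longrightarrow> D y - D x = integral {x..y} G"
  shows "\<eta> \<in> X_space" "has_curvature \<eta> G"
proof -
  have eq: "deriv01 \<eta> s = D s" if "s \<in> {0..<1}" for s
    using deriv01_eqI[OF D[OF that] that] .
  show "has_curvature \<eta> G"
    unfolding has_curvature_def using eq G DG by auto
  have "lip_loc01 (deriv01 \<eta>)"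
    unfolding lip_loc01_def
  proof
    fix x :: real assume x: "x \<in> {0..<1}"
    define u where "u = (1 - x) / 2"
    have u: "u > 0" "x + u < 1" using x by (auto simp: u_def field_simps)
    obtain C where C: "\<And>s. s \<in> {0..x + u} \<Longrightarrow> \<bar>G s\<bar> \<le> C" using G(2)[OF u(2)] by blast
    have C0: "C \<ge> 0" using C[of x] x u by force
    have key: "\<bar>D z - D y\<bar> \<le> C * (z - y)" if "0 \<le> y" "y \<le> z" "z \<le> x + u" for y z
    proof -
      have "G integrable_on {y..z}"
        by (rule bounded_borel_integrable_on[OF G(1), of _ _ C]) (use that C in auto)
      then have "norm (integral {y..z} G) \<le> C * measure lborel (cbox y z)"
        by (intro has_integral_bound[OF C0]) (use that C in \<open>auto simp: integrable_integral\<close>)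
      moreover have "D z - D y = integral {y..z} G" using DG[of y z] that u by auto
      ultimately show ?thesis using that by simp
    qed
    have "C-lipschitz_on (cball x u \<inter> {0..<1}) (deriv01 \<eta>)"
    proof (rule lipschitz_onI[OF _ C0])
      fix y z assume yz: "y \<in> cball x u \<inter> {0..<1}" "z \<in> cball x u \<inter> {0..<1}"
      then have "y \<le> x + u" "z \<le> x + u" by (auto simp: dist_real_def)
      then show "dist (deriv01 \<eta> y) (deriv01 \<eta> z) \<le> C * dist y z"
        using key[of y z] key[of z y] yz eq
        by (cases "y \<le> z") (auto simp: dist_real_def abs_minus_commute)
    qed
    then show "\<exists>u>0. \<exists>L. L-lipschitz_on (cball x u \<inter> {0..<1}) (deriv01 \<eta>)" using u by blast
  qed
  moreover from this have "continuous_on {0..<1} (deriv01 \<eta>)"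
    by (intro local_lipschitz_continuous_on[where T = "{0::real}" and t = 0]
        lip_loc01_local_lipschitz) auto
  ultimately show "\<eta> \<in> X_space"
    using D unfolding X_space_def differentiable_on_def real_differentiable_def by blast
qed

text \<open>On each \<open>[0, c n]\<close>, compactness makes the derivative Lipschitz and hence gives a density
  \<open>w n\<close>. These agree almost everywhere where they overlap. At \<open>s\<close> one takes the density with the least
  admissible index, so that on \<open>[0, c n]\<close> only finitely many of them occur, which keeps the bound.\<close>

lemma X_space_has_curvature:
  assumes "\<eta> \<in> X_space"
  obtains G where "has_curvature \<eta> G"
proof -
  let ?F = "deriv01 \<eta>"
  define c where "c n = 1 - 1 / (real n + 2)" for n :: nat
  have c: "0 < c n" "c n < 1" for n by (auto simp: c_def field_simps)
  have cmono: "c m \<le> c n" if "m \<le> n" for m n using that by (auto simp: c_def field_simps)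
  have cex: "\<exists>n. d \<le> c n" if "d < 1" for d
  proof -
    have "0 < 1 - d" using that by simp
    then obtain n where "inverse (real (Suc n)) < 1 - d" using reals_Archimedean by blast
    moreover have "1 / (real n + 2) \<le> inverse (real (Suc n))" by (simp add: field_simps)
    ultimately show ?thesis by (intro exI[of _ n]) (auto simp: c_def)
  qed
  have "local_lipschitz {0::real} {0..<1} (\<lambda>_. ?F)"
    using assms by (auto simp: X_space_def intro: lip_loc01_local_lipschitz)
  then have ll: "local_lipschitz {0::real} {0..c n} (\<lambda>_. ?F)" for n
    by (rule local_lipschitz_subset) (use c[of n] in auto)
  have "\<exists>L. L-lipschitz_on {0..c n} ?F" for n
    by (rule local_lipschitz_compact_implies_lipschitz[OF ll[of n]]) auto
  then obtain L :: "nat \<Rightarrow> real" where L: "\<And>n. (L n)-lipschitz_on {0..c n} ?F" by metis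
  have "\<exists>w. w \<in> borel_measurable borel \<and> (\<forall>r. \<bar>w r\<bar> \<le> L n) \<and>
      (\<forall>x y. 0 \<le> x \<longrightarrow> x \<le> y \<longrightarrow> y \<le> c n \<longrightarrow> ?F y - ?F x = integral {x..y} w)" for n
    by (rule lipschitz_density[OF L[of n]]) (use c(1)[of n] in auto)
  then obtain w where w: "\<And>n. w n \<in> borel_measurable borel" "\<And>n r. \<bar>w n r\<bar> \<le> L n"
    "\<And>n x y. 0 \<le> x \<Longrightarrow> x \<le> y \<Longrightarrow> y \<le> c n \<Longrightarrow> ?F y - ?F x = integral {x..y} (w n)"
    by metis
  have [measurable]: "w n \<in> borel_measurable borel" for n by (rule w)
  have wint: "w n integrable_on {x..y}" for n x y
    by (rule bounded_borel_integrable_on[OF w(1) w(2)])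
  have agree: "AE s in lborel. s \<in> {0..c m} \<longrightarrow> w n s = w m s" if "m \<le> n" for m n
  proof -
    have "AE s in lborel. s \<in> {0..c m} \<longrightarrow> w n s - w m s = 0"
    proof (rule AE_zero_if_interval_integrals_zero)
      show "\<bar>w n r - w m r\<bar> \<le> L n + L m" for r using w(2)[of n r] w(2)[of m r] by linarith
      fix x y assume "0 \<le> x" "x \<le> y" "y \<le> c m"
      then show "integral {x..y} (\<lambda>s. w n s - w m s) = 0"
        using w(3)[of x y m] w(3)[of x y n] cmono[OF that]
        by (simp add: Henstock_Kurzweil_Integration.integral_diff wint)
    qed measurable
    then show ?thesis by (auto elim: eventually_mono)
  qed
  define N where "N s = (LEAST n. s \<le> c n)" for s
  define G where "G s = w (N s) s" for s
  have [measurable]: "N \<in> measurable borel (count_space UNIV)"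
    unfolding N_def by measurable
  have Nle: "N s \<le> n" if "s \<le> c n" for s n unfolding N_def by (rule Least_le) (rule that)
  have Nc: "s \<le> c (N s)" if "s < 1" for s
    unfolding N_def using cex[OF that] by (rule LeastI_ex)
  have Gw: "AE s in lborel. s \<in> {0..c n} \<longrightarrow> G s = w n s" for n
  proof -
    have "AE s in lborel. \<forall>m\<in>{..n}. s \<in> {0..c m} \<longrightarrow> w n s = w m s"
      by (rule AE_finite_allI[OF _ agree]) auto
    then show ?thesis
    proof eventually_elim
      case (elim s)
      show ?case
      proof
        assume s: "s \<in> {0..c n}"
        then have "N s \<in> {..n}" "s \<in> {0..c (N s)}" using Nle Nc c(2)[of n] by auto
        then show "G s = w n s" using elim by (auto simp: G_def)
      qed
    qed
  qed
  show ?thesis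
  proof (rule that, unfold has_curvature_def, intro conjI allI impI)
    show Gm: "G \<in> borel_measurable borel"
      unfolding G_def by (rule measurable_compose_countable[where g = N]) measurable
    have Gbd: "\<bar>G s\<bar> \<le> Max (L ` {..n})" if "s \<le> c n" for s n
    proof -
      have "\<bar>G s\<bar> \<le> L (N s)" by (simp add: G_def w)
      also have "\<dots> \<le> Max (L ` {..n})" using Nle[OF that] by (intro Max_ge) auto
      finally show ?thesis .
    qed
    show "\<exists>C. \<forall>s\<in>{0..d}. \<bar>G s\<bar> \<le> C" if d: "d < 1" for d
    proof -
      obtain n where "d \<le> c n" using cex[OF d] by blast
      then show ?thesis using Gbd by (meson atLeastAtMost_iff order_trans)
    qed
    fix x y :: real assume xy: "0 \<le> x" "x \<le> y" "y < 1"
    obtain n where n: "y \<le> c n" using cex[OF xy(3)] by blast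
    have i1: "set_integrable lborel {x..y} G"
      by (rule bounded_borel_set_integrable[OF Gm, of _ _ "Max (L ` {..n})"]) (use n Gbd in auto)
    have i2: "set_integrable lborel {x..y} (w n)"
      by (rule bounded_borel_set_integrable[OF w(1) w(2)])
    have "(LINT s:{x..y}|lborel. G s) = (LINT s:{x..y}|lborel. w n s)"
      by (rule set_lebesgue_integral_cong_AE)
        (use Gw[of n] xy n Gm in \<open>auto elim: eventually_mono\<close>)
    then show "?F y - ?F x = integral {x..y} G"
      using set_borel_integral_eq_integral(2)[OF i1] set_borel_integral_eq_integral(2)[OF i2] w(3)[OF xy(1,2) n] by simp
  qed
qed

lemma lebesgue_integral_01_supported:
  fixes f :: "real \<Rightarrow> real"
  assumes f: "set_integrable lborel {c..d} f" and cd: "0 < c" "d < 1"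
    and supp: "\<And>s. s \<notin> {c..d} \<Longrightarrow> f s = 0"
  shows "(LINT s:{0<..<1}|lebesgue. f s) = integral {c..d} f"
    and "(LINT s:{0<..<1}|lborel. f s) = integral {c..d} f"
    and "set_integrable lborel {0<..<1} f"
proof -
  have eq: "(\<lambda>s. indicator {0<..<1} s *\<^sub>R f s) = (\<lambda>s. indicator {c..d} s *\<^sub>R f s)"
    using supp cd by (auto simp: indicator_def fun_eq_iff)
  have m: "(\<lambda>s. indicator {c..d} s *\<^sub>R f s) \<in> borel_measurable lborel"
    using f by (auto simp: set_integrable_def)
  show 1: "(LINT s:{0<..<1}|lborel. f s) = integral {c..d} f"
    unfolding set_lebesgue_integral_def eq
    using set_borel_integral_eq_integral(2)[OF f] by (simp add: set_lebesgue_integral_def)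
  then show "(LINT s:{0<..<1}|lebesgue. f s) = integral {c..d} f"
    unfolding set_lebesgue_integral_def eq using integral_completion[OF m] by simp
  show "set_integrable lborel {0<..<1} f"
    using f unfolding set_integrable_def eq .
qed

text \<open>The support is enlarged slightly, so that the function and its derivatives vanish at the end
  points as well.\<close>

lemma test_fun01E:
  assumes "test_fun01 \<phi>"
  obtains c d where "0 < c" "c < d" "d < 1"
    "\<And>s. s \<notin> {c<..<d} \<Longrightarrow> \<phi> s = 0"
    "\<And>s. s \<notin> {c<..<d} \<Longrightarrow> deriv \<phi> s = 0"
    "\<And>s. s \<notin> {c<..<d} \<Longrightarrow> (deriv ^^ 2) \<phi> s = 0"
proof -
  obtain c0 d0 where c0: "0 < c0" "c0 \<le> d0" "d0 < 1" "\<And>s. s \<notin> {c0..d0} \<Longrightarrow> \<phi> s = 0"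
    using assms unfolding test_fun01_def by blast
  have d1: "deriv f s = 0" if f: "\<And>s. s \<notin> {c0..d0} \<Longrightarrow> f s = 0" and s: "s \<notin> {c0..d0}" for f :: "real \<Rightarrow> real" and s
  proof (rule DERIV_imp_deriv)
    have "open (- {c0..d0})" by (simp add: open_Compl)
    then show "(f has_real_derivative 0) (at s)"
      by (rule has_field_derivative_transform_within_open[of "\<lambda>_. 0", rotated]) (use f s in auto)
  qed
  show ?thesis
  proof (rule that[of "c0 / 2" "(1 + d0) / 2"])
    fix s assume "s \<notin> {c0 / 2<..<(1 + d0) / 2}"
    then have s: "s \<notin> {c0..d0}" using c0 by auto
    then show "\<phi> s = 0" "deriv \<phi> s = 0" "(deriv ^^ 2) \<phi> s = 0"
      using c0(4) d1[OF c0(4)] d1[OF d1[OF c0(4)]] by (auto simp: numeral_2_eq_2)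
  qed (use c0 in auto)
qed

lemma test_fun01_deriv:
  assumes "test_fun01 \<phi>"
  shows "(\<phi> has_real_derivative deriv \<phi> s) (at s)"
    and "(deriv \<phi> has_real_derivative (deriv ^^ 2) \<phi> s) (at s)"
    and "continuous_on S \<phi>" "continuous_on S (deriv \<phi>)" "continuous_on S ((deriv ^^ 2) \<phi>)"
proof -
  have d: "(deriv ^^ n) \<phi> differentiable (at s)" for n s
    using assms by (auto simp: test_fun01_def differentiable_on_def)
  show "(\<phi> has_real_derivative deriv \<phi> s) (at s)"
    using d[of 0 s] DERIV_deriv_iff_real_differentiable[of \<phi> s] by simp
  show "(deriv \<phi> has_real_derivative (deriv ^^ 2) \<phi> s) (at s)"
    using d[of 1 s] DERIV_deriv_iff_real_differentiable[of "deriv \<phi>" s] by (simp add: numeral_2_eq_2)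
  have c: "continuous_on S ((deriv ^^ n) \<phi>)" for n
    by (rule differentiable_imp_continuous_on) (auto intro: differentiable_at_imp_differentiable_on d)
  show "continuous_on S \<phi>" "continuous_on S (deriv \<phi>)" "continuous_on S ((deriv ^^ 2) \<phi>)"
    using c[of 0] c[of 1] c[of 2] by simp_all
qed

text \<open>Two integrations by parts move both derivatives from the test function to \<open>\<eta>\<close>; the second one
  uses that \<open>G\<close> is a density of \<open>\<eta>'\<close>.\<close>

lemma curvature_weak_form:
  assumes X: "\<eta> \<in> X_space" and G: "has_curvature \<eta> G" and \<phi>: "test_fun01 \<phi>"
  shows "(LINT s:{0<..<1}|lebesgue. \<eta> s * (deriv ^^ 2) \<phi> s) = (LINT s:{0<..<1}|lborel. G s * \<phi> s)"
    and "(LINT s:{0<..<1}|lebesgue. G s * \<phi> s) = (LINT s:{0<..<1}|lborel. G s * \<phi> s)"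
    and "set_integrable lborel {0<..<1} (\<lambda>s. G s * \<phi> s)"
proof -
  obtain c d where cd: "0 < c" "c < d" "d < 1"
    and z: "\<And>s. s \<notin> {c<..<d} \<Longrightarrow> \<phi> s = 0"
      "\<And>s. s \<notin> {c<..<d} \<Longrightarrow> deriv \<phi> s = 0"
      "\<And>s. s \<notin> {c<..<d} \<Longrightarrow> (deriv ^^ 2) \<phi> s = 0"
    by (rule test_fun01E[OF \<phi>]) blast
  note D = test_fun01_deriv[OF \<phi>]
  have e': "continuous_on {0..<1} (deriv01 \<eta>)" using X by (simp add: X_space_def)
  have De: "(\<eta> has_real_derivative deriv01 \<eta> s) (at s within {c..d})" if "s \<in> {c..d}" for s
    by (rule DERIV_subset[OF X_space_deriv01[OF X]]) (use that cd in auto)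
  have ce: "continuous_on {c..d} \<eta>"
    using De DERIV_continuous continuous_on_eq_continuous_within by blast
  have [measurable]: "G \<in> borel_measurable borel" by (rule has_curvatureD[OF G])
  have [measurable]: "\<phi> \<in> borel_measurable borel" by (intro borel_measurable_continuous_onI D)
  obtain C where C: "\<And>s. s \<in> {0..d} \<Longrightarrow> \<bar>G s\<bar> \<le> C" using has_curvatureD(2)[OF G cd(3)] by blast
  obtain P where P: "\<And>s. s \<in> {c..d} \<Longrightarrow> norm (\<phi> s) \<le> P"
    using continuous_on_compact_bound[OF compact_Icc D(3)] by metis
  obtain P2 where P2: "\<And>s. s \<in> {c..d} \<Longrightarrow> norm ((deriv ^^ 2) \<phi> s) \<le> P2"
    using continuous_on_compact_bound[OF compact_Icc D(5)] by metis
  have i1: "set_integrable lborel {c..d} (\<lambda>s. G s * \<phi> s)"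
  proof (rule bounded_borel_set_integrable)
    show "(\<lambda>s. G s * \<phi> s) \<in> borel_measurable borel" by measurable
    fix r assume r: "r \<in> {c..d}"
    then have "\<bar>G r\<bar> \<le> C" "\<bar>\<phi> r\<bar> \<le> P" using C P cd by auto
    then show "\<bar>G r * \<phi> r\<bar> \<le> C * P" unfolding abs_mult by (intro mult_mono) auto
  qed
  have i2: "set_integrable lborel {c..d} (\<lambda>s. \<eta> s * (deriv ^^ 2) \<phi> s)"
    unfolding set_integrable_def
    by (rule borel_integrable_compact) (auto intro!: continuous_on_mult ce D)
  have "integral {c..d} (\<lambda>s. G s * \<phi> s) = - integral {c..d} (\<lambda>s. deriv01 \<eta> s * deriv \<phi> s)"
  proof -
    have "integral {c..d} (\<lambda>s. G s * \<phi> s) =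
        deriv01 \<eta> d * \<phi> d - deriv01 \<eta> c * \<phi> c - integral {c..d} (\<lambda>s. deriv01 \<eta> s * deriv \<phi> s)"
      by (rule integral_by_parts_density(2)[where C = C])
        (use cd C has_curvatureD(3)[OF G] D in \<open>auto intro: has_field_derivative_at_within\<close>)
    then show ?thesis using z by simp
  qed
  moreover have "integral {c..d} (\<lambda>s. \<eta> s * (deriv ^^ 2) \<phi> s) = - integral {c..d} (\<lambda>s. deriv01 \<eta> s * deriv \<phi> s)"
  proof -
    have "integral {c..d} (\<lambda>s. (deriv ^^ 2) \<phi> s * \<eta> s) =
        deriv \<phi> d * \<eta> d - deriv \<phi> c * \<eta> c - integral {c..d} (\<lambda>s. deriv \<phi> s * deriv01 \<eta> s)"
    proof (rule integral_by_parts_density(2)[where C = P2])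
      show "(deriv ^^ 2) \<phi> \<in> borel_measurable borel" by (intro borel_measurable_continuous_onI D)
      show "continuous_on {c..d} (deriv01 \<eta>)" using e' by (rule continuous_on_subset) (use cd in auto)
      show "deriv \<phi> y - deriv \<phi> x = integral {x..y} ((deriv ^^ 2) \<phi>)" if "x \<le> y" for x y
        using that D(2)
        by (intro integral_unique[symmetric] fundamental_theorem_of_calculus)
          (auto simp: has_real_derivative_iff_has_vector_derivative[symmetric] intro: has_field_derivative_at_within)
    qed (use cd P2 De in auto)
    then show ?thesis using z by (simp add: mult.commute)
  qed
  moreover note lebesgue_integral_01_supported[OF i1 cd(1,3)] lebesgue_integral_01_supported[OF i2 cd(1,3)]
  moreover have "G s * \<phi> s = 0" "\<eta> s * (deriv ^^ 2) \<phi> s = 0" if "s \<notin> {c..d}" for s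
    using z[of s] that by auto
  ultimately show "(LINT s:{0<..<1}|lebesgue. \<eta> s * (deriv ^^ 2) \<phi> s) = (LINT s:{0<..<1}|lborel. G s * \<phi> s)"
    "(LINT s:{0<..<1}|lebesgue. G s * \<phi> s) = (LINT s:{0<..<1}|lborel. G s * \<phi> s)"
    "set_integrable lborel {0<..<1} (\<lambda>s. G s * \<phi> s)"
    by simp_all
qed

lemma curvature_is_second_distr_deriv:
  assumes X: "\<eta> \<in> X_space" and G: "has_curvature \<eta> G"
  shows "is_second_distr_deriv \<eta> G"
  unfolding is_second_distr_deriv_def
proof (intro conjI allI impI)
  have [measurable]: "G \<in> borel_measurable borel" by (rule has_curvatureD[OF G])
  have "(\<lambda>s. indicator {0..<1} s *\<^sub>R G s) \<in> borel_measurable lborel" by measurable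
  then show "set_borel_measurable lebesgue {0..<1} G"
    unfolding set_borel_measurable_def by (rule measurable_completion)
  show "\<exists>C. AE s in lebesgue. s \<in> {0..1 - \<delta>} \<longrightarrow> \<bar>G s\<bar> \<le> C" if "\<delta> > 0" for \<delta>
  proof -
    obtain C where "\<forall>s\<in>{0..1 - \<delta>}. \<bar>G s\<bar> \<le> C" using has_curvatureD(2)[OF G, of "1 - \<delta>"] \<open>\<delta> > 0\<close> by auto
    then have "AE s in lebesgue. s \<in> {0..1 - \<delta>} \<longrightarrow> \<bar>G s\<bar> \<le> C" by (intro AE_I2) blast
    then show ?thesis by blast
  qed
qed (simp add: curvature_weak_form[OF X G])

text \<open>A Lebesgue measurable representative is first replaced by a Borel one, which is only essentially
  bounded; the difference to \<open>G\<close> is then annihilated by all test functions.\<close>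

lemma second_distr_deriv_unique:
  assumes X: "\<eta> \<in> X_space" and G: "has_curvature \<eta> G" and g: "is_second_distr_deriv \<eta> g"
  shows "AE s in lborel. s \<in> {0..<1} \<longrightarrow> g s = G s"
proof -
  have [measurable]: "G \<in> borel_measurable borel" by (rule has_curvatureD[OF G])
  have gm: "(\<lambda>s. indicator {0..<1} s *\<^sub>R g s) \<in> borel_measurable lebesgue"
    using g by (simp add: is_second_distr_deriv_def set_borel_measurable_def)
  then obtain g' where g'm: "g' \<in> borel_measurable lborel"
    and "AE s in lborel. indicator {0..<1} s *\<^sub>R g s = g' s"
    using completion_ex_borel_measurable_real by blast
  then have gg': "AE s in lborel. s \<in> {0..<1} \<longrightarrow> g s = g' s"
    by (auto elim!: eventually_mono)
  have [measurable]: "g' \<in> borel_measurable borel" using g'm by simp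
  have g'bd: "\<exists>C. AE s in lborel. s \<in> {0..d} \<longrightarrow> \<bar>g' s\<bar> \<le> C" if d: "d < 1" for d
  proof -
    have "1 - d > 0" using d by simp
    then obtain C where "AE s in lebesgue. s \<in> {0..1 - (1 - d)} \<longrightarrow> \<bar>g s\<bar> \<le> C"
      using g unfolding is_second_distr_deriv_def by blast
    then have "AE s in lborel. s \<in> {0..d} \<longrightarrow> \<bar>g s\<bar> \<le> C" by (simp add: AE_completion_iff)
    with gg' have "AE s in lborel. s \<in> {0..d} \<longrightarrow> \<bar>g' s\<bar> \<le> C"
      by eventually_elim (use d in auto)
    then show ?thesis by blast
  qed
  have "AE s in lborel. s \<in> {0..<1} \<longrightarrow> g' s - G s = 0"
  proof (rule test_functions_separate)
    fix d :: real assume d: "d < 1"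
    obtain C where C: "AE s in lborel. s \<in> {0..d} \<longrightarrow> \<bar>g' s\<bar> \<le> C" using g'bd[OF d] by blast
    obtain C' where C': "\<forall>s\<in>{0..d}. \<bar>G s\<bar> \<le> C'" using has_curvatureD(2)[OF G d] by blast
    have "AE s in lborel. s \<in> {0..d} \<longrightarrow> \<bar>g' s - G s\<bar> \<le> C + C'"
      using C by eventually_elim (use C' in fastforce)
    then show "\<exists>C. AE s in lborel. s \<in> {0..d} \<longrightarrow> \<bar>g' s - G s\<bar> \<le> C" by blast
  next
    fix \<phi> assume \<phi>: "test_fun01 \<phi>"
    obtain c d where cd: "0 < c" "c < d" "d < 1" and z: "\<And>s. s \<notin> {c<..<d} \<Longrightarrow> \<phi> s = 0"
      by (rule test_fun01E[OF \<phi>]) blast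
    note D = test_fun01_deriv[OF \<phi>]
    have [measurable]: "\<phi> \<in> borel_measurable borel" by (intro borel_measurable_continuous_onI D)
    obtain P where P: "\<And>s. s \<in> {c..d} \<Longrightarrow> norm (\<phi> s) \<le> P"
      using continuous_on_compact_bound[OF compact_Icc D(3)] by metis
    obtain C where C: "AE s in lborel. s \<in> {0..d} \<longrightarrow> \<bar>g' s\<bar> \<le> C" using g'bd[OF cd(3)] by blast
    have i1: "set_integrable lborel {c..d} (\<lambda>s. g' s * \<phi> s)"
    proof (rule ess_bounded_set_integrable)
      show "AE r in lborel. r \<in> {c..d} \<longrightarrow> \<bar>g' r * \<phi> r\<bar> \<le> C * P"
        using C
      proof eventually_elim
        case (elim r)
        then show ?case using P[of r] cd unfolding abs_mult by (auto intro!: mult_mono)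
      qed
    qed measurable
    have z': "g' s * \<phi> s = 0" if "s \<notin> {c..d}" for s using z[of s] that by auto
    note I = lebesgue_integral_01_supported[OF i1 cd(1,3) z']
    have "(LINT s:{0<..<1}|lebesgue. g s * \<phi> s) = (LINT s:{0<..<1}|lebesgue. g' s * \<phi> s)"
      unfolding set_lebesgue_integral_def
    proof (rule integral_cong_AE)
      have \<phi>': "\<phi> \<in> borel_measurable lebesgue" by (rule measurable_completion) simp
      have i': "(indicator {0<..<1} :: real \<Rightarrow> real) \<in> borel_measurable lebesgue"
        by (rule borel_measurable_indicator) simp
      have "(\<lambda>s. indicator {0<..<1} s *\<^sub>R ((indicator {0..<1} s *\<^sub>R g s) * \<phi> s)) \<in> borel_measurable lebesgue"
        by (intro borel_measurable_scaleR borel_measurable_times gm \<phi>' i')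
      moreover have "(\<lambda>s. indicator {0<..<1} s *\<^sub>R ((indicator {0..<1} s *\<^sub>R g s) * \<phi> s)) = (\<lambda>s. indicator {0<..<1} s *\<^sub>R (g s * \<phi> s))"
        by (auto simp: indicator_def fun_eq_iff)
      ultimately show "(\<lambda>s. indicator {0<..<1} s *\<^sub>R (g s * \<phi> s)) \<in> borel_measurable lebesgue" by simp
      show "(\<lambda>s. indicator {0<..<1} s *\<^sub>R (g' s * \<phi> s)) \<in> borel_measurable lebesgue"
        by (rule measurable_completion) measurable
      show "AE s in lebesgue. indicator {0<..<1} s *\<^sub>R (g s * \<phi> s) = indicator {0<..<1} s *\<^sub>R (g' s * \<phi> s)"
        unfolding AE_completion_iff using gg' by eventually_elim (auto simp: indicator_def)
    qed
    moreover have "(LINT s:{0<..<1}|lebesgue. g s * \<phi> s) = (LINT s:{0<..<1}|lebesgue. \<eta> s * (deriv ^^ 2) \<phi> s)"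
      using g \<phi> by (simp add: is_second_distr_deriv_def)
    ultimately have "(LINT s:{0<..<1}|lborel. g' s * \<phi> s) = (LINT s:{0<..<1}|lborel. G s * \<phi> s)"
      using curvature_weak_form(1)[OF X G \<phi>] I(1,2) by simp
    moreover have "(LINT s:{0<..<1}|lborel. g' s * \<phi> s - G s * \<phi> s)
        = (LINT s:{0<..<1}|lborel. g' s * \<phi> s) - (LINT s:{0<..<1}|lborel. G s * \<phi> s)"
      by (rule set_integral_diff(2)[OF I(3) curvature_weak_form(3)[OF X G \<phi>]])
    ultimately show "(LINT s:{0<..<1}|lborel. (g' s - G s) * \<phi> s) = 0"
      by (simp add: left_diff_distrib)
  qed measurable
  with gg' show ?thesis by eventually_elim auto
qed

text \<open>This removes the arbitrary choice in \<open>second_deriv\<close>: up to a null set it is any density of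
  \<open>\<eta>'\<close>.\<close>

lemma second_deriv_eq_curvature:
  assumes "\<eta> \<in> X_space" "has_curvature \<eta> G"
  shows "AE s in lborel. s \<in> {0..<1} \<longrightarrow> second_deriv \<eta> s = G s"
  using second_distr_deriv_unique[OF assms someI[of "is_second_distr_deriv \<eta>", OF curvature_is_second_distr_deriv[OF assms]]]
  by (simp only: second_deriv_def)

section \<open>Comparison with competitors that differ on a compact interval\<close>

text \<open>The negated integrand of the dual functional, with the curvature as argument. For
  \<open>G s \<ge> 0\<close> and \<open>s < 1\<close> it is the square of \<open>sqrt (G s * (1 - s)) - 1 / sqrt (1 - s)\<close>.\<close>

definition defect :: "(real \<Rightarrow> real) \<Rightarrow> real \<Rightarrow> real" where
  "defect G s = G s * (1 - s) + 1 / (1 - s) - 2 * sqrt (G s)"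

lemma defect_nonneg:
  assumes "G s \<ge> 0" "s < 1"
  shows "defect G s \<ge> 0"
proof -
  define q where "q = sqrt (1 - s)"
  have q: "q > 0" "q\<^sup>2 = 1 - s" using assms(2) by (auto simp: q_def)
  have "defect G s = (sqrt (G s) * q - 1 / q)\<^sup>2"
    using q(1) assms(1) unfolding defect_def q(2)[symmetric]
    by (simp add: power2_diff power_mult_distrib power_divide)
  then show ?thesis by simp
qed

lemma Lambda_iff_curvature:
  assumes "\<eta> \<in> X_space" "has_curvature \<eta> G"
  shows "\<eta> \<in> Lambda \<xi> h \<longleftrightarrow> (\<forall>s\<in>{0..<1}. \<eta> s \<ge> \<xi> s) \<and> deriv01 \<eta> 0 = - h\<^sup>2 \<and>
     (AE s in lborel. s \<in> {0..<1} \<longrightarrow> G s \<ge> 0)"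
proof -
  have "(AE s in lborel. s \<in> {0..<1} \<longrightarrow> second_deriv \<eta> s \<ge> 0) \<longleftrightarrow> (AE s in lborel. s \<in> {0..<1} \<longrightarrow> G s \<ge> 0)"
  proof
    assume "AE s in lborel. s \<in> {0..<1} \<longrightarrow> second_deriv \<eta> s \<ge> 0"
    with second_deriv_eq_curvature[OF assms] show "AE s in lborel. s \<in> {0..<1} \<longrightarrow> G s \<ge> 0"
      by eventually_elim auto
  next
    assume "AE s in lborel. s \<in> {0..<1} \<longrightarrow> G s \<ge> 0"
    with second_deriv_eq_curvature[OF assms] show "AE s in lborel. s \<in> {0..<1} \<longrightarrow> second_deriv \<eta> s \<ge> 0"
      by eventually_elim auto
  qed
  then show ?thesis using assms(1) by (simp add: Lambda_def AE_completion_iff)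
qed

text \<open>Changing the density on a null set makes it non-negative everywhere, so that square roots
  can be estimated pointwise.\<close>

lemma Lambda_nonneg_curvature:
  assumes "\<eta> \<in> Lambda \<xi> h"
  obtains G where "has_curvature \<eta> G" "\<And>s. G s \<ge> 0"
proof -
  have X: "\<eta> \<in> X_space" using assms by (simp add: Lambda_def)
  obtain H where H: "has_curvature \<eta> H" by (rule X_space_has_curvature[OF X])
  have H0: "AE s in lborel. s \<in> {0..<1} \<longrightarrow> H s \<ge> 0"
    using assms by (simp add: Lambda_iff_curvature[OF X H])
  have [measurable]: "H \<in> borel_measurable borel" by (rule has_curvatureD[OF H])
  define G where "G s = max (H s) 0" for s
  have Gm [measurable]: "G \<in> borel_measurable borel" unfolding G_def by measurable
  have Gb: "\<exists>C. \<forall>s\<in>{0..d}. \<bar>G s\<bar> \<le> C" if d: "d < 1" for d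
  proof -
    obtain C where "\<forall>s\<in>{0..d}. \<bar>H s\<bar> \<le> C" using has_curvatureD(2)[OF H d] by blast
    moreover have "\<bar>G s\<bar> \<le> \<bar>H s\<bar>" for s by (simp add: G_def)
    ultimately show ?thesis by (meson order_trans)
  qed
  have "integral {x..y} G = integral {x..y} H" if xy: "0 \<le> x" "y < 1" for x y
  proof -
    obtain C where C: "\<forall>s\<in>{0..y}. \<bar>H s\<bar> \<le> C" using has_curvatureD(2)[OF H xy(2)] by blast
    obtain C' where C': "\<forall>s\<in>{0..y}. \<bar>G s\<bar> \<le> C'" using Gb[OF xy(2)] by blast
    have i: "set_integrable lborel {x..y} H" by (rule bounded_borel_set_integrable[where C = C]) (use C xy in auto)
    have i': "set_integrable lborel {x..y} G" by (rule bounded_borel_set_integrable[where C = C']) (use C' xy in auto)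
    have "AE s in lborel. s \<in> {x..y} \<longrightarrow> G s = H s"
      using H0 by eventually_elim (use xy in \<open>auto simp: G_def\<close>)
    then have "(LINT s:{x..y}|lborel. G s) = (LINT s:{x..y}|lborel. H s)"
      by (intro set_lebesgue_integral_cong_AE) auto
    then show ?thesis
      using set_borel_integral_eq_integral(2)[OF i] set_borel_integral_eq_integral(2)[OF i'] by simp
  qed
  then have "has_curvature \<eta> G"
    unfolding has_curvature_def using has_curvatureD(3)[OF H] Gb Gm by auto
  then show ?thesis by (rule that) (simp add: G_def)
qed

definition total_defect :: "(real \<Rightarrow> real) \<Rightarrow> ennreal" where
  "total_defect G = (\<integral>\<^sup>+s\<in>{0..<1}. ennreal (defect G s) \<partial>lborel)"

lemma dual_fun_curvature:
  assumes "\<eta> \<in> X_space" "has_curvature \<eta> G"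
  shows "dual_fun \<xi> h \<eta> = ereal (1 / 2) * (- enn2ereal (total_defect G) + ereal (- \<eta> 0 + h\<^sup>2 + \<xi> 1))"
proof -
  have "(\<integral>\<^sup>+s\<in>{0..<1}. ennreal (- dual_integrand \<eta> s) \<partial>lebesgue) = (\<integral>\<^sup>+s\<in>{0..<1}. ennreal (- dual_integrand \<eta> s) \<partial>lborel)"
    by (rule nn_integral_completion)
  also have "\<dots> = total_defect G"
    unfolding total_defect_def using second_deriv_eq_curvature[OF assms]
    by (intro nn_integral_cong_AE, eventually_elim)
      (auto simp: indicator_def dual_integrand_def defect_def algebra_simps)
  finally show ?thesis by (simp add: dual_fun_def)
qed

lemma sqrt_abs_le: "\<bar>x\<bar> \<le> C \<Longrightarrow> \<bar>sqrt x\<bar> \<le> sqrt C"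
  using real_sqrt_le_mono[of x C] real_sqrt_le_mono[of "- C" x] by (auto simp: real_sqrt_minus abs_le_iff)

text \<open>The optimal value is finite because there is an admissible function without any defect: the
  barrier \<open>- ln (1 - s)\<close> has curvature \<open>1 / (1 - s)\<^sup>2\<close>, where the arithmetic-geometric mean
  inequality is an equality. The affine correction adjusts the slope at \<open>0\<close> and lifts it above \<open>\<xi>\<close>.\<close>

lemma optimal_total_defect_finite:
  assumes opt: "optimal \<xi> h \<eta>" and G: "has_curvature \<eta> G"
    and B: "\<And>s. s \<in> {0..<1} \<Longrightarrow> \<xi> s \<le> B"
  shows "total_defect G < \<infinity>"
proof -
  have X: "\<eta> \<in> X_space" using opt by (auto simp: optimal_def Lambda_def)
  define \<zeta> where "\<zeta> s = - ln (1 - s) - s + h\<^sup>2 * (1 - s) + B" for s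
  define D where "D s = 1 / (1 - s) - 1 - h\<^sup>2" for s :: real
  define H where "H s = (1 / (1 - s))\<^sup>2" for s :: real
  have D: "(\<zeta> has_real_derivative D s) (at s within {0..<1})" if "s \<in> {0..<1}" for s
    unfolding \<zeta>_def[abs_def] D_def using that
    by (auto intro!: derivative_eq_intros simp: field_simps)
  have Hm: "H \<in> borel_measurable borel" unfolding H_def by measurable
  have Hb: "\<exists>C. \<forall>s\<in>{0..d}. \<bar>H s\<bar> \<le> C" if "d < 1" for d
  proof (intro exI ballI)
    fix s assume "s \<in> {0..d}"
    then have "1 / (1 - s) \<le> 1 / (1 - d)" "1 / (1 - s) \<ge> 0" using that by (auto intro!: divide_left_mono mult_pos_pos)
    then show "\<bar>H s\<bar> \<le> (1 / (1 - d))\<^sup>2" by (simp add: H_def power_mono)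
  qed
  have HD: "D y - D x = integral {x..y} H" if xy: "0 \<le> x" "x \<le> y" "y < 1" for x y
  proof -
    have "(H has_integral (D y - D x)) {x..y}"
      using xy by (intro fundamental_theorem_of_calculus)
        (auto simp: has_real_derivative_iff_has_vector_derivative[symmetric] D_def[abs_def] H_def power2_eq_square
          intro!: derivative_eq_intros)
    then show ?thesis by (simp add: integral_unique)
  qed
  have \<zeta>: "\<zeta> \<in> X_space" "has_curvature \<zeta> H" by (rule X_spaceI_density[OF D Hm Hb HD]; assumption)+
  have "\<zeta> s \<ge> \<xi> s" if s: "s \<in> {0..<1}" for s
  proof -
    have "ln (1 - s) \<le> - s" using ln_le_minus_one[of "1 - s"] s by simp
    moreover have "h\<^sup>2 * (1 - s) \<ge> 0" using s by simp
    ultimately show ?thesis using B[OF s] by (simp add: \<zeta>_def)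
  qed
  moreover have "deriv01 \<zeta> 0 = - h\<^sup>2" using deriv01_eqI[OF D[of 0]] by (simp add: D_def)
  ultimately have "\<zeta> \<in> Lambda \<xi> h" by (simp add: Lambda_iff_curvature[OF \<zeta>] H_def)
  then have le: "dual_fun \<xi> h \<zeta> \<le> dual_fun \<xi> h \<eta>" using opt by (simp add: optimal_def)
  have dH: "defect H s = 0" if "s < 1" for s
  proof -
    have "sqrt (H s) = 1 / (1 - s)" using that by (simp add: H_def)
    then show ?thesis using that by (simp add: defect_def H_def power2_eq_square)
  qed
  have "total_defect H = (\<integral>\<^sup>+s. 0 \<partial>(lborel :: real measure))"
    unfolding total_defect_def
    by (intro nn_integral_cong) (auto simp: indicator_def dH)
  then have H0: "total_defect H = 0" by simp
  show ?thesis
  proof (rule ccontr)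
    assume "\<not> total_defect G < \<infinity>"
    then have "total_defect G = \<infinity>" by (metis infinity_ennreal_def less_top)
    then show False using le
      by (simp add: dual_fun_curvature[OF \<zeta>] dual_fun_curvature[OF X G] H0)
  qed
qed

text \<open>Taylor's formula with integral remainder, read backwards: integration by parts writes the
  moment function as an iterated integral of \<open>w\<close>.\<close>

lemma moment_function_deriv:
  fixes w :: "real \<Rightarrow> real"
  assumes w: "w \<in> borel_measurable borel" "\<And>r. \<bar>w r\<bar> \<le> C" and s: "s \<in> {0..1}"
  shows "((\<lambda>s. integral {0..s} (\<lambda>r. (s - r) * w r)) has_real_derivative integral {0..s} w) (at s within {0..1})"
proof -
  define W where "W s = integral {0..s} w" for s
  have wint: "w integrable_on {x..y}" for x y by (rule bounded_borel_integrable_on[OF w])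
  have cW: "continuous_on {0..1} W" unfolding W_def by (rule indefinite_integral_continuous_1[OF wint])
  have eq: "integral {0..s} (\<lambda>r. (s - r) * w r) = integral {0..s} W" if s: "s \<in> {0..1}" for s
  proof -
    have "integral {0..s} (\<lambda>r. w r * (s - r)) = W s * (s - s) - W 0 * (s - 0) - integral {0..s} (\<lambda>r. W r * (- 1))"
    proof (rule integral_by_parts_density(2)[OF _ w(1), of _ _ C])
      show "W y - W x = integral {x..y} w" if "0 \<le> x" "x \<le> y" for x y
        using Henstock_Kurzweil_Integration.integral_combine[OF that wint] by (simp add: W_def)
    qed (use s w in \<open>auto intro!: derivative_eq_intros\<close>)
    moreover have "W 0 = 0" by (simp add: W_def)
    ultimately show ?thesis by (simp add: mult.commute)
  qed
  have "((\<lambda>s. integral {0..s} W) has_real_derivative W s) (at s within {0..1})"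
    by (rule integral_has_real_derivative[OF cW s])
  then show ?thesis unfolding W_def[symmetric]
    by (rule has_field_derivative_transform_within[of _ _ _ _ 1]) (use s eq in auto)
qed

text \<open>The competitor adds to \<open>\<eta>\<close> the function \<open>v\<close> with \<open>v'' = w\<close> and \<open>v 0 = v' 0 = 0\<close>. The two moment
  conditions make \<open>v\<close> vanish to the right of \<open>\<beta>\<close>, so the obstacle matters only on
  \<open>[\<alpha>,\<beta>]\<close>. They also cancel the linear part \<open>w s * (1 - s)\<close> of the change in the functional, which
  leaves the square roots. Finiteness of the optimal value allows the common contribution of the complement
  of \<open>[\<alpha>,\<beta>]\<close> to be subtracted.\<close>

lemma comparison_principle:
  fixes w :: "real \<Rightarrow> real"
  assumes opt: "optimal \<xi> h \<eta>" and G: "has_curvature \<eta> G"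
    and B: "\<And>s. s \<in> {0..<1} \<Longrightarrow> \<xi> s \<le> B"
    and \<alpha>\<beta>: "0 \<le> \<alpha>" "\<alpha> \<le> \<beta>" "\<beta> < 1"
    and w: "w \<in> borel_measurable borel" "\<And>r. \<bar>w r\<bar> \<le> C" "\<And>r. r \<notin> {\<alpha>..\<beta>} \<Longrightarrow> w r = 0"
    and moments: "integral {\<alpha>..\<beta>} w = 0" "integral {\<alpha>..\<beta>} (\<lambda>r. r * w r) = 0"
    and nn: "AE s in lborel. s \<in> {\<alpha>..\<beta>} \<longrightarrow> G s + w s \<ge> 0"
    and obstacle: "\<And>s. s \<in> {\<alpha>..\<beta>} \<Longrightarrow> \<xi> s \<le> \<eta> s + integral {\<alpha>..s} (\<lambda>r. (s - r) * w r)"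
  shows "integral {\<alpha>..\<beta>} (\<lambda>s. sqrt (G s + w s)) \<le> integral {\<alpha>..\<beta>} (\<lambda>s. sqrt (G s))"
proof -
  have X: "\<eta> \<in> X_space" and \<eta>\<Lambda>: "\<eta> \<in> Lambda \<xi> h" using opt by (auto simp: optimal_def Lambda_def)
  have [measurable]: "G \<in> borel_measurable borel" "w \<in> borel_measurable borel"
    by (rule has_curvatureD[OF G]) (rule w)
  note \<eta>L = \<eta>\<Lambda>[unfolded Lambda_iff_curvature[OF X G]]
  have G0: "AE s in lborel. s \<in> {0..<1} \<longrightarrow> G s \<ge> 0" using \<eta>L by blast
  have wint: "w integrable_on {x..y}" for x y by (rule bounded_borel_integrable_on[OF w(1,2)])
  have gwint: "(\<lambda>r. g r * w r) integrable_on {x..y}" if gc: "continuous_on UNIV g" for g x y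
  proof -
    have [measurable]: "g \<in> borel_measurable borel" by (rule borel_measurable_continuous_onI[OF gc])
    obtain M where "\<And>r. r \<in> {x..y} \<Longrightarrow> norm (g r) \<le> M"
      using continuous_on_compact_bound[OF compact_Icc continuous_on_subset[OF gc subset_UNIV]] by metis
    then show ?thesis
      by (intro bounded_borel_integrable_on[where C = "M * C"])
        (use w(2) in \<open>auto simp: abs_mult intro!: mult_mono intro: order_trans[OF abs_ge_zero]\<close>)
  qed
  define v where "v s = integral {0..s} (\<lambda>r. (s - r) * w r)" for s
  define W where "W s = integral {0..s} w" for s
  have v_in: "v s = integral {\<alpha>..s} (\<lambda>r. (s - r) * w r)" if "\<alpha> \<le> s" for s
  proof -
    have "integral {0..\<alpha>} (\<lambda>r. (s - r) * w r) = integral {0..\<alpha>} (\<lambda>r. 0)"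
      by (rule integral_spike[of "{\<alpha>}"]) (use w(3) in auto)
    then show ?thesis
      unfolding v_def
      using Henstock_Kurzweil_Integration.integral_combine[OF \<alpha>\<beta>(1) that gwint[of "\<lambda>r. s - r"]]
      by (simp add: continuous_intros)
  qed
  have v_left: "v s = 0" if "s < \<alpha>" for s
  proof -
    have "integral {0..s} (\<lambda>r. (s - r) * w r) = integral {0..s} (\<lambda>r. 0)"
      by (rule Henstock_Kurzweil_Integration.integral_cong) (use that w(3) in auto)
    then show ?thesis by (simp add: v_def)
  qed
  have v_right: "v s = 0" if "\<beta> < s" for s
  proof -
    have "integral {\<beta>..s} (\<lambda>r. (s - r) * w r) = integral {\<beta>..s} (\<lambda>r. 0)"
      by (rule integral_spike[of "{\<beta>}"]) (use w(3) in auto)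
    moreover have "integral {\<alpha>..s} (\<lambda>r. (s - r) * w r) = integral {\<alpha>..\<beta>} (\<lambda>r. (s - r) * w r) + integral {\<beta>..s} (\<lambda>r. (s - r) * w r)"
      by (rule Henstock_Kurzweil_Integration.integral_combine[symmetric])
        (use \<alpha>\<beta> that in \<open>auto intro!: gwint continuous_intros\<close>)
    moreover have "integral {\<alpha>..\<beta>} (\<lambda>r. (s - r) * w r) = integral {\<alpha>..\<beta>} (\<lambda>r. s * w r) - integral {\<alpha>..\<beta>} (\<lambda>r. r * w r)"
      unfolding left_diff_distrib
      by (rule Henstock_Kurzweil_Integration.integral_diff) (auto intro!: gwint continuous_intros)
    ultimately show ?thesis using v_in[of s] that \<alpha>\<beta> moments by simp
  qed
  define \<zeta> where "\<zeta> s = \<eta> s + v s" for s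
  define D where "D s = deriv01 \<eta> s + W s" for s
  define H where "H s = G s + w s" for s
  have [measurable]: "H \<in> borel_measurable borel" unfolding H_def by measurable
  have D: "(\<zeta> has_real_derivative D s) (at s within {0..<1})" if "s \<in> {0..<1}" for s
    unfolding \<zeta>_def[abs_def] D_def v_def W_def
    by (intro DERIV_add X_space_deriv01[OF X that] DERIV_subset[OF moment_function_deriv[OF w(1,2)]])
      (use that in auto)
  have Gbd: "\<exists>C. \<forall>s\<in>{0..d}. \<bar>G s\<bar> \<le> C" "\<exists>C. \<forall>s\<in>{0..d}. \<bar>H s\<bar> \<le> C" if "d < 1" for d
  proof -
    obtain C' where C': "\<forall>s\<in>{0..d}. \<bar>G s\<bar> \<le> C'" using has_curvatureD(2)[OF G \<open>d < 1\<close>] by blast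
    have "\<bar>H s\<bar> \<le> C' + C" if "s \<in> {0..d}" for s
      using C' w(2)[of s] that unfolding H_def by (smt (verit))
    then show "\<exists>C. \<forall>s\<in>{0..d}. \<bar>G s\<bar> \<le> C" "\<exists>C. \<forall>s\<in>{0..d}. \<bar>H s\<bar> \<le> C" using C' by blast+
  qed
  have HD: "D y - D x = integral {x..y} H" if xy: "0 \<le> x" "x \<le> y" "y < 1" for x y
  proof -
    have Gi: "G integrable_on {x..y}"
    proof -
      obtain C' where "\<forall>s\<in>{0..y}. \<bar>G s\<bar> \<le> C'" using Gbd(1)[OF xy(3)] by blast
      then show ?thesis by (intro bounded_borel_integrable_on[where C = C']) (use xy in auto)
    qed
    show ?thesis
      unfolding D_def H_def
      using has_curvatureD(3)[OF G xy] Henstock_Kurzweil_Integration.integral_combine[OF xy(1,2) wint]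
      by (simp add: W_def Henstock_Kurzweil_Integration.integral_add[OF Gi wint])
  qed
  have \<zeta>: "\<zeta> \<in> X_space" "has_curvature \<zeta> H"
    by (rule X_spaceI_density[OF D _ Gbd(2) HD]; (assumption | measurable))+
  have "\<xi> s \<le> \<zeta> s" if "s \<in> {0..<1}" for s
    using \<eta>L that v_left[of s] v_right[of s] v_in[of s] obstacle[of s]
    by (cases "s < \<alpha>"; cases "s > \<beta>") (auto simp: \<zeta>_def)
  moreover have "deriv01 \<zeta> 0 = - h\<^sup>2"
    using deriv01_eqI[OF D[of 0]] \<eta>L by (simp add: D_def W_def)
  moreover have H0: "AE s in lborel. s \<in> {0..<1} \<longrightarrow> H s \<ge> 0"
    using G0 nn
  proof eventually_elim
    case (elim s)
    then show ?case using w(3)[of s] by (cases "s \<in> {\<alpha>..\<beta>}") (auto simp: H_def)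
  qed
  ultimately have "\<zeta> \<in> Lambda \<xi> h" by (simp add: Lambda_iff_curvature[OF \<zeta>])
  then have le: "dual_fun \<xi> h \<zeta> \<le> dual_fun \<xi> h \<eta>" using opt by (simp add: optimal_def)
  have fin: "total_defect G < \<infinity>" by (rule optimal_total_defect_finite[OF opt G B])
  have "v 0 = 0" by (simp add: v_def)
  then have "\<zeta> 0 = \<eta> 0" by (simp add: \<zeta>_def)
  have tot: "total_defect G \<le> total_defect H"
  proof (cases "total_defect H")
    case (real b)
    obtain a where a: "a \<ge> 0" "total_defect G = ennreal a" using fin by (cases "total_defect G") auto
    have "ereal (1 / 2) * (- ereal b + ereal (- \<eta> 0 + h\<^sup>2 + \<xi> 1)) \<le> ereal (1 / 2) * (- ereal a + ereal (- \<eta> 0 + h\<^sup>2 + \<xi> 1))"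
      using le real a by (simp add: dual_fun_curvature[OF \<zeta>] dual_fun_curvature[OF X G] \<open>\<zeta> 0 = \<eta> 0\<close>)
    then have "a \<le> b" by simp
    then show ?thesis using real a by (simp add: ennreal_leI)
  qed simp
  \<comment> \<open>Outside \<open>[\<alpha>,\<beta>]\<close> the two defects coincide; this common part is finite and can be cancelled.\<close>
  let ?K = "{\<alpha>..\<beta>}"
  have [measurable]: "defect H \<in> borel_measurable borel" "defect G \<in> borel_measurable borel"
    unfolding defect_def[abs_def] by measurable
  have split: "total_defect F = (\<integral>\<^sup>+s\<in>?K. ennreal (defect F s) \<partial>lborel) + (\<integral>\<^sup>+s\<in>({0..<1} - ?K). ennreal (defect F s) \<partial>lborel)"
    if [measurable]: "defect F \<in> borel_measurable borel" for F
  proof -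
    have "(\<integral>\<^sup>+s\<in>?K. ennreal (defect F s) \<partial>lborel) + (\<integral>\<^sup>+s\<in>({0..<1} - ?K). ennreal (defect F s) \<partial>lborel)
      = (\<integral>\<^sup>+s. ennreal (defect F s) * indicator ?K s + ennreal (defect F s) * indicator ({0..<1} - ?K) s \<partial>lborel)"
      by (rule nn_integral_add[symmetric]) measurable
    also have "\<dots> = total_defect F"
      unfolding total_defect_def
      by (rule nn_integral_cong) (use \<alpha>\<beta> in \<open>auto simp: indicator_def\<close>)
    finally show ?thesis by simp
  qed
  have out: "(\<integral>\<^sup>+s\<in>({0..<1} - ?K). ennreal (defect H s) \<partial>lborel) = (\<integral>\<^sup>+s\<in>({0..<1} - ?K). ennreal (defect G s) \<partial>lborel)"
    by (rule nn_integral_cong) (use w(3) in \<open>auto simp: indicator_def defect_def H_def\<close>)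
  have "(\<integral>\<^sup>+s\<in>({0..<1} - ?K). ennreal (defect G s) \<partial>lborel) \<noteq> \<infinity>"
    using fin split[of G] by auto
  then have leK: "(\<integral>\<^sup>+s\<in>?K. ennreal (defect G s) \<partial>lborel) \<le> (\<integral>\<^sup>+s\<in>?K. ennreal (defect H s) \<partial>lborel)"
    using tot split[of G] split[of H] out by (simp add: add.commute)
  have K: "(\<integral>\<^sup>+s\<in>?K. ennreal (defect F s) \<partial>lborel) = ennreal (integral ?K (defect F)) \<and> integral ?K (defect F) \<ge> 0
      \<and> defect F integrable_on ?K \<and> (\<lambda>s. sqrt (F s)) integrable_on ?K"
    if F: "F \<in> {G, H}" for F
  proof -
    have Fm [measurable]: "F \<in> borel_measurable borel" using F by auto
    have dm [measurable]: "defect F \<in> borel_measurable borel" using F by auto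
    have F0: "AE s in lborel. s \<in> {0..<1} \<longrightarrow> F s \<ge> 0" using F G0 H0 by auto
    obtain C' where C': "\<forall>s\<in>{0..\<beta>}. \<bar>F s\<bar> \<le> C'" using Gbd[OF \<alpha>\<beta>(3)] F by auto
    have bd: "\<bar>defect F s\<bar> \<le> C' * 1 + 1 / (1 - \<beta>) + 2 * sqrt C'" "\<bar>sqrt (F s)\<bar> \<le> sqrt C'" if "s \<in> ?K" for s
    proof -
      have s: "\<bar>F s\<bar> \<le> C'" "0 \<le> s" "s \<le> \<beta>" using that C' \<alpha>\<beta> by auto
      have "\<bar>F s * (1 - s)\<bar> \<le> C' * 1" unfolding abs_mult using s \<alpha>\<beta> by (intro mult_mono) auto
      moreover have "\<bar>1 / (1 - s)\<bar> \<le> 1 / (1 - \<beta>)" using s \<alpha>\<beta> by (auto intro!: divide_left_mono mult_pos_pos)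
      moreover show "\<bar>sqrt (F s)\<bar> \<le> sqrt C'" by (rule sqrt_abs_le[OF s(1)])
      ultimately show "\<bar>defect F s\<bar> \<le> C' * 1 + 1 / (1 - \<beta>) + 2 * sqrt C'"
        unfolding defect_def by linarith
    qed
    have i: "set_integrable lborel ?K (defect F)" by (rule bounded_borel_set_integrable[OF dm bd(1)])
    have nn: "AE s in lborel. 0 \<le> indicator ?K s *\<^sub>R defect F s"
      using F0 by eventually_elim (use \<alpha>\<beta> in \<open>auto simp: indicator_def intro!: defect_nonneg\<close>)
    have "(\<integral>\<^sup>+s\<in>?K. ennreal (defect F s) \<partial>lborel) = (\<integral>\<^sup>+s. ennreal (indicator ?K s *\<^sub>R defect F s) \<partial>lborel)"
      by (rule nn_integral_cong) (auto simp: indicator_def)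
    also have "\<dots> = ennreal (LINT s:?K|lborel. defect F s)"
      unfolding set_lebesgue_integral_def
      by (rule nn_integral_eq_integral) (use i nn in \<open>auto simp: set_integrable_def\<close>)
    finally have "(\<integral>\<^sup>+s\<in>?K. ennreal (defect F s) \<partial>lborel) = ennreal (integral ?K (defect F))"
      using set_borel_integral_eq_integral(2)[OF i] by simp
    moreover have "(LINT s:?K|lborel. defect F s) \<ge> 0"
      unfolding set_lebesgue_integral_def by (rule integral_nonneg_AE[OF nn])
    moreover have "(\<lambda>s. sqrt (F s)) integrable_on ?K"
      by (rule bounded_borel_integrable_on[OF _ bd(2)]) measurable
    ultimately show ?thesis using set_borel_integral_eq_integral[OF i] by simp
  qed
  have "integral ?K (defect G) \<le> integral ?K (defect H)"
    using leK K[of G] K[of H] by simp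
  moreover have "integral ?K (defect H) - integral ?K (defect G) = integral ?K (\<lambda>s. defect H s - defect G s)"
    using K[of G] K[of H] by (simp add: Henstock_Kurzweil_Integration.integral_diff)
  moreover have "integral ?K (\<lambda>s. defect H s - defect G s)
      = integral ?K (\<lambda>s. (w s - s * w s) + 2 * (sqrt (G s) - sqrt (H s)))"
    by (rule Henstock_Kurzweil_Integration.integral_cong) (simp add: defect_def H_def algebra_simps)
  moreover have "\<dots> = 2 * (integral ?K (\<lambda>s. sqrt (G s)) - integral ?K (\<lambda>s. sqrt (H s)))"
  proof -
    have sw: "(\<lambda>s. s * w s) integrable_on ?K" by (rule gwint) (rule continuous_on_id)
    have 1: "integral ?K (\<lambda>s. w s - s * w s) = 0"
      using moments by (simp add: Henstock_Kurzweil_Integration.integral_diff[OF wint sw])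
    have 2: "(\<lambda>s. w s - s * w s) integrable_on ?K" by (intro Henstock_Kurzweil_Integration.integrable_diff wint sw)
    have 3: "(\<lambda>s. sqrt (G s) - sqrt (H s)) integrable_on ?K" using K[of G] K[of H] by (auto intro: Henstock_Kurzweil_Integration.integrable_diff)
    then have 4: "(\<lambda>s. 2 * (sqrt (G s) - sqrt (H s))) integrable_on ?K" by (rule integrable_on_mult_right)
    have 5: "integral ?K (\<lambda>s. sqrt (G s) - sqrt (H s)) = integral ?K (\<lambda>s. sqrt (G s)) - integral ?K (\<lambda>s. sqrt (H s))"
      using K[of G] K[of H] by (intro Henstock_Kurzweil_Integration.integral_diff) auto
    show ?thesis
      unfolding Henstock_Kurzweil_Integration.integral_add[OF 2 4] 1 integral_mult_right 5 by simp
  qed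
  ultimately show ?thesis by (simp add: H_def)
qed

section \<open>The mixture and its sign function\<close>

text \<open>On an interval larger than \<open>[0,1]\<close> the mixture is a power series with non-negative
  coefficients and without constant and linear term. A coefficient of order at least two is positive, as \<open>\<xi>\<close>
  is not zero; hence \<open>\<xi>'' > 0\<close> to the right of \<open>0\<close>. Four derivatives are what the sign function
  involves.\<close>

lemma mixture_regularity:
  fixes \<beta> :: real and b :: "nat \<Rightarrow> real"
  assumes xi: "\<xi> = mixture \<beta> b"
    and nontrivial: "\<exists>t\<in>{0..1}. \<xi> t \<noteq> 0"
    and convergent: "\<exists>\<epsilon>>0. summable (\<lambda>p. \<beta>\<^sup>2 * ((b (p + 2))\<^sup>2 * (1 + \<epsilon>) ^ (p + 2)))"
  obtains r :: real and x1 x2 x3 x4 :: "real \<Rightarrow> real" where "r > 1"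
    "\<And>t. t \<in> {- r<..<r} \<Longrightarrow> (\<xi> has_real_derivative x1 t) (at t)"
    "\<And>t. t \<in> {- r<..<r} \<Longrightarrow> (x1 has_real_derivative x2 t) (at t)"
    "\<And>t. t \<in> {- r<..<r} \<Longrightarrow> (x2 has_real_derivative x3 t) (at t)"
    "\<And>t. t \<in> {- r<..<r} \<Longrightarrow> (x3 has_real_derivative x4 t) (at t)"
    "continuous_on {- r<..<r} x4" "x1 0 = 0" "\<And>t. t \<in> {0<..<r} \<Longrightarrow> x2 t > 0" "x2 0 \<ge> 0"
proof -
  obtain \<epsilon> where \<epsilon>: "\<epsilon> > 0" "summable (\<lambda>p. \<beta>\<^sup>2 * ((b (p + 2))\<^sup>2 * (1 + \<epsilon>) ^ (p + 2)))"
    using convergent by blast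
  have \<beta>: "\<beta> \<noteq> 0" using nontrivial by (auto simp: xi mixture_def)
  define c where "c n = (if n < 2 then 0 else \<beta>\<^sup>2 * (b n)\<^sup>2)" for n
  define r where "r = 1 + \<epsilon>"
  have r: "r > 1" using \<epsilon> by (simp add: r_def)
  have c0: "c n \<ge> 0" for n by (simp add: c_def)
  have sr: "summable (\<lambda>n. c n * r ^ n)"
    using \<epsilon>(2) by (subst summable_iff_shift[symmetric, of _ 2]) (simp add: c_def r_def mult.assoc)
  have sc: "summable (\<lambda>n. c n * t ^ n)" if "norm t < r" for t
    by (rule powser_inside[OF sr]) (use that in simp)
  have \<xi>eq: "\<xi> t = (\<Sum>n. c n * t ^ n)" if "norm t < r" for t
  proof -
    have "summable (\<lambda>p. c (p + 2) * t ^ (p + 2))"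
      using sc[OF that] by (subst summable_iff_shift[of "\<lambda>n. c n * t ^ n" 2])
    then have "summable (\<lambda>p. inverse (\<beta>\<^sup>2) * (c (p + 2) * t ^ (p + 2)))" by (rule summable_mult)
    then have s: "summable (\<lambda>p. (b (p + 2))\<^sup>2 * t ^ (p + 2))" using \<beta> by (simp add: c_def field_simps)
    have "\<xi> t = (\<Sum>p. \<beta>\<^sup>2 * ((b (p + 2))\<^sup>2 * t ^ (p + 2)))"
      unfolding xi mixture_def by (rule suminf_mult[OF s, symmetric])
    also have "\<dots> = (\<Sum>p. c (p + 2) * t ^ (p + 2))" by (simp add: c_def mult.assoc)
    also have "\<dots> = (\<Sum>n. c n * t ^ n)"
      using suminf_split_initial_segment[OF sc[OF that], of 2] by (simp add: c_def numeral_2_eq_2)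
    finally show ?thesis .
  qed
  define P where "P k t = (\<Sum>n. (diffs ^^ k) c n * t ^ n)" for k :: nat and t :: real
  have sk: "summable (\<lambda>n. (diffs ^^ k) c n * t ^ n)" if "norm t < r" for k t
    using that
  proof (induction k arbitrary: t)
    case (Suc k)
    have "summable (\<lambda>n. diffs ((diffs ^^ k) c) n * t ^ n)"
      by (rule termdiff_converges[OF Suc.prems]) (rule Suc.IH)
    then show ?case by simp
  qed (simp add: sc)
  have DP: "(P k has_real_derivative P (Suc k) t) (at t)" if "t \<in> {- r<..<r}" for k t
  proof -
    have "((\<lambda>t. \<Sum>n. (diffs ^^ k) c n * t ^ n) has_real_derivative (\<Sum>n. diffs ((diffs ^^ k) c) n * t ^ n)) (at t)"
      by (rule termdiffs_strong'[of r]) (use sk that in auto)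
    then show ?thesis by (simp add: P_def[abs_def])
  qed
  have D2: "(diffs ^^ 2) c n = real (Suc n) * real (Suc (Suc n)) * c (n + 2)" for n
    by (simp add: numeral_2_eq_2 diffs_def mult.assoc)
  show ?thesis
  proof (rule that[of r "P 1" "P 2" "P 3" "P 4"])
    show "r > 1" by (rule r)
    show "(\<xi> has_real_derivative P 1 t) (at t)" if t: "t \<in> {- r<..<r}" for t
    proof (rule has_field_derivative_transform_within_open)
      show "(P 0 has_real_derivative P 1 t) (at t)" using DP[OF t, of 0] by simp
      show "open {- r<..<r}" by simp
      show "P 0 x = \<xi> x" if "x \<in> {- r<..<r}" for x using that by (subst \<xi>eq) (auto simp: P_def)
    qed (rule t)
    show "(P 1 has_real_derivative P 2 t) (at t)" "(P 2 has_real_derivative P 3 t) (at t)"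
      "(P 3 has_real_derivative P 4 t) (at t)" if t: "t \<in> {- r<..<r}" for t
      using DP[OF t, of 1] DP[OF t, of 2] DP[OF t, of 3] by (simp_all add: eval_nat_numeral)
    show "continuous_on {- r<..<r} (P 4)"
      by (rule DERIV_continuous_on) (rule has_field_derivative_at_within, rule DP)
    have "P 1 0 = diffs c 0" by (simp add: P_def powser_zero)
    then show "P 1 0 = 0" by (simp add: diffs_def c_def)
    have "P 2 0 = (diffs ^^ 2) c 0" unfolding P_def by (rule powser_zero)
    then show "P 2 0 \<ge> 0" using c0 by (simp add: D2)
    show "P 2 t > 0" if t: "t \<in> {0<..<r}" for t
    proof -
      have "\<exists>n. c (n + 2) > 0"
      proof (rule ccontr)
        assume n: "\<not> (\<exists>n. c (n + 2) > 0)"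
        have c00: "c n = 0" for n
        proof (cases "n < 2")
          case False
          then have "n = (n - 2) + 2" by simp
          then have "c n = c ((n - 2) + 2)" by (rule arg_cong)
          moreover have "c ((n - 2) + 2) \<le> 0" using n by (meson not_le)
          ultimately show ?thesis using c0[of n] by linarith
        qed (simp add: c_def)
        obtain t where t: "t \<in> {0..1}" "\<xi> t \<noteq> 0" using nontrivial by blast
        have "\<xi> t = (\<Sum>n. c n * t ^ n)" by (rule \<xi>eq) (use t r in auto)
        then show False using t(2) by (simp only: c00) simp
      qed
      then obtain n where n: "c (n + 2) > 0" by blast
      show ?thesis unfolding P_def
      proof (rule suminf_pos2)
        show "summable (\<lambda>n. (diffs ^^ 2) c n * t ^ n)" by (rule sk) (use t in auto)
        show "0 \<le> (diffs ^^ 2) c n * t ^ n" for n using c0 t by (auto simp: D2)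
        show "0 < (diffs ^^ 2) c n * t ^ n" using n t by (simp add: D2)
      qed
    qed
  qed
qed

text \<open>The iterated \<open>deriv\<close> in the definition of the sign function is a genuine derivative on an open
  set where \<open>\<xi>''\<close> is positive, because there all functions involved agree with differentiable ones near
  each point. The witness is \<open>g1 = - x3 * g ^ 3 / 2\<close> with \<open>g = 1 / sqrt x2\<close>.\<close>

lemma sign_fun_formula:
  fixes x1 x2 x3 x4 :: "real \<Rightarrow> real"
  assumes U: "open U"
    and d: "\<And>t. t \<in> U \<Longrightarrow> (\<xi> has_real_derivative x1 t) (at t)"
      "\<And>t. t \<in> U \<Longrightarrow> (x1 has_real_derivative x2 t) (at t)"
      "\<And>t. t \<in> U \<Longrightarrow> (x2 has_real_derivative x3 t) (at t)"
      "\<And>t. t \<in> U \<Longrightarrow> (x3 has_real_derivative x4 t) (at t)"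
    and x4: "continuous_on U x4" and pos: "\<And>t. t \<in> U \<Longrightarrow> x2 t > 0"
  obtains g1 where
    "\<And>t. t \<in> U \<Longrightarrow> ((\<lambda>t. 1 / sqrt (x2 t)) has_real_derivative g1 t) (at t)"
    "\<And>t. t \<in> U \<Longrightarrow> (g1 has_real_derivative sign_fun \<xi> t) (at t)"
    "continuous_on U (sign_fun \<xi>)"
    "\<And>t. t \<in> U \<Longrightarrow> (deriv ^^ 2) \<xi> t = x2 t"
proof -
  define g where "g t = 1 / sqrt (x2 t)" for t
  define g1 where "g1 t = - x3 t * (g t)^3 / 2" for t
  define g2 where "g2 t = - x4 t * (g t)^3 / 2 + 3 * (x3 t)\<^sup>2 * (g t)^5 / 4" for t
  have e1: "deriv \<xi> t = x1 t" if "t \<in> U" for t using d(1)[OF that] by (rule DERIV_imp_deriv)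
  have e2: "(deriv ^^ 2) \<xi> t = x2 t" if "t \<in> U" for t
  proof -
    have "(deriv \<xi> has_real_derivative x2 t) (at t)"
      by (rule has_field_derivative_transform_within_open[OF d(2)[OF that] U that]) (simp add: e1)
    then show ?thesis by (simp add: numeral_2_eq_2 DERIV_imp_deriv)
  qed
  have Dg: "(g has_real_derivative g1 t) (at t)" if "t \<in> U" for t
  proof -
    have p: "x2 t > 0" using pos that by blast
    have "(g has_real_derivative - (x3 t * (inverse (sqrt (x2 t)) / 2)) / (sqrt (x2 t) * sqrt (x2 t))) (at t)"
      unfolding g_def[abs_def] using p by (auto intro!: derivative_eq_intros d(3)[OF that])
    moreover have "- (x3 t * (inverse (sqrt (x2 t)) / 2)) / (sqrt (x2 t) * sqrt (x2 t)) = g1 t"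
    proof -
      have "- (y * (inverse q / 2)) / (q * q) = - y * (1 / q) ^ 3 / 2" if "q > 0" for y q :: real
        using that by (simp add: field_simps power3_eq_cube)
      from this[of "sqrt (x2 t)"] p show ?thesis unfolding g1_def g_def by simp
    qed
    ultimately show ?thesis by simp
  qed
  have Dg1: "(g1 has_real_derivative g2 t) (at t)" if "t \<in> U" for t
  proof -
    have "((\<lambda>t. - x3 t * g t ^ 3 / 2) has_real_derivative
        (- x4 t * g t ^ 3 + (of_nat 3 * (g1 t * g t ^ (3 - Suc 0))) * - x3 t) / 2) (at t)"
      by (intro DERIV_cdivide DERIV_mult DERIV_minus DERIV_power Dg[OF that] d(4)[OF that])
    moreover have "(- x4 t * g t ^ 3 + (of_nat 3 * (g1 t * g t ^ (3 - Suc 0))) * - x3 t) / 2 = g2 t"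
      by (simp add: g2_def g1_def power2_eq_square eval_nat_numeral)
    ultimately show ?thesis by (simp add: g1_def[abs_def])
  qed
  have s2: "sign_fun \<xi> t = g2 t" if "t \<in> U" for t
  proof -
    let ?f = "\<lambda>t. 1 / sqrt ((deriv ^^ 2) \<xi> t)"
    have "(?f has_real_derivative g1 t) (at t)" if "t \<in> U" for t
      by (rule has_field_derivative_transform_within_open[OF Dg[OF that] U that]) (simp add: e2 g_def)
    then have d1: "deriv ?f t = g1 t" if "t \<in> U" for t using that by (intro DERIV_imp_deriv)
    have "(deriv ?f has_real_derivative g2 t) (at t)"
      by (rule has_field_derivative_transform_within_open[OF Dg1[OF that] U that]) (simp only: d1)
    then show ?thesis by (simp add: sign_fun_def numeral_2_eq_2 DERIV_imp_deriv)
  qed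
  have "continuous_on U g2"
  proof -
    have "continuous_on U g" "continuous_on U x3"
      by (auto intro!: DERIV_continuous_on[OF has_field_derivative_at_within] Dg d(4))
    then show ?thesis unfolding g2_def[abs_def] by (intro continuous_intros x4) auto
  qed
  then have "continuous_on U (sign_fun \<xi>)" using s2 by (simp cong: continuous_on_cong)
  then show ?thesis using that[of g1] Dg Dg1 s2 e2 by (simp add: g_def[abs_def])
qed

section \<open>Contact throughout an interval\<close>

lemma boundary_min_deriv:
  fixes f :: "real \<Rightarrow> real"
  assumes d: "(f has_real_derivative d) (at s within {0..<1})" and s: "s \<in> {0..<1}" "f s = 0"
    and f: "\<And>t. t \<in> {0..<1} \<Longrightarrow> f t \<ge> 0"
  shows "d \<ge> 0" "s > 0 \<Longrightarrow> d = 0"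
proof -
  show z: "d = 0" if "s > 0"
  proof -
    have "at s within {0..<1} = at s"
      by (rule at_within_interior) (use that s in auto)
    then have "(f has_real_derivative d) (at s)" using d by simp
    then show ?thesis
      by (rule DERIV_local_min[where d = "min s (1 - s)"]) (use that s f in \<open>auto simp: abs_less_iff\<close>)
  qed
  show "d \<ge> 0"
  proof (cases "s > 0")
    case False
    then have s0: "s = 0" using s by auto
    have "((\<lambda>t. (f t - f s) / (t - s)) \<longlongrightarrow> d) (at s within {0..<1})"
      using d by (simp add: has_field_derivative_iff)
    then show ?thesis
      by (rule tendsto_lowerbound)
        (use s0 s f at_within_01_nonbot[OF s(1)] in \<open>auto simp: eventually_at_filter intro!: always_eventually\<close>)
  qed (use z in simp)
qed

text \<open>At \<open>0\<close> the minimum of \<open>\<eta> - \<xi>\<close> only gives a non-negative one-sided derivative, but the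
  boundary condition makes it \<open>- h\<^sup>2\<close>.\<close>

lemma contact_deriv:
  assumes \<Lambda>: "\<eta> \<in> Lambda \<xi> h"
    and x1: "\<And>t. t \<in> {0..<1} \<Longrightarrow> (\<xi> has_real_derivative x1 t) (at t within {0..<1})" "x1 0 = 0"
    and s: "s \<in> contact_set \<xi> \<eta>"
  shows "deriv01 \<eta> s = x1 s"
proof -
  have X: "\<eta> \<in> X_space" and ge: "\<And>t. t \<in> {0..<1} \<Longrightarrow> \<xi> t \<le> \<eta> t" and d0: "deriv01 \<eta> 0 = - h\<^sup>2"
    using \<Lambda> by (auto simp: Lambda_def)
  have s': "s \<in> {0..<1}" "\<eta> s = \<xi> s" using s by (auto simp: contact_set_def)
  have D: "((\<lambda>t. \<eta> t - \<xi> t) has_real_derivative (deriv01 \<eta> s - x1 s)) (at s within {0..<1})"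
    by (intro DERIV_diff X_space_deriv01[OF X] x1 s')
  have b: "0 \<le> deriv01 \<eta> s - x1 s" "s > 0 \<Longrightarrow> deriv01 \<eta> s - x1 s = 0"
    by (rule boundary_min_deriv[OF D s'(1)]; use s' ge in auto)+
  show ?thesis
  proof (cases "s > 0")
    case False
    then have "s = 0" using s' by auto
    then show ?thesis using b(1) d0 x1(2) by simp
  qed (use b in simp)
qed

text \<open>The competitor follows the obstacle on \<open>[\<alpha>,\<beta>]\<close>. The moment conditions hold because \<open>\<xi> - \<eta>\<close> and
  its derivative vanish at both end points. The tangent line of the square root at \<open>x2 s\<close> and two
  integrations by parts then show that the comparison principle can only hold with equality.\<close>

lemma contact_interval:
  fixes x1 x2 g' g'' :: "real \<Rightarrow> real"
  assumes opt: "optimal \<xi> h \<eta>"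
    and B: "\<And>s. s \<in> {0..<1} \<Longrightarrow> \<xi> s \<le> B"
    and \<alpha>\<beta>: "0 \<le> \<alpha>" "\<alpha> < \<beta>" "\<beta> < 1"
    and x1: "\<And>t. t \<in> {0..<1} \<Longrightarrow> (\<xi> has_real_derivative x1 t) (at t within {0..<1})" "x1 0 = 0"
    and x2: "\<And>t. t \<in> {\<alpha>..\<beta>} \<Longrightarrow> (x1 has_real_derivative x2 t) (at t within {\<alpha>..\<beta>})"
      "continuous_on {\<alpha>..\<beta>} x2" "\<And>t. t \<in> {\<alpha>..\<beta>} \<Longrightarrow> x2 t > 0"
    and g: "\<And>t. t \<in> {\<alpha>..\<beta>} \<Longrightarrow> ((\<lambda>t. 1 / sqrt (x2 t)) has_real_derivative g' t) (at t within {\<alpha>..\<beta>})"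
    and g': "\<And>t. t \<in> {\<alpha>..\<beta>} \<Longrightarrow> (g' has_real_derivative g'' t) (at t within {\<alpha>..\<beta>})"
    and g'': "continuous_on {\<alpha>..\<beta>} g''" "\<And>t. t \<in> {\<alpha>..\<beta>} \<Longrightarrow> g'' t \<le> 0"
    and contact: "\<alpha> \<in> contact_set \<xi> \<eta>" "\<beta> \<in> contact_set \<xi> \<eta>"
  shows "{\<alpha>..\<beta>} \<subseteq> contact_set \<xi> \<eta>"
proof -
  let ?K = "{\<alpha>..\<beta>}"
  have \<Lambda>: "\<eta> \<in> Lambda \<xi> h" using opt by (simp add: optimal_def)
  then have X: "\<eta> \<in> X_space" and ge: "\<And>t. t \<in> {0..<1} \<Longrightarrow> \<xi> t \<le> \<eta> t" by (auto simp: Lambda_def)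
  obtain G where G: "has_curvature \<eta> G" and Gnn: "\<And>s. G s \<ge> 0"
    by (rule Lambda_nonneg_curvature[OF \<Lambda>]) blast
  have [measurable]: "G \<in> borel_measurable borel" by (rule has_curvatureD[OF G])
  define \<phi> where "\<phi> s = \<xi> s - \<eta> s" for s
  define F where "F s = x1 s - deriv01 \<eta> s" for s
  define w where "w s = (if s \<in> ?K then x2 s - G s else 0)" for s
  have \<phi>0: "\<phi> \<alpha> = 0" "\<phi> \<beta> = 0" "\<And>s. s \<in> ?K \<Longrightarrow> \<phi> s \<le> 0"
    using contact ge \<alpha>\<beta> by (auto simp: \<phi>_def contact_set_def)
  have F0: "F \<alpha> = 0" "F \<beta> = 0"
    using contact_deriv[OF \<Lambda> x1 contact(1)] contact_deriv[OF \<Lambda> x1 contact(2)] by (simp_all add: F_def)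
  have D\<phi>: "(\<phi> has_real_derivative F s) (at s within ?K)" if "s \<in> ?K" for s
    unfolding \<phi>_def[abs_def] F_def
    by (rule DERIV_subset[where s = "{0..<1}"], intro DERIV_diff X_space_deriv01[OF X] x1) (use that \<alpha>\<beta> in auto)
  have cF: "continuous_on ?K F"
  proof -
    have "continuous_on ?K (deriv01 \<eta>)"
      by (rule continuous_on_subset[of "{0..<1}"]) (use X \<alpha>\<beta> in \<open>auto simp: X_space_def\<close>)
    moreover have "continuous_on ?K x1" by (rule DERIV_continuous_on[OF x2(1)])
    ultimately show ?thesis unfolding F_def[abs_def] by (intro continuous_intros)
  qed
  have c\<phi>: "continuous_on ?K \<phi>" by (rule DERIV_continuous_on[OF D\<phi>])
  have wm [measurable]: "w \<in> borel_measurable borel"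
  proof -
    have "(\<lambda>s. indicator ?K s *\<^sub>R x2 s) \<in> borel_measurable borel"
      by (rule borel_measurable_continuous_on_indicator[OF _ x2(2)]) simp
    then have "(\<lambda>s. indicator ?K s *\<^sub>R x2 s - indicator ?K s *\<^sub>R G s) \<in> borel_measurable borel" by measurable
    moreover have "(\<lambda>s. indicator ?K s *\<^sub>R x2 s - indicator ?K s *\<^sub>R G s) = w"
      by (auto simp: w_def indicator_def fun_eq_iff)
    ultimately show ?thesis by simp
  qed
  obtain C1 where C1: "\<forall>s\<in>{0..\<beta>}. \<bar>G s\<bar> \<le> C1" using has_curvatureD(2)[OF G \<alpha>\<beta>(3)] by blast
  obtain C2 where C2: "\<And>s. s \<in> ?K \<Longrightarrow> norm (x2 s) \<le> C2"
    using continuous_on_compact_bound[OF compact_Icc x2(2)] by metis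
  have wbd: "\<bar>w s\<bar> \<le> \<bar>C1\<bar> + \<bar>C2\<bar>" for s
  proof (cases "s \<in> ?K")
    case True
    then have "\<bar>G s\<bar> \<le> C1" "\<bar>x2 s\<bar> \<le> C2" using C1 C2 \<alpha>\<beta> by auto
    then show ?thesis using True by (simp add: w_def)
  qed (auto simp: w_def)
  have FK: "F y - F x = integral {x..y} w" if xy: "\<alpha> \<le> x" "x \<le> y" "y \<le> \<beta>" for x y
  proof -
    have 1: "(x2 has_integral (x1 y - x1 x)) {x..y}"
      using xy by (intro fundamental_theorem_of_calculus)
        (auto simp: has_real_derivative_iff_has_vector_derivative[symmetric] intro!: DERIV_subset[OF x2(1)])
    have 2: "G integrable_on {x..y}"
      by (rule bounded_borel_integrable_on[where C = C1]) (use C1 xy \<alpha>\<beta> in auto)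
    have "integral {x..y} w = integral {x..y} (\<lambda>s. x2 s - G s)"
      by (rule Henstock_Kurzweil_Integration.integral_cong) (use xy in \<open>auto simp: w_def\<close>)
    also have "\<dots> = integral {x..y} x2 - integral {x..y} G"
      by (rule Henstock_Kurzweil_Integration.integral_diff) (use 1 2 in auto)
    also have "\<dots> = (x1 y - x1 x) - (deriv01 \<eta> y - deriv01 \<eta> x)"
      using has_curvatureD(3)[OF G, of x y] 1 xy \<alpha>\<beta> by (simp add: integral_unique)
    finally show ?thesis by (simp add: F_def)
  qed
  have F\<phi>: "integral {\<alpha>..s} F = \<phi> s" if "s \<in> ?K" for s
  proof -
    have "(F has_integral (\<phi> s - \<phi> \<alpha>)) {\<alpha>..s}"
      using that by (intro fundamental_theorem_of_calculus)
        (auto simp: has_real_derivative_iff_has_vector_derivative[symmetric] intro!: DERIV_subset[OF D\<phi>])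
    then show ?thesis using \<phi>0 by (simp add: integral_unique)
  qed
  have wint: "w integrable_on {x..y}" for x y by (rule bounded_borel_integrable_on[OF wm wbd])
  \<comment> \<open>As \<open>\<phi>\<close> and its derivative vanish at \<open>\<alpha>\<close>, Taylor's formula consists of the remainder only; so the
    competitor \<open>\<eta> + \<phi>\<close> is \<open>\<xi>\<close>.\<close>
  have taylor: "integral {\<alpha>..s} (\<lambda>r. (s - r) * w r) = \<phi> s" if "s \<in> ?K" for s
  proof -
    have "integral {\<alpha>..s} (\<lambda>r. w r * (s - r)) = F s * (s - s) - F \<alpha> * (s - \<alpha>) - integral {\<alpha>..s} (\<lambda>r. F r * (- 1))"
      by (rule integral_by_parts_density(2)[OF _ wm, of _ _ "\<bar>C1\<bar> + \<bar>C2\<bar>"])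
        (use that wbd FK in \<open>auto intro!: derivative_eq_intros\<close>)
    then show ?thesis using F0 F\<phi>[OF that] by (simp add: mult.commute)
  qed
  have m0: "integral ?K w = 0" using FK[of \<alpha> \<beta>] F0 \<alpha>\<beta> by simp
  have m1: "integral ?K (\<lambda>r. r * w r) = 0"
  proof -
    have "integral ?K (\<lambda>r. w r * r) = F \<beta> * \<beta> - F \<alpha> * \<alpha> - integral ?K (\<lambda>r. F r * 1)"
      by (rule integral_by_parts_density(2)[OF _ wm, of _ _ "\<bar>C1\<bar> + \<bar>C2\<bar>"])
        (use \<alpha>\<beta> wbd FK in \<open>auto intro!: derivative_eq_intros\<close>)
    then show ?thesis using F0 F\<phi>[of \<beta>] \<phi>0 \<alpha>\<beta> by (simp add: mult.commute)
  qed
  have "integral ?K (\<lambda>s. sqrt (G s + w s)) \<le> integral ?K (\<lambda>s. sqrt (G s))"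
  proof (rule comparison_principle[OF opt G B \<alpha>\<beta>(1) _ \<alpha>\<beta>(3) wm wbd _ m0 m1])
    show "AE s in lborel. s \<in> ?K \<longrightarrow> 0 \<le> G s + w s"
      using x2(3) by (intro AE_I2) (auto simp: w_def less_imp_le)
    show "\<xi> s \<le> \<eta> s + integral {\<alpha>..s} (\<lambda>r. (s - r) * w r)" if "s \<in> ?K" for s
      by (simp add: taylor[OF that] \<phi>_def)
  qed (use \<alpha>\<beta> in \<open>auto simp: w_def\<close>)
  also have "integral ?K (\<lambda>s. sqrt (G s + w s)) = integral ?K (\<lambda>s. sqrt (x2 s))"
    by (rule Henstock_Kurzweil_Integration.integral_cong) (simp add: w_def)
  finally have main: "integral ?K (\<lambda>s. sqrt (x2 s)) \<le> integral ?K (\<lambda>s. sqrt (G s))" .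
  define gg where "gg t = 1 / sqrt (x2 t)" for t
  have Dgg: "(gg has_real_derivative g' t) (at t within ?K)" if "t \<in> ?K" for t
    using g[OF that] by (simp add: gg_def[abs_def])
  have cg: "continuous_on ?K gg" "continuous_on ?K g'"
    using DERIV_continuous_on[OF g] DERIV_continuous_on[OF g'] by (simp_all add: gg_def[abs_def])
  \<comment> \<open>All boundary terms vanish, so \<open>gg\<close> tested against \<open>w = \<phi>''\<close> equals \<open>gg''\<close> tested against \<open>\<phi>\<close>.\<close>
  note ibp1 = integral_by_parts_density[OF less_imp_le[OF \<alpha>\<beta>(2)] wm wbd FK Dgg cg(2)]
  have i1: "(\<lambda>r. F r * g' r) integrable_on ?K" and i2: "(\<lambda>r. \<phi> r * g'' r) integrable_on ?K"
    by (intro integrable_continuous_interval continuous_on_mult cF cg c\<phi> g'')+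
  have "((\<lambda>r. F r * g' r + \<phi> r * g'' r) has_integral (\<phi> \<beta> * g' \<beta> - \<phi> \<alpha> * g' \<alpha>)) ?K"
    using \<alpha>\<beta> by (intro fundamental_theorem_of_calculus)
      (auto simp: has_real_derivative_iff_has_vector_derivative[symmetric] mult.commute
        intro!: derivative_eq_intros D\<phi> g')
  then have "integral ?K (\<lambda>r. F r * g' r) + integral ?K (\<lambda>r. \<phi> r * g'' r) = 0"
    using \<phi>0 Henstock_Kurzweil_Integration.integral_add[OF i1 i2] by (simp only: integral_unique)
  moreover have "integral ?K (\<lambda>r. \<phi> r * g'' r) \<ge> 0"
    by (rule Henstock_Kurzweil_Integration.integral_nonneg[OF i2]) (use \<phi>0 g'' in \<open>auto intro: mult_nonpos_nonpos\<close>)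
  ultimately have wg: "integral ?K (\<lambda>r. w r * gg r) \<ge> 0"
    using ibp1(2) F0 by simp
  \<comment> \<open>The gap between the square root and its tangent line at \<open>x2 s\<close>, evaluated at \<open>G s\<close>.\<close>
  define q where "q s = sqrt (x2 s) - w s * gg s / 2 - sqrt (G s)" for s
  have q: "q s = (sqrt (G s) - sqrt (x2 s))\<^sup>2 / (2 * sqrt (x2 s))" if "s \<in> ?K" for s
  proof -
    define y where "y = sqrt (x2 s)"
    define z where "z = sqrt (G s)"
    have y: "y > 0" "x2 s = y\<^sup>2" "G s = z\<^sup>2" using x2(3)[OF that] Gnn[of s] by (auto simp: y_def z_def)
    have "q s = y - (y\<^sup>2 - z\<^sup>2) * (1 / y) / 2 - z"
      unfolding q_def w_def gg_def y_def[symmetric] z_def[symmetric] using that y(2,3) by simp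
    also have "\<dots> = (z - y)\<^sup>2 / (2 * y)" using y(1) by (simp add: field_simps power2_eq_square)
    finally show ?thesis by (simp add: y_def z_def)
  qed
  have isx: "(\<lambda>s. sqrt (x2 s)) integrable_on ?K"
    by (intro integrable_continuous_interval continuous_intros x2)
  have isG: "(\<lambda>s. sqrt (G s)) integrable_on ?K"
    by (rule bounded_borel_integrable_on[where C = "sqrt C1"]) (use C1 \<alpha>\<beta> in \<open>auto intro!: sqrt_abs_le\<close>)
  have iwg: "(\<lambda>s. w s * gg s / 2) integrable_on ?K" using ibp1(1) by (rule integrable_on_divide)
  have q_int: "q integrable_on ?K" unfolding q_def
    by (intro Henstock_Kurzweil_Integration.integrable_diff isx iwg isG)
  have "integral ?K q = integral ?K (\<lambda>s. sqrt (x2 s)) - integral ?K (\<lambda>s. w s * gg s / 2) - integral ?K (\<lambda>s. sqrt (G s))"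
    unfolding q_def
    by (simp add: Henstock_Kurzweil_Integration.integral_diff Henstock_Kurzweil_Integration.integrable_diff isx iwg isG)
  also have "integral ?K (\<lambda>s. w s * gg s / 2) = integral ?K (\<lambda>s. w s * gg s) / 2" by simp
  finally have q_le: "integral ?K q \<le> 0" using main wg by simp
  have q0: "q s \<ge> 0" if "s \<in> ?K" for s
    using q[OF that] x2(3)[OF that] by simp
  have qs: "set_integrable lborel ?K q"
  proof -
    have c1: "set_integrable lborel ?K (\<lambda>s. sqrt (x2 s))"
      unfolding set_integrable_def by (rule borel_integrable_compact) (auto intro!: continuous_intros x2)
    have c2: "set_integrable lborel ?K (\<lambda>s. sqrt (G s))"
      by (rule bounded_borel_set_integrable[where C = "sqrt C1"]) (use C1 \<alpha>\<beta> in \<open>auto intro!: sqrt_abs_le\<close>)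
    have c3: "set_integrable lborel ?K (\<lambda>s. w s * gg s / 2)"
    proof -
      obtain C3 where C3: "\<And>s. s \<in> ?K \<Longrightarrow> norm (gg s) \<le> C3"
        using continuous_on_compact_bound[OF compact_Icc cg(1)] by metis
      have "(\<lambda>s. indicator ?K s *\<^sub>R gg s) \<in> borel_measurable borel"
        by (rule borel_measurable_continuous_on_indicator[OF _ cg(1)]) simp
      then have "set_integrable lborel ?K (\<lambda>s. w s * (indicator ?K s *\<^sub>R gg s) / 2)"
        by (intro bounded_borel_set_integrable[where C = "(\<bar>C1\<bar> + \<bar>C2\<bar>) * C3 / 2"])
          (use C3 wbd in \<open>auto simp: abs_mult intro!: mult_mono\<close>)
      moreover have "(\<lambda>s. indicator ?K s *\<^sub>R (w s * (indicator ?K s *\<^sub>R gg s) / 2)) = (\<lambda>s. indicator ?K s *\<^sub>R (w s * gg s / 2))"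
        by (auto simp: indicator_def fun_eq_iff)
      ultimately show ?thesis by (simp add: set_integrable_def)
    qed
    show ?thesis unfolding q_def by (intro set_integral_diff c1 c2 c3)
  qed
  have "AE s in lborel. s \<in> ?K \<longrightarrow> q s = 0"
    by (rule AE_zero_if_nonneg_integral_nonpos[OF qs _ q_le]) (use q0 in auto)
  then have "AE s in lborel. w s = 0"
  proof eventually_elim
    case (elim s)
    show ?case
    proof (cases "s \<in> ?K")
      case True
      then have "(sqrt (G s) - sqrt (x2 s))\<^sup>2 / (2 * sqrt (x2 s)) = 0" "x2 s > 0" using elim q x2(3) by auto
      then show ?thesis by (simp add: w_def)
    qed (auto simp: w_def)
  qed
  then have w0: "AE s in lborel. (indicator {\<alpha>..t} s *\<^sub>R w s) = 0" for t by (auto elim!: eventually_mono)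
  have Fzero: "F t = 0" if "t \<in> ?K" for t
  proof -
    have "(LINT s:{\<alpha>..t}|lborel. w s) = 0"
      unfolding set_lebesgue_integral_def using w0[of t] by (intro integral_eq_zero_AE)
    moreover have "set_integrable lborel {\<alpha>..t} w" by (rule bounded_borel_set_integrable[OF wm wbd])
    ultimately show ?thesis using FK[of \<alpha> t] F0 that set_borel_integral_eq_integral(2)[of "{\<alpha>..t}" w] by simp
  qed
  have "\<phi> t = 0" if "t \<in> ?K" for t
  proof -
    have "integral {\<alpha>..t} F = integral {\<alpha>..t} (\<lambda>_. 0)"
      by (rule Henstock_Kurzweil_Integration.integral_cong) (use that Fzero in auto)
    then show ?thesis using F\<phi>[OF that] by simp
  qed
  then show ?thesis using \<alpha>\<beta> by (auto simp: contact_set_def \<phi>_def)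
qed

section \<open>No three contact points\<close>

lemma not_AE_pos_if_integral_nonpos:
  fixes k :: "real \<Rightarrow> real"
  assumes k: "set_integrable lborel {x..y} k" and "x < y" and le: "integral {x..y} k \<le> 0"
  shows "\<not> (AE s in lborel. s \<in> {x<..<y} \<longrightarrow> k s > 0)"
proof
  assume ae: "AE s in lborel. s \<in> {x<..<y} \<longrightarrow> k s > 0"
  have "AE s in lborel. s \<in> {x..y} \<longrightarrow> k s \<ge> 0 \<or> s = x \<or> s = y"
    using ae by eventually_elim auto
  then have "AE s in lborel. s \<in> {x..y} \<longrightarrow> k s \<ge> 0"
    using AE_lborel_singleton[of x] AE_lborel_singleton[of y] by eventually_elim auto
  from AE_zero_if_nonneg_integral_nonpos[OF k this le] ae
  have "AE s in lborel. s \<notin> {x<..<y}" by eventually_elim auto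
  then have "{x<..<y} \<in> null_sets lborel" by (subst AE_iff_null_sets) auto
  then show False using \<open>x < y\<close> by auto
qed

lemma measure_pos_if_not_AE:
  fixes P :: "real \<Rightarrow> bool"
  assumes S: "{s \<in> S. P s} \<in> sets borel" "S \<subseteq> {a..b}" and n: "\<not> (AE s in lborel. s \<in> S \<longrightarrow> \<not> P s)"
  shows "0 < measure lborel {s \<in> S. P s}"
proof -
  have "emeasure lborel {s \<in> S. P s} \<noteq> 0"
  proof
    assume "emeasure lborel {s \<in> S. P s} = 0"
    then have "{s \<in> S. P s} \<in> null_sets lborel" using S by auto
    then have "AE s in lborel. s \<notin> {s \<in> S. P s}" by (rule AE_not_in)
    then show False using n by (auto elim: eventually_mono)
  qed
  moreover have "emeasure lborel {s \<in> S. P s} \<le> emeasure lborel {a..b}"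
    by (rule emeasure_mono) (use S in auto)
  then have "emeasure lborel {s \<in> S. P s} < \<infinity>" by (rule le_less_trans) (simp add: emeasure_lborel_Icc_eq)
  ultimately show ?thesis
    by (simp add: measure_def enn2real_positive_iff zero_less_iff_neq_zero)
qed

text \<open>Exhaust the open interval by compact ones: countably many null sets cannot cover a set of positive
  measure.\<close>

lemma positive_measure_inside:
  fixes P :: "real \<Rightarrow> bool"
  assumes P [measurable]: "Measurable.pred borel P"
    and n: "\<not> (AE s in lborel. s \<in> {x<..<y} \<longrightarrow> \<not> P s)"
  obtains e where "e > 0" "\<And>d. 0 < d \<Longrightarrow> d \<le> e \<Longrightarrow> 0 < measure lborel {s \<in> {x + d..y - d}. P s}"
proof -
  define e where "e n = inverse (real (Suc n))" for n
  have "\<exists>n. \<not> (AE s in lborel. s \<in> {x + e n..y - e n} \<longrightarrow> \<not> P s)"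
  proof (rule ccontr)
    assume "\<not> ?thesis"
    then have "AE s in lborel. \<forall>n. s \<in> {x + e n..y - e n} \<longrightarrow> \<not> P s"
      unfolding AE_all_countable by blast
    then have "AE s in lborel. s \<in> {x<..<y} \<longrightarrow> \<not> P s"
    proof eventually_elim
      case (elim s)
      show ?case
      proof
        assume "s \<in> {x<..<y}"
        then have "min (s - x) (y - s) > 0" by simp
        then obtain n where "e n < min (s - x) (y - s)" unfolding e_def using reals_Archimedean by blast
        then have "s \<in> {x + e n..y - e n}" by auto
        then show "\<not> P s" using elim by blast
      qed
    qed
    then show False using n by blast
  qed
  then obtain n where n: "\<not> (AE s in lborel. s \<in> {x + e n..y - e n} \<longrightarrow> \<not> P s)" by blast
  have n': "\<not> (AE s in lborel. s \<in> {x + d..y - d} \<longrightarrow> \<not> P s)" if "d \<le> e n" for d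
  proof
    assume "AE s in lborel. s \<in> {x + d..y - d} \<longrightarrow> \<not> P s"
    then have "AE s in lborel. s \<in> {x + e n..y - e n} \<longrightarrow> \<not> P s"
      by (rule eventually_mono) (use \<open>d \<le> e n\<close> in auto)
    with n show False by blast
  qed
  show ?thesis
  proof (rule that[of "e n"])
    show "e n > 0" by (simp add: e_def)
    show "0 < measure lborel {s \<in> {x + d..y - d}. P s}" if "d \<le> e n" for d
      by (rule measure_pos_if_not_AE[OF _ order_refl n'[OF \<open>d \<le> e n\<close>]]) measurable
  qed
qed

text \<open>Read \<open>m\<close> as the masses and \<open>M\<close> as the first moments of three sets from left to right, separated
  by \<open>y\<close> and \<open>z\<close>. The coefficients come from Cramer's rule; the order of the barycentres gives the
  signs of the determinants.\<close>

lemma balance_masses: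
  fixes mA mB mC MA MB MC y z :: real
  assumes "0 < mA" "0 \<le> mB" "0 < mC" "y < z"
    and "MA \<le> y * mA" "y * mB \<le> MB" "MB \<le> z * mB" "z * mC \<le> MC"
  obtains p q where "p \<ge> 0" "q \<ge> 0" "p * mA + q * mC = mB" "p * MA + q * MC = MB"
proof -
  define D where "D = mA * MC - mC * MA"
  have "mA * MC \<ge> mA * (z * mC)" "mC * MA \<le> mC * (y * mA)" using assms by (simp_all add: mult_left_mono)
  moreover have "mA * (z * mC) - mC * (y * mA) = mA * mC * (z - y)" by (simp add: algebra_simps)
  moreover have "mA * mC * (z - y) > 0" using assms by simp
  ultimately have D: "D > 0" by (simp add: D_def)
  have "mB * MC \<ge> mB * (z * mC)" "mC * MB \<le> mC * (z * mB)" using assms by (simp_all add: mult_left_mono)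
  then have p: "mB * MC - mC * MB \<ge> 0" by (simp add: mult_ac)
  have "mA * MB \<ge> mA * (y * mB)" "mB * MA \<le> mB * (y * mA)" using assms by (simp_all add: mult_left_mono)
  then have q: "mA * MB - mB * MA \<ge> 0" by (simp add: mult_ac)
  show ?thesis
  proof (rule that[of "(mB * MC - mC * MB) / D" "(mA * MB - mB * MA) / D"])
    have "((mB * MC - mC * MB) * mA + (mA * MB - mB * MA) * mC) = mB * D"
      "((mB * MC - mC * MB) * MA + (mA * MB - mB * MA) * MC) = MB * D"
      by (simp_all add: D_def algebra_simps)
    then show "(mB * MC - mC * MB) / D * mA + (mA * MB - mB * MA) / D * mC = mB"
      "(mB * MC - mC * MB) / D * MA + (mA * MB - mB * MA) / D * MC = MB"
      using D by (simp_all add: add_divide_distrib[symmetric])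
  qed (use p q D in auto)
qed

text \<open>Concavity of the square root, in a form that remains usable when \<open>a = 0\<close>.\<close>

lemma sqrt_increment_antimono:
  assumes "0 \<le> a" "a \<le> b" "0 \<le> t"
  shows "sqrt (b + t) - sqrt b \<le> sqrt (a + t) - sqrt a"
proof -
  have "(sqrt (b + t) + sqrt a)\<^sup>2 \<le> (sqrt (a + t) + sqrt b)\<^sup>2"
  proof -
    have "(b + t) * a \<le> (a + t) * b" using assms by (simp add: algebra_simps mult_right_mono)
    then have "sqrt (b + t) * sqrt a \<le> sqrt (a + t) * sqrt b" by (simp add: real_sqrt_mult[symmetric])
    then show ?thesis using assms by (simp add: power2_sum)
  qed
  then have "sqrt (b + t) + sqrt a \<le> sqrt (a + t) + sqrt b"
    by (rule power2_le_imp_le) (use assms in auto)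
  then show ?thesis by simp
qed

text \<open>With \<open>y = sqrt (1 + u / x)\<close> the difference of the two sides is a positive multiple of
  \<open>(y - 1)\<^sup>2 * ((y + 1)\<^sup>2 - 1)\<close>.\<close>

lemma sqrt_second_order:
  assumes "x > 0" "u \<ge> - x"
  shows "sqrt (x + u) \<ge> sqrt x + u / (2 * sqrt x) - u\<^sup>2 / (2 * (x * sqrt x))"
proof -
  define q where "q = sqrt x"
  define y where "y = sqrt (1 + u / x)"
  have q: "q > 0" "x = q\<^sup>2" using assms by (auto simp: q_def)
  have y: "y \<ge> 0" "y\<^sup>2 = 1 + u / x" using assms by (auto simp: y_def field_simps)
  have u: "u = q\<^sup>2 * (y\<^sup>2 - 1)" using y(2) q by (simp add: field_simps)
  have "sqrt (x + u) = q * y"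
    using q y u by (intro real_sqrt_unique) (auto simp: power_mult_distrib algebra_simps)
  moreover have "q * y - (q + u / (2 * q) - u\<^sup>2 / (2 * (q\<^sup>2 * q))) = q * ((y - 1)\<^sup>2 / 2 * ((y + 1)\<^sup>2 - 1))"
    unfolding u using q(1) by (simp add: field_simps power2_eq_square)
  moreover have "(y + 1)\<^sup>2 - 1 \<ge> 0" using y(1) by (simp add: power2_eq_square algebra_simps)
  then have "q * ((y - 1)\<^sup>2 / 2 * ((y + 1)\<^sup>2 - 1)) \<ge> 0" using q(1) by simp
  ultimately show ?thesis using q by (simp add: q_def[symmetric])
qed

definition chord :: "(real \<Rightarrow> real) \<Rightarrow> real \<Rightarrow> real \<Rightarrow> real \<Rightarrow> real" where
  "chord f y z r = f y + (f z - f y) / (z - y) * (r - y)"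

lemma chord_eq: "y < z \<Longrightarrow> (z - y) * (f r - chord f y z r) = f r * (z - y) - (f y * (z - r) + f z * (r - y))"
  by (simp add: chord_def field_simps)

lemma chord_above:
  assumes "y < z" "f r * (z - y) \<le> f z * (r - y) + f y * (z - r)"
  shows "f r \<le> chord f y z r"
proof -
  have "(z - y) * (f r - chord f y z r) \<le> 0" using chord_eq[OF assms(1), of f r] assms(2) by simp
  then show ?thesis using assms(1) by (simp add: mult_le_0_iff)
qed

lemma chord_above_strict:
  assumes "y < z" "f r * (z - y) < f z * (r - y) + f y * (z - r)"
  shows "f r < chord f y z r"
proof -
  have "(z - y) * (f r - chord f y z r) < 0" using chord_eq[OF assms(1), of f r] assms(2) by simp
  then show ?thesis using assms(1) by (simp add: mult_less_0_iff)
qed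

lemma chord_below:
  assumes "y < z" "f r * (z - y) \<ge> f z * (r - y) + f y * (z - r)"
  shows "f r \<ge> chord f y z r"
proof -
  have "(z - y) * (f r - chord f y z r) \<ge> 0" using chord_eq[OF assms(1), of f r] assms(2) by simp
  then show ?thesis using assms(1) by (simp add: zero_le_mult_iff)
qed

text \<open>Curvature is moved from a set \<open>Bs\<close> just behind the middle contact point to sets \<open>A\<close> and \<open>C\<close> in
  the two gaps. On \<open>A\<close> and \<open>C\<close> the curvature of \<open>\<eta>\<close> is at most that of \<open>\<xi>\<close>, on \<open>Bs\<close> it is
  at least that of \<open>\<xi>\<close>; by concavity of the square root the transfer is at least as profitable as it
  would be for \<open>\<xi>\<close> itself, where strict convexity of \<open>1 / sqrt \<xi>''\<close> makes it profitable to first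
  order. All sets lie in a compact subinterval of \<open>(s1,s3)\<close>, since \<open>\<xi>''\<close> may vanish at \<open>s1 = 0\<close>.\<close>

lemma no_three_contacts:
  fixes x1 x2 :: "real \<Rightarrow> real"
  assumes opt: "optimal \<xi> h \<eta>"
    and B: "\<And>s. s \<in> {0..<1} \<Longrightarrow> \<xi> s \<le> B"
    and x1: "\<And>t. t \<in> {0..<1} \<Longrightarrow> (\<xi> has_real_derivative x1 t) (at t within {0..<1})" "x1 0 = 0"
    and x2: "\<And>t. t \<in> {s1..s3} \<Longrightarrow> (x1 has_real_derivative x2 t) (at t within {s1..s3})"
      "continuous_on {s1..s3} x2" "\<And>t. t \<in> {s1<..<s3} \<Longrightarrow> x2 t > 0"
    and convex: "\<And>x y z. s1 < x \<Longrightarrow> x < y \<Longrightarrow> y < z \<Longrightarrow> z < s3 \<Longrightarrow>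
        1 / sqrt (x2 y) * (z - x) < 1 / sqrt (x2 z) * (y - x) + 1 / sqrt (x2 x) * (z - y)"
    and order: "s1 < s2" "s2 < s3"
    and contact: "s1 \<in> contact_set \<xi> \<eta>" "s2 \<in> contact_set \<xi> \<eta>" "s3 \<in> contact_set \<xi> \<eta>"
  shows False
proof -
  have \<Lambda>: "\<eta> \<in> Lambda \<xi> h" using opt by (simp add: optimal_def)
  then have X: "\<eta> \<in> X_space" and ge: "\<And>t. t \<in> {0..<1} \<Longrightarrow> \<xi> t \<le> \<eta> t" by (auto simp: Lambda_def)
  have s01: "0 \<le> s1" "s3 < 1" using contact by (auto simp: contact_set_def)
  obtain G where G: "has_curvature \<eta> G" and Gnn: "\<And>s. G s \<ge> 0"
    by (rule Lambda_nonneg_curvature[OF \<Lambda>]) blast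
  have [measurable]: "G \<in> borel_measurable borel" by (rule has_curvatureD[OF G])
  define F where "F s = deriv01 \<eta> s - x1 s" for s
  have F0: "F s1 = 0" "F s2 = 0" "F s3 = 0"
    using contact_deriv[OF \<Lambda> x1] contact by (simp_all add: F_def)
  define k where "k s = indicator {s1..s3} s * G s - indicator {s1..s3} s *\<^sub>R x2 s" for s
  have km [measurable]: "k \<in> borel_measurable borel"
  proof -
    have [measurable]: "(\<lambda>s. indicator {s1..s3} s *\<^sub>R x2 s) \<in> borel_measurable borel"
      by (rule borel_measurable_continuous_on_indicator[OF _ x2(2)]) simp
    show ?thesis unfolding k_def by measurable
  qed
  have k_in: "k s = G s - x2 s" if "s \<in> {s1..s3}" for s using that by (simp add: k_def)
  obtain C1 where C1: "\<forall>s\<in>{0..s3}. \<bar>G s\<bar> \<le> C1" using has_curvatureD(2)[OF G s01(2)] by blast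
  obtain C2 where C2: "\<And>s. s \<in> {s1..s3} \<Longrightarrow> norm (x2 s) \<le> C2"
    using continuous_on_compact_bound[OF compact_Icc x2(2)] by metis
  have kbd: "\<bar>k s\<bar> \<le> \<bar>C1\<bar> + \<bar>C2\<bar>" for s
  proof (cases "s \<in> {s1..s3}")
    case True
    then have "\<bar>G s\<bar> \<le> C1" "\<bar>x2 s\<bar> \<le> C2" using C1 C2 s01 by auto
    then show ?thesis using True by (simp add: k_def)
  qed (auto simp: k_def)
  have kset: "set_integrable lborel {x..y} k" for x y by (rule bounded_borel_set_integrable[OF km kbd])
  have mkset: "set_integrable lborel {x..y} (\<lambda>s. - k s)" for x y
    by (rule bounded_borel_set_integrable[where C = "\<bar>C1\<bar> + \<bar>C2\<bar>"]) (use kbd in auto)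
  have FK: "F y - F x = integral {x..y} k" if xy: "s1 \<le> x" "x \<le> y" "y \<le> s3" for x y
  proof -
    have 1: "(x2 has_integral (x1 y - x1 x)) {x..y}"
      using xy by (intro fundamental_theorem_of_calculus)
        (auto simp: has_real_derivative_iff_has_vector_derivative[symmetric] intro!: DERIV_subset[OF x2(1)])
    have 2: "G integrable_on {x..y}"
      by (rule bounded_borel_integrable_on[where C = C1]) (use C1 xy s01 in auto)
    have "integral {x..y} k = integral {x..y} (\<lambda>s. G s - x2 s)"
      by (rule Henstock_Kurzweil_Integration.integral_cong) (use xy in \<open>auto simp: k_in\<close>)
    also have "\<dots> = integral {x..y} G - integral {x..y} x2"
      by (rule Henstock_Kurzweil_Integration.integral_diff) (use 1 2 in auto)
    also have "\<dots> = (deriv01 \<eta> y - deriv01 \<eta> x) - (x1 y - x1 x)"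
      using has_curvatureD(3)[OF G, of x y] 1 xy s01 by (simp add: integral_unique)
    finally show ?thesis by (simp add: F_def)
  qed
  \<comment> \<open>Otherwise \<open>F\<close>, the derivative of \<open>\<eta> - \<xi>\<close>, would increase strictly between two of its zeros.\<close>
  have nA: "\<not> (AE s in lborel. s \<in> {s1<..<s2} \<longrightarrow> \<not> k s \<le> 0)"
    using not_AE_pos_if_integral_nonpos[OF kset order(1)] FK[of s1 s2] F0 order by (simp add: not_le)
  have nC: "\<not> (AE s in lborel. s \<in> {s2<..<s3} \<longrightarrow> \<not> k s \<le> 0)"
    using not_AE_pos_if_integral_nonpos[OF kset order(2)] FK[of s2 s3] F0 order by (simp add: not_le)
  have kP: "Measurable.pred borel (\<lambda>s. k s \<le> 0)" by measurable
  obtain eA where eA: "eA > 0" "\<And>d. 0 < d \<Longrightarrow> d \<le> eA \<Longrightarrow> 0 < measure lborel {s \<in> {s1 + d..s2 - d}. k s \<le> 0}"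
    using positive_measure_inside[OF kP nA] by blast
  obtain eC where eC: "eC > 0" "\<And>d. 0 < d \<Longrightarrow> d \<le> eC \<Longrightarrow> 0 < measure lborel {s \<in> {s2 + d..s3 - d}. k s \<le> 0}"
    using positive_measure_inside[OF kP nC] by blast
  define d where "d = min (min eA eC) (min (s2 - s1) (s3 - s2) / 2)"
  have d: "d > 0" "d \<le> eA" "d \<le> eC" "2 * d \<le> s2 - s1" "2 * d \<le> s3 - s2"
    using eA(1) eC(1) order by (auto simp: d_def min_def field_simps)
  define \<alpha> where "\<alpha> = s1 + d"
  define \<beta> where "\<beta> = s3 - d"
  define z where "z = s2 + d"
  let ?K = "{\<alpha>..\<beta>}"
  have ord: "s1 < \<alpha>" "\<alpha> < s2" "s2 < z" "z \<le> \<beta>" "\<beta> < s3" "0 \<le> \<alpha>" "\<alpha> \<le> \<beta>" "\<beta> < 1"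
    using d order s01 by (auto simp: \<alpha>_def \<beta>_def z_def)
  \<comment> \<open>Otherwise \<open>\<eta> - \<xi>\<close> would become negative to the right of its zero \<open>s2\<close>.\<close>
  have nB: "\<not> (AE s in lborel. s \<in> {s2<..<z} \<longrightarrow> \<not> 0 \<le> k s)"
  proof
    assume ae: "AE s in lborel. s \<in> {s2<..<z} \<longrightarrow> \<not> 0 \<le> k s"
    have Fneg: "F x < 0" if x: "x \<in> {s2<..<z}" for x
    proof (rule ccontr)
      assume "\<not> F x < 0"
      then have "integral {s2..x} (\<lambda>s. - k s) \<le> 0"
        using FK[of s2 x] F0 x ord by auto
      then have "\<not> (AE s in lborel. s \<in> {s2<..<x} \<longrightarrow> - k s > 0)"
        using x by (intro not_AE_pos_if_integral_nonpos mkset) auto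
      moreover have "AE s in lborel. s \<in> {s2<..<x} \<longrightarrow> - k s > 0"
        using ae by (rule eventually_mono) (use x in auto)
      ultimately show False by blast
    qed
    define f where "f t = \<eta> t - \<xi> t" for t
    have Df: "(f has_real_derivative F t) (at t within {0..<1})" if "t \<in> {0..<1}" for t
      unfolding f_def[abs_def] F_def using that by (intro DERIV_diff X_space_deriv01[OF X] x1)
    have "\<exists>x\<in>{s2<..<z}. f z - f s2 = (z - s2) * F x"
    proof -
      have "continuous_on {0..<1} f" by (rule DERIV_continuous_on[OF Df])
      then have c: "continuous_on {s2..z} f" by (rule continuous_on_subset) (use ord in auto)
      have "\<exists>x\<in>{s2<..<z}. f z - f s2 = (\<lambda>u. u * F x) (z - s2)"
      proof (rule mvt[OF ord(3) c])
        fix t assume t: "s2 < t" "t < z"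
        have "at t within {0..<1} = at t"
          by (rule at_within_interior) (use t ord in auto)
        then have "(f has_real_derivative F t) (at t)" using Df[of t] t ord by simp
        then show "(f has_derivative (\<lambda>u. u * F t)) (at t)"
          by (simp add: has_field_derivative_def mult.commute[of _ "F t"])
      qed (metis greaterThanLessThan_iff)
      then show ?thesis by simp
    qed
    then obtain x where "x \<in> {s2<..<z}" "f z - f s2 = (z - s2) * F x" by blast
    then have "f z < f s2" using Fneg[of x] ord mult_pos_neg[of "z - s2" "F x"] by simp
    moreover have "f s2 = 0" "f z \<ge> 0" using contact ge[of z] ord by (auto simp: f_def contact_set_def)
    ultimately show False by simp
  qed
  define A where "A = {s \<in> {\<alpha>..s2 - d}. k s \<le> 0}"
  define C where "C = {s \<in> {z..\<beta>}. k s \<le> 0}"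
  define Bs where "Bs = {s \<in> {s2<..<z}. 0 \<le> k s}"
  have [measurable]: "A \<in> sets borel" "C \<in> sets borel" "Bs \<in> sets borel"
    unfolding A_def C_def Bs_def by measurable
  have pos: "0 < measure lborel A" "0 < measure lborel C" "0 < measure lborel Bs"
  proof -
    show "0 < measure lborel A" using eA(2)[OF d(1,2)] by (simp add: A_def \<alpha>_def)
    show "0 < measure lborel C" using eC(2)[OF d(1,3)] by (simp add: C_def \<beta>_def z_def)
    show "0 < measure lborel Bs" unfolding Bs_def
      by (rule measure_pos_if_not_AE[where a = s2 and b = z, OF _ _ nB]) auto
  qed
  have sub: "A \<subseteq> ?K" "C \<subseteq> ?K" "Bs \<subseteq> ?K" using d ord by (auto simp: A_def C_def Bs_def)
  define m where "m S = integral ?K (\<lambda>r. indicator S r :: real)" for S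
  define M where "M S = integral ?K (\<lambda>r. r * indicator S r :: real)" for S
  have bK: "\<bar>r\<bar> \<le> 1" if "r \<in> ?K" for r using that ord by auto
  have iS: "(\<lambda>r. indicator S r :: real) integrable_on ?K" "(\<lambda>r. r * indicator S r :: real) integrable_on ?K"
    if [measurable]: "S \<in> sets borel" for S
    by (rule bounded_borel_integrable_on[where C = 1]; use bK in \<open>force simp: indicator_def\<close>)+
  have m_eq: "m S = measure lborel S" if [measurable]: "S \<in> sets borel" and S: "S \<subseteq> ?K" for S
  proof -
    have "set_integrable lborel ?K (\<lambda>r. indicator S r :: real)"
      by (rule bounded_borel_set_integrable[where C = 1]) (auto simp: indicator_def)
    then have "m S = (LINT r:?K|lborel. indicator S r)"
      unfolding m_def by (simp add: set_borel_integral_eq_integral(2))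
    also have "\<dots> = (LINT r|lborel. indicator S r)"
      unfolding set_lebesgue_integral_def
      by (rule Bochner_Integration.integral_cong) (use S in \<open>auto simp: indicator_def\<close>)
    finally show ?thesis by simp
  qed
  have M_le: "M S \<le> c * m S" if [measurable]: "S \<in> sets borel" and "\<And>r. r \<in> S \<Longrightarrow> r \<le> c" for S c
    unfolding M_def m_def integral_mult_right[symmetric]
    by (intro integral_le iS integrable_on_mult_right) (use that in \<open>auto simp: indicator_def\<close>)
  have M_ge: "c * m S \<le> M S" if [measurable]: "S \<in> sets borel" and "\<And>r. r \<in> S \<Longrightarrow> c \<le> r" for S c
    unfolding M_def m_def integral_mult_right[symmetric]
    by (intro integral_le iS integrable_on_mult_right) (use that in \<open>auto simp: indicator_def\<close>)
  obtain p q where pq: "p \<ge> 0" "q \<ge> 0" "p * m A + q * m C = m Bs" "p * M A + q * M C = M Bs"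
  proof (rule balance_masses[of "m A" "m Bs" "m C" s2 z "M A" "M Bs" "M C"])
    show "0 < m A" "0 \<le> m Bs" "0 < m C" using pos sub by (simp_all add: m_eq)
    show "M A \<le> s2 * m A" by (rule M_le) (use d in \<open>auto simp: A_def\<close>)
    show "s2 * m Bs \<le> M Bs" by (rule M_ge) (auto simp: Bs_def)
    show "M Bs \<le> z * m Bs" by (rule M_le) (auto simp: Bs_def)
    show "z * m C \<le> M C" by (rule M_ge) (auto simp: C_def)
  qed (use ord that in auto)
  define w where "w r = p * indicator A r + q * indicator C r - indicator Bs r" for r :: real
  have wm [measurable]: "w \<in> borel_measurable borel" unfolding w_def by measurable
  define W0 where "W0 = p + q + 1"
  have wbd: "\<bar>w r\<bar> \<le> W0" for r using pq by (auto simp: w_def W0_def indicator_def)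
  have w_out: "w r = 0" if "r \<notin> ?K" for r
    using that sub by (auto simp: w_def indicator_def)
  have w_off: "w r \<ge> 0" if "r \<notin> {s2<..<z}" for r
    using that pq by (auto simp: w_def Bs_def indicator_def)
  have w_on: "w r = - indicator Bs r" if "r \<in> {s2<..<z}" for r
    using that d by (auto simp: w_def A_def C_def indicator_def)
  have w0: "integral ?K w = 0"
  proof -
    have "integral ?K w = p * m A + q * m C - m Bs"
      unfolding w_def m_def
      by (simp add: Henstock_Kurzweil_Integration.integral_diff Henstock_Kurzweil_Integration.integral_add
          Henstock_Kurzweil_Integration.integrable_add iS integrable_on_mult_right)
    then show ?thesis using pq by simp
  qed
  have w1: "integral ?K (\<lambda>r. r * w r) = 0"
  proof -
    have "(\<lambda>r. r * w r) = (\<lambda>r. p * (r * indicator A r) + q * (r * indicator C r) - r * indicator Bs r)"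
      by (auto simp: w_def algebra_simps)
    then have "integral ?K (\<lambda>r. r * w r) = p * M A + q * M C - M Bs"
      unfolding M_def
      by (simp add: Henstock_Kurzweil_Integration.integral_diff Henstock_Kurzweil_Integration.integral_add
          Henstock_Kurzweil_Integration.integrable_add iS integrable_on_mult_right)
    then show ?thesis using pq by simp
  qed
  have fw: "set_integrable lborel ?K (\<lambda>r. f r * w r)" "(\<lambda>r. f r * w r) integrable_on ?K" if f: "continuous_on ?K f" for f
  proof -
    obtain C3 where C3: "\<And>s. s \<in> ?K \<Longrightarrow> norm (f s) \<le> C3"
      using continuous_on_compact_bound[OF compact_Icc f] by metis
    have "(\<lambda>s. indicator ?K s *\<^sub>R f s) \<in> borel_measurable borel"
      by (rule borel_measurable_continuous_on_indicator[OF _ f]) simp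
    then have "set_integrable lborel ?K (\<lambda>s. (indicator ?K s *\<^sub>R f s) * w s)"
      by (intro bounded_borel_set_integrable[where C = "C3 * W0"])
        (use C3 wbd in \<open>auto simp: abs_mult intro!: mult_mono intro: order_trans[OF abs_ge_zero]\<close>)
    moreover have "(\<lambda>s. indicator ?K s *\<^sub>R ((indicator ?K s *\<^sub>R f s) * w s)) = (\<lambda>s. indicator ?K s *\<^sub>R (f s * w s))"
      by (auto simp: indicator_def fun_eq_iff)
    ultimately show *: "set_integrable lborel ?K (\<lambda>r. f r * w r)" by (simp add: set_integrable_def)
    then show "(\<lambda>r. f r * w r) integrable_on ?K" by (rule set_borel_integral_eq_integral(1))
  qed
  \<comment> \<open>\<open>w\<close> is orthogonal to affine functions, so every \<open>f\<close> may be tested relative to its chord over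
    \<open>[s2,z]\<close>. For convex \<open>f\<close> that difference has the sign of \<open>w\<close> everywhere.\<close>
  have sub_chord: "integral ?K (\<lambda>r. (f r - chord f s2 z r) * w r) = integral ?K (\<lambda>r. f r * w r)"
    if f: "continuous_on ?K f" for f
  proof -
    define u where "u = (f z - f s2) / (z - s2)"
    have "(\<lambda>r. (f r - chord f s2 z r) * w r) = (\<lambda>r. f r * w r - ((f s2 - u * s2) * w r + u * (r * w r)))"
      by (simp add: chord_def u_def[symmetric] algebra_simps)
    moreover have "(\<lambda>r. r * w r) integrable_on ?K" by (rule fw) (rule continuous_on_id)
    moreover have "w integrable_on ?K" by (rule bounded_borel_integrable_on[OF wm wbd])
    ultimately show ?thesis
      by (simp add: Henstock_Kurzweil_Integration.integral_diff Henstock_Kurzweil_Integration.integral_add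
          Henstock_Kurzweil_Integration.integrable_add integrable_on_mult_right fw[OF f] w0 w1)
  qed
  \<comment> \<open>The perturbation at \<open>s\<close> is \<open>w\<close> tested against the convex function \<open>max (s - r) 0\<close>.\<close>
  have v_nonneg: "integral {\<alpha>..s} (\<lambda>r. (s - r) * w r) \<ge> 0" if s: "s \<in> ?K" for s
  proof -
    define f where "f r = max (s - r) 0" for r
    have cf: "continuous_on ?K f" unfolding f_def by (intro continuous_intros)
    have f3: "f y * (z' - x) \<le> f z' * (y - x) + f x * (z' - y)" if "x \<le> y" "y \<le> z'" for x y z'
    proof -
      have "(s - y) * (z' - x) = (s - z') * (y - x) + (s - x) * (z' - y)" by (simp add: algebra_simps)
      also have "\<dots> \<le> f z' * (y - x) + f x * (z' - y)"
        using that by (intro add_mono mult_right_mono) (auto simp: f_def)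
      finally have 1: "(s - y) * (z' - x) \<le> f z' * (y - x) + f x * (z' - y)" .
      have "0 \<le> f z' * (y - x) + f x * (z' - y)" using that by (auto simp: f_def)
      with 1 show ?thesis by (cases "s \<ge> y") (auto simp: f_def)
    qed
    have "0 \<le> integral ?K (\<lambda>r. (f r - chord f s2 z r) * w r)"
    proof (rule Henstock_Kurzweil_Integration.integral_nonneg)
      show "(\<lambda>r. (f r - chord f s2 z r) * w r) integrable_on ?K"
        by (rule fw) (use ord in \<open>auto simp: chord_def intro!: continuous_intros cf\<close>)
      fix r assume "r \<in> ?K"
      consider "r \<in> {s2<..<z}" | "r \<le> s2" | "r \<ge> z" by force
      then show "0 \<le> (f r - chord f s2 z r) * w r"
      proof cases
        case 1
        then have "f r \<le> chord f s2 z r"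
          using f3[of s2 r z] ord by (intro chord_above) (auto simp: algebra_simps)
        then show ?thesis using w_on[OF 1] by (auto simp: indicator_def)
      next
        case 2
        then have "f r \<ge> chord f s2 z r"
          using f3[of r s2 z] ord by (intro chord_below) (auto simp: algebra_simps)
        then show ?thesis using w_off[of r] 2 by auto
      next
        case 3
        then have "f r \<ge> chord f s2 z r"
          using f3[of s2 z r] ord by (intro chord_below) (auto simp: algebra_simps)
        then show ?thesis using w_off[of r] 3 by auto
      qed
    qed
    also have "\<dots> = integral ?K (\<lambda>r. f r * w r)" by (rule sub_chord[OF cf])
    also have "\<dots> = integral {\<alpha>..s} (\<lambda>r. f r * w r) + integral {s..\<beta>} (\<lambda>r. f r * w r)"
      using Henstock_Kurzweil_Integration.integral_combine[OF _ _ fw(2)[OF cf], of s] s by simp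
    also have "integral {s..\<beta>} (\<lambda>r. f r * w r) = integral {s..\<beta>} (\<lambda>r. 0)"
      by (rule Henstock_Kurzweil_Integration.integral_cong) (auto simp: f_def)
    also have "integral {\<alpha>..s} (\<lambda>r. f r * w r) = integral {\<alpha>..s} (\<lambda>r. (s - r) * w r)"
      by (rule Henstock_Kurzweil_Integration.integral_cong) (auto simp: f_def)
    finally show ?thesis by simp
  qed
  define g where "g r = 1 / sqrt (x2 r)" for r
  have conv: "g y * (z' - x) < g z' * (y - x) + g x * (z' - y)" if "s1 < x" "x < y" "y < z'" "z' < s3" for x y z'
    using convex[OF that] by (simp add: g_def)
  have Kin: "r \<in> {s1<..<s3}" if "r \<in> ?K" for r using that ord by auto
  have cx2: "continuous_on ?K x2" by (rule continuous_on_subset[OF x2(2)]) (use ord in auto)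
  have cg: "continuous_on ?K g" unfolding g_def[abs_def]
    by (intro continuous_intros cx2) (use x2(3) Kin in force)
  \<comment> \<open>Strict convexity makes the first variation positive.\<close>
  have I: "integral ?K (\<lambda>r. g r * w r) > 0"
  proof (rule ccontr)
    assume "\<not> ?thesis"
    then have le: "integral ?K (\<lambda>r. (g r - chord g s2 z r) * w r) \<le> 0" by (simp add: sub_chord[OF cg])
    have si: "set_integrable lborel ?K (\<lambda>r. (g r - chord g s2 z r) * w r)"
      by (rule fw) (use ord in \<open>auto simp: chord_def intro!: continuous_intros cg\<close>)
    have above: "g r < chord g s2 z r" if "r \<in> {s2<..<z}" for r
      using that conv[of s2 r z] ord by (intro chord_above_strict) (auto simp: algebra_simps)
    have nn: "0 \<le> (g r - chord g s2 z r) * w r" if r: "r \<in> ?K" for r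
    proof -
      consider "r \<in> {s2<..<z}" | "r < s2" | "r > z" | "r = s2" | "r = z" by force
      then show ?thesis
      proof cases
        case 1
        then show ?thesis using w_on[OF 1] above[OF 1] by (auto simp: indicator_def)
      next
        case 2
        then have "g r \<ge> chord g s2 z r"
          using conv[of r s2 z] ord r by (intro chord_below) (auto simp: algebra_simps)
        then show ?thesis using w_off[of r] 2 by auto
      next
        case 3
        then have "g r \<ge> chord g s2 z r"
          using conv[of s2 z r] ord r by (intro chord_below) (auto simp: algebra_simps)
        then show ?thesis using w_off[of r] 3 by auto
      qed (use ord in \<open>auto simp: chord_def\<close>)
    qed
    have "AE r in lborel. r \<in> ?K \<longrightarrow> (g r - chord g s2 z r) * w r = 0"
      by (rule AE_zero_if_nonneg_integral_nonpos[OF si _ le]) (use nn in auto)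
    then have "AE r in lborel. r \<notin> Bs"
    proof eventually_elim
      case (elim r)
      show ?case
      proof
        assume r: "r \<in> Bs"
        then have "r \<in> {s2<..<z}" "r \<in> ?K" using sub by (auto simp: Bs_def)
        then show False using elim above[of r] w_on[of r] r by auto
      qed
    qed
    then have "Bs \<in> null_sets lborel" by (subst AE_iff_null_sets) auto
    then show False using pos(3) by (simp add: null_sets_def measure_def)
  qed
  define Iv where "Iv = integral ?K (\<lambda>r. g r * w r)"
  obtain x0 where x0: "x0 \<in> ?K" "\<And>r. r \<in> ?K \<Longrightarrow> x2 x0 \<le> x2 r"
    using continuous_attains_inf[OF compact_Icc _ cx2] ord by auto
  define \<mu> where "\<mu> = x2 x0"
  have \<mu>: "\<mu> > 0" "\<And>r. r \<in> ?K \<Longrightarrow> \<mu> \<le> x2 r" using x0 x2(3) Kin by (auto simp: \<mu>_def)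
  \<comment> \<open>\<open>t\<^sup>2 * Q\<close> bounds the second-order loss of a step of length \<open>t\<close>; \<open>t \<le> \<mu>\<close> keeps the curvature
    non-negative on \<open>Bs\<close>.\<close>
  define Q where "Q = W0\<^sup>2 / (2 * (\<mu> * sqrt \<mu>))"
  have Q: "Q \<ge> 0" using \<mu> by (simp add: Q_def)
  define t where "t = min \<mu> (Iv / (4 * (Q + 1)))"
  have t: "t > 0" "t \<le> \<mu>" "t * Q < Iv / 2"
  proof -
    show t0: "t > 0" using \<mu> I Q by (auto simp: t_def Iv_def intro!: divide_pos_pos)
    show "t \<le> \<mu>" by (simp add: t_def)
    have "t \<le> Iv / (4 * (Q + 1))" by (simp add: t_def)
    then have "t * (4 * (Q + 1)) \<le> Iv" using Q by (simp add: pos_le_divide_eq)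
    moreover have "t * (4 * (Q + 1)) = 4 * (t * Q) + 4 * t" by (simp add: algebra_simps)
    moreover have "t * Q \<ge> 0" using t0 Q by simp
    ultimately show "t * Q < Iv / 2" using t0 by linarith
  qed
  define W where "W r = t * w r" for r
  have pt: "sqrt (G r) + t / 2 * (g r * w r) - t\<^sup>2 * Q \<le> sqrt (G r + W r)" "G r + W r \<ge> 0" if r: "r \<in> ?K" for r
  proof -
    have xr: "x2 r \<ge> \<mu>" "x2 r > 0" using \<mu> r by (auto intro: less_le_trans)
    have kr: "k r = G r - x2 r" using k_in[of r] Kin[OF r] by auto
    have cases: "(w r = - 1 \<and> G r \<ge> x2 r) \<or> (w r \<ge> 0 \<and> G r \<le> x2 r) \<or> w r = 0"
    proof (cases "r \<in> {s2<..<z}")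
      case True
      then show ?thesis using w_on[OF True] kr by (auto simp: indicator_def Bs_def)
    next
      case False
      then show ?thesis using w_off[OF False] kr by (cases "r \<in> A \<union> C") (auto simp: w_def A_def C_def Bs_def indicator_def)
    qed
    have Wc: "W r = - t \<and> G r \<ge> x2 r \<or> W r \<ge> 0"
      using cases t by (auto simp: W_def)
    have Wx: "W r \<ge> - x2 r" using Wc xr t by linarith
    show "G r + W r \<ge> 0" using Wc xr t Gnn[of r] by linarith
    have incr: "sqrt (x2 r + W r) - sqrt (x2 r) \<le> sqrt (G r + W r) - sqrt (G r)"
      using cases
    proof (elim disjE conjE)
      assume "w r = - 1" "x2 r \<le> G r"
      then show ?thesis using sqrt_increment_antimono[of "x2 r - t" "G r - t" t] xr t by (simp add: W_def)
    next
      assume "0 \<le> w r" "G r \<le> x2 r"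
      then show ?thesis using sqrt_increment_antimono[of "G r" "x2 r" "W r"] Gnn[of r] t by (simp add: W_def)
    qed (simp add: W_def)
    have "(W r)\<^sup>2 / (2 * (x2 r * sqrt (x2 r))) \<le> t\<^sup>2 * Q"
    proof -
      have "(W r)\<^sup>2 \<le> (t * W0)\<^sup>2"
        using wbd[of r] t by (intro abs_le_square_iff[THEN iffD1]) (auto simp: W_def abs_mult W0_def intro!: mult_left_mono)
      moreover have "\<mu> * sqrt \<mu> \<le> x2 r * sqrt (x2 r)" using xr \<mu> by (intro mult_mono) auto
      ultimately have "(W r)\<^sup>2 / (2 * (x2 r * sqrt (x2 r))) \<le> (t * W0)\<^sup>2 / (2 * (\<mu> * sqrt \<mu>))"
        using \<mu> by (intro frac_le) auto
      then show ?thesis by (simp add: Q_def power_mult_distrib)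
    qed
    moreover have "W r / (2 * sqrt (x2 r)) = t / 2 * (g r * w r)" by (simp add: W_def g_def)
    ultimately show "sqrt (G r) + t / 2 * (g r * w r) - t\<^sup>2 * Q \<le> sqrt (G r + W r)"
      using sqrt_second_order[OF xr(2) Wx] incr by linarith
  qed
  have Wm [measurable]: "W \<in> borel_measurable borel" unfolding W_def by measurable
  have Wbd: "\<bar>W r\<bar> \<le> t * W0" for r using wbd[of r] t by (simp add: W_def abs_mult mult_left_mono)
  have tw: "(\<lambda>r. f r * W r) = (\<lambda>r. t * (f r * w r))" for f by (simp add: W_def mult_ac)
  have comp: "integral ?K (\<lambda>s. sqrt (G s + W s)) \<le> integral ?K (\<lambda>s. sqrt (G s))"
  proof (rule comparison_principle[OF opt G B ord(6,7,8) Wm Wbd])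
    show "W r = 0" if "r \<notin> ?K" for r using w_out[OF that] by (simp add: W_def)
    show "integral ?K W = 0" "integral ?K (\<lambda>r. r * W r) = 0"
      using w0 w1 tw[of "\<lambda>r. r"] by (simp_all add: W_def[abs_def])
    show "AE s in lborel. s \<in> ?K \<longrightarrow> 0 \<le> G s + W s" using pt(2) by auto
    fix s assume s: "s \<in> ?K"
    have "integral {\<alpha>..s} (\<lambda>r. (s - r) * W r) = t * integral {\<alpha>..s} (\<lambda>r. (s - r) * w r)"
      unfolding tw by simp
    moreover have "\<xi> s \<le> \<eta> s" by (rule ge) (use s ord in auto)
    ultimately show "\<xi> s \<le> \<eta> s + integral {\<alpha>..s} (\<lambda>r. (s - r) * W r)"
      using mult_nonneg_nonneg[OF less_imp_le[OF t(1)] v_nonneg[OF s]] by simp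
  qed
  have Gs: "\<bar>G s\<bar> \<le> C1" if "s \<in> ?K" for s using C1 that ord by auto
  have isG: "(\<lambda>s. sqrt (G s)) integrable_on ?K"
    by (rule bounded_borel_integrable_on[where C = "sqrt C1"]) (use Gs in \<open>auto intro!: sqrt_abs_le\<close>)
  have isGW: "(\<lambda>s. sqrt (G s + W s)) integrable_on ?K"
  proof (rule bounded_borel_integrable_on[where C = "sqrt (C1 + t * W0)"])
    show "\<bar>sqrt (G r + W r)\<bar> \<le> sqrt (C1 + t * W0)" if "r \<in> ?K" for r
      by (rule sqrt_abs_le) (use Gs[OF that] Wbd[of r] in linarith)
  qed measurable
  have igw: "(\<lambda>r. t / 2 * (g r * w r)) integrable_on ?K" using fw(2)[OF cg] by (rule integrable_on_mult_right)
  have ilow: "(\<lambda>r. sqrt (G r) + t / 2 * (g r * w r) - t\<^sup>2 * Q) integrable_on ?K"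
    by (intro Henstock_Kurzweil_Integration.integrable_diff Henstock_Kurzweil_Integration.integrable_add isG igw integrable_const_ivl)
  have "integral ?K (\<lambda>r. sqrt (G r) + t / 2 * (g r * w r) - t\<^sup>2 * Q) \<le> integral ?K (\<lambda>s. sqrt (G s + W s))"
    by (rule integral_le[OF ilow isGW]) (use pt in auto)
  moreover have "integral ?K (\<lambda>r. sqrt (G r) + t / 2 * (g r * w r) - t\<^sup>2 * Q)
      = integral ?K (\<lambda>s. sqrt (G s)) + integral ?K (\<lambda>r. t / 2 * (g r * w r)) - integral ?K (\<lambda>r. t\<^sup>2 * Q)"
    by (subst Henstock_Kurzweil_Integration.integral_diff)
      (intro Henstock_Kurzweil_Integration.integrable_add isG igw integrable_const_ivl
        | simp only: Henstock_Kurzweil_Integration.integral_add[OF isG igw])+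
  moreover have "integral ?K (\<lambda>r. t / 2 * (g r * w r)) = t / 2 * Iv"
    unfolding Iv_def by (rule integral_mult_right)
  moreover have "integral ?K (\<lambda>r. t\<^sup>2 * Q) \<le> t\<^sup>2 * Q"
  proof -
    have "integral ?K (\<lambda>r. t\<^sup>2 * Q) = (\<beta> - \<alpha>) * (t\<^sup>2 * Q)" using ord by simp
    also have "\<dots> \<le> 1 * (t\<^sup>2 * Q)" using ord Q by (intro mult_right_mono) auto
    finally show ?thesis by simp
  qed
  ultimately have "t / 2 * Iv \<le> t\<^sup>2 * Q" using comp by linarith
  moreover have "t * (t * Q) < t * (Iv / 2)" using t by (intro mult_strict_left_mono) auto
  ultimately show False by (simp add: power2_eq_square mult_ac)
qed

section \<open>The rule of signs\<close>

lemma strict_convex_three_points: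
  fixes g g1 g2 :: "real \<Rightarrow> real"
  assumes g: "\<And>t. t \<in> {a<..<b} \<Longrightarrow> (g has_real_derivative g1 t) (at t)"
    and g1: "\<And>t. t \<in> {a<..<b} \<Longrightarrow> (g1 has_real_derivative g2 t) (at t)"
    and g2: "\<And>t. t \<in> {a<..<b} \<Longrightarrow> g2 t > 0"
    and o: "a < x" "x < y" "y < z" "z < b"
  shows "g y * (z - x) < g z * (y - x) + g x * (z - y)"
proof -
  obtain u where u: "x < u" "u < y" "g y - g x = (y - x) * g1 u"
    using MVT2[OF o(2), of g g1] g o by auto
  obtain v where v: "y < v" "v < z" "g z - g y = (z - y) * g1 v"
    using MVT2[OF o(3), of g g1] g o by auto
  obtain t where t: "u < t" "t < v" "g1 v - g1 u = (v - u) * g2 t"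
    using MVT2[of u v g1 g2] g1 o u v by auto
  have "(v - u) * g2 t > 0" using g2[of t] t u v o by (intro mult_pos_pos) auto
  then have "(y - x) * (z - y) * g1 u < (y - x) * (z - y) * g1 v"
    using t(3) o by (intro mult_strict_left_mono) auto
  then have "(g y - g x) * (z - y) < (g z - g y) * (y - x)"
    by (simp only: u(3) v(3)) (simp add: mult_ac)
  then show ?thesis by (simp add: algebra_simps)
qed

text \<open>A concave function lies below its tangent line at \<open>c\<close>, hence is bounded near \<open>0\<close>; so its
  reciprocal square stays away from \<open>0\<close>.\<close>

lemma concave_reciprocal_sqrt_bounded_below:
  fixes x2 g1 g2 :: "real \<Rightarrow> real"
  assumes c: "0 < c"
    and g: "\<And>t. t \<in> {0<..c} \<Longrightarrow> ((\<lambda>t. 1 / sqrt (x2 t)) has_real_derivative g1 t) (at t)"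
    and g1: "\<And>t. t \<in> {0<..c} \<Longrightarrow> (g1 has_real_derivative g2 t) (at t)"
    and g2: "\<And>t. t \<in> {0<..c} \<Longrightarrow> g2 t \<le> 0"
    and pos: "\<And>t. t \<in> {0<..c} \<Longrightarrow> x2 t > 0"
    and lim: "(x2 \<longlongrightarrow> x2 0) (at_right 0)"
  shows "x2 0 > 0"
proof -
  define g where "g t = 1 / sqrt (x2 t)" for t
  define M where "M = g c + c * \<bar>g1 c\<bar>"
  have M: "M > 0" using pos[of c] c by (auto simp: M_def g_def intro!: add_pos_nonneg)
  have low: "x2 s \<ge> (1 / M)\<^sup>2" if s: "0 < s" "s < c" for s
  proof -
    obtain u where u: "s < u" "u < c" "g c - g s = (c - s) * g1 u"
      using MVT2[OF s(2), of g g1] g s by (auto simp: g_def[abs_def])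
    obtain v where v: "u < v" "v < c" "g1 c - g1 u = (c - u) * g2 v"
      using MVT2[OF u(2), of g1 g2] g1 s u by auto
    have "g1 u \<ge> g1 c" using v g2[of v] u s mult_nonneg_nonpos[of "c - u" "g2 v"] by simp
    then have "(c - s) * g1 u \<ge> (c - s) * (- \<bar>g1 c\<bar>)" using s by (intro mult_left_mono) auto
    moreover have "(c - s) * \<bar>g1 c\<bar> \<le> c * \<bar>g1 c\<bar>" using s by (intro mult_right_mono) auto
    ultimately have "g s \<le> M" using u(3) by (simp add: M_def)
    moreover have "sqrt (x2 s) > 0" using pos[of s] s by simp
    ultimately have "1 / M \<le> sqrt (x2 s)" using M by (simp add: g_def field_simps)
    then have "(1 / M)\<^sup>2 \<le> (sqrt (x2 s))\<^sup>2" using M by (intro power_mono) auto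
    then show ?thesis using pos[of s] s by simp
  qed
  have "(1 / M)\<^sup>2 \<le> x2 0"
    by (rule tendsto_lowerbound[OF lim]) (use low c in \<open>auto intro: eventually_at_rightI[of 0 c]\<close>)
  then show ?thesis using M by (auto intro: less_le_trans[of _ "(1 / M)\<^sup>2"])
qed

lemma three_increasing_elements:
  fixes S :: "real set"
  assumes "\<not> (finite S \<and> card S \<le> 2)"
  obtains x y z where "x \<in> S" "y \<in> S" "z \<in> S" "x < y" "y < z"
proof -
  obtain T where T: "T \<subseteq> S" "card T = 3"
  proof (cases "finite S")
    case True
    then have "3 \<le> card S" using assms by simp
    then show ?thesis using obtain_subset_with_card_n that by metis
  next
    case False
    then show ?thesis using infinite_arbitrarily_large that by metis
  qed
  then obtain x y z where "T = {x, y, z}" "x \<noteq> y" "y \<noteq> z" "x \<noteq> z"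
    by (auto simp: card_3_iff)
  then show ?thesis
    using T(1) that[of x y z] that[of x z y] that[of y x z] that[of y z x] that[of z x y] that[of z y x]
    by force
qed

theorem theorem1p3:
  fixes \<beta> :: real and b :: "nat \<Rightarrow> real" and \<xi> :: "real \<Rightarrow> real" and h :: real
    and \<eta> :: "real \<Rightarrow> real" and a c :: real
  assumes xi: "\<xi> = mixture \<beta> b"
    and nontrivial: "\<exists>t\<in>{0..1}. \<xi> t \<noteq> 0"
    and convergent: "\<exists>\<epsilon>>0. summable (\<lambda>p. \<beta>\<^sup>2 * ((b (p + 2))\<^sup>2 * (1 + \<epsilon>) ^ (p + 2)))"
    and h: "h \<ge> 0"
    and opt: "optimal \<xi> h \<eta>"
    and ac: "0 \<le> a" "a < c" "c < 1"
  shows "((\<forall>s\<in>{a<..<c}. sign_fun \<xi> s > 0) \<longrightarrow>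
            finite (contact_set \<xi> \<eta> \<inter> {a..c}) \<and> card (contact_set \<xi> \<eta> \<inter> {a..c}) \<le> 2)
       \<and> ((\<forall>s\<in>{a..c} \<inter> sign_dom \<xi>. sign_fun \<xi> s \<le> 0) \<longrightarrow>
            a \<in> contact_set \<xi> \<eta> \<longrightarrow> c \<in> contact_set \<xi> \<eta> \<longrightarrow>
            {a..c} \<subseteq> contact_set \<xi> \<eta>)"
proof -
  obtain r x1 x2 x3 x4 where r: "r > 1"
    and D1: "\<And>t. t \<in> {- r<..<r} \<Longrightarrow> (\<xi> has_real_derivative x1 t) (at t)"
    and D2: "\<And>t. t \<in> {- r<..<r} \<Longrightarrow> (x1 has_real_derivative x2 t) (at t)"
    and D3: "\<And>t. t \<in> {- r<..<r} \<Longrightarrow> (x2 has_real_derivative x3 t) (at t)"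
    and D4: "\<And>t. t \<in> {- r<..<r} \<Longrightarrow> (x3 has_real_derivative x4 t) (at t)"
    and c4: "continuous_on {- r<..<r} x4" and x10: "x1 0 = 0"
    and pos: "\<And>t. t \<in> {0<..<r} \<Longrightarrow> x2 t > 0" and x20: "x2 0 \<ge> 0"
    by (rule mixture_regularity[OF xi nontrivial convergent]) blast
  have cx2: "continuous_on {- r<..<r} x2"
    by (rule DERIV_continuous_on[OF has_field_derivative_at_within[OF D3]])
  have c\<xi>: "continuous_on {- r<..<r} \<xi>"
    by (rule DERIV_continuous_on[OF has_field_derivative_at_within[OF D1]])
  have "continuous_on {0..1} \<xi>" by (rule continuous_on_subset[OF c\<xi>]) (use r in auto)
  then obtain B where "\<And>s. s \<in> {0..1} \<Longrightarrow> norm (\<xi> s) \<le> B"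
    using continuous_on_compact_bound[OF compact_Icc] by metis
  then have B: "\<And>s. s \<in> {0..<1} \<Longrightarrow> \<xi> s \<le> B" by fastforce
  have x1: "\<And>t. t \<in> {0..<1} \<Longrightarrow> (\<xi> has_real_derivative x1 t) (at t within {0..<1})"
    by (rule has_field_derivative_at_within[OF D1]) (use r in auto)
  define U where "U = {- r<..<r} \<inter> x2 -` {0<..}"
  have U: "open U" unfolding U_def by (rule continuous_open_preimage[OF cx2]) auto
  have Ur: "t \<in> {- r<..<r}" "x2 t > 0" if "t \<in> U" for t using that by (auto simp: U_def)
  have Upos: "t \<in> U" if "0 < t" "t < 1" for t using that pos[of t] r by (auto simp: U_def)
  obtain g1 where g: "\<And>t. t \<in> U \<Longrightarrow> ((\<lambda>t. 1 / sqrt (x2 t)) has_real_derivative g1 t) (at t)"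
    and g1: "\<And>t. t \<in> U \<Longrightarrow> (g1 has_real_derivative sign_fun \<xi> t) (at t)"
    and cs: "continuous_on U (sign_fun \<xi>)"
    and dd: "\<And>t. t \<in> U \<Longrightarrow> (deriv ^^ 2) \<xi> t = x2 t"
    by (rule sign_fun_formula[OF U D1 D2 D3 D4 continuous_on_subset[OF c4]]) (use Ur in blast)+
  show ?thesis
  proof (rule conjI; intro impI)
    assume sign: "\<forall>s\<in>{a<..<c}. sign_fun \<xi> s > 0"
    show "finite (contact_set \<xi> \<eta> \<inter> {a..c}) \<and> card (contact_set \<xi> \<eta> \<inter> {a..c}) \<le> 2"
    proof (rule ccontr)
      assume "\<not> ?thesis"
      then obtain s1 s2 s3 where s: "s1 \<in> contact_set \<xi> \<eta> \<inter> {a..c}" "s2 \<in> contact_set \<xi> \<eta> \<inter> {a..c}"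
        "s3 \<in> contact_set \<xi> \<eta> \<inter> {a..c}" "s1 < s2" "s2 < s3"
        by (rule three_increasing_elements)
      then have sub: "{s1..s3} \<subseteq> {- r<..<r}" "{s1<..<s3} \<subseteq> {a<..<c}" "\<And>t. t \<in> {a<..<c} \<Longrightarrow> t \<in> U"
        using ac r by (auto intro!: Upos)
      show False
      proof (rule no_three_contacts[OF opt B x1 x10, of s1 s3 x2 s2])
        show "(x1 has_real_derivative x2 t) (at t within {s1..s3})" if "t \<in> {s1..s3}" for t
          by (rule has_field_derivative_at_within[OF D2]) (use that sub in auto)
        show "continuous_on {s1..s3} x2" by (rule continuous_on_subset[OF cx2 sub(1)])
        show "x2 t > 0" if "t \<in> {s1<..<s3}" for t using Ur(2) sub that by blast
        show "1 / sqrt (x2 y) * (z - x) < 1 / sqrt (x2 z) * (y - x) + 1 / sqrt (x2 x) * (z - y)"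
          if "s1 < x" "x < y" "y < z" "z < s3" for x y z
        proof (rule strict_convex_three_points[of a c "\<lambda>t. 1 / sqrt (x2 t)" g1 "sign_fun \<xi>"])
          show "a < x" "x < y" "y < z" "z < c" using that s by auto
        qed (use g g1 sign sub in auto)
      qed (use s in auto)
    qed
  next
    assume sign: "\<forall>s\<in>{a..c} \<inter> sign_dom \<xi>. sign_fun \<xi> s \<le> 0"
      and contact: "a \<in> contact_set \<xi> \<eta>" "c \<in> contact_set \<xi> \<eta>"
    have le: "sign_fun \<xi> t \<le> 0" if "t \<in> U" "t \<in> {a..c}" for t
    proof -
      have "t \<in> sign_dom \<xi>" using that ac Ur(2)[of t] dd[of t] by (auto simp: sign_dom_def)
      then show ?thesis using sign that by blast
    qed
    have aU: "a \<in> U"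
    proof (cases "a = 0")
      case True
      have "x2 0 > 0"
      proof (rule concave_reciprocal_sqrt_bounded_below[of c x2 g1 "sign_fun \<xi>"])
        show "0 < c" using ac by simp
        have "isCont x2 0" using D3[of 0] r by (auto intro: DERIV_isCont)
        then show "(x2 \<longlongrightarrow> x2 0) (at_right 0)" by (simp add: isCont_def filterlim_at_split)
      qed (use g g1 le Ur(2) Upos True ac in auto)
      then show ?thesis using True r by (simp add: U_def)
    qed (use ac in \<open>auto intro!: Upos\<close>)
    have sub: "{a..c} \<subseteq> U" using aU Upos ac by (force simp: le_less)
    show "{a..c} \<subseteq> contact_set \<xi> \<eta>"
    proof (rule contact_interval[OF opt B ac x1 x10, of x2 g1 "sign_fun \<xi>"])
      fix t assume "t \<in> {a..c}"
      then have t: "t \<in> U" using sub by blast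
      show "(x1 has_real_derivative x2 t) (at t within {a..c})"
        by (rule has_field_derivative_at_within[OF D2[OF Ur(1)[OF t]]])
      show "((\<lambda>t. 1 / sqrt (x2 t)) has_real_derivative g1 t) (at t within {a..c})"
        by (rule has_field_derivative_at_within[OF g[OF t]])
      show "(g1 has_real_derivative sign_fun \<xi> t) (at t within {a..c})"
        by (rule has_field_derivative_at_within[OF g1[OF t]])
      show "x2 t > 0" by (rule Ur(2)[OF t])
      show "sign_fun \<xi> t \<le> 0" using le t \<open>t \<in> {a..c}\<close> by blast
    next
      show "continuous_on {a..c} x2" using cx2 by (rule continuous_on_subset) (use sub Ur in blast)
      show "continuous_on {a..c} (sign_fun \<xi>)" using cs sub by (rule continuous_on_subset)
    qed (use contact in auto)
  qed
qed

end
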